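(* Let $(G,\mathfrak S)$ be a hierarchically hyperbolic group, let $\mathfrak S_\infty$ be the set of all unbounded domains in $\mathfrak S$, and let $\Lambda$ be a finite induced subgraph of the orthogonality graph $\mathcal O^{\mathfrak S_\infty}$. Then: (1) If $(G,\mathfrak S)$ satisfies the weak commutativity property and every unbounded domain admits an axial element of $G$ fully supported on it, then there exists a subgroup of $G$ isomorphic to the right-angled Artin group $A(\Lambda)$. (2) If every unbounded domain admits an axial element of $G$ rigidly fully supported on it, then there exists an undistorted subgroup of $G$ isomorphic to $A(\Lambda)$.
   Context: **Notation.** $2^Y$ is the set of non-empty subsets of $Y$; the distance between two sets is the infimum of distances between their points; the image of a set under a map into $2^Y$ is the union of the images of its points; $\mathcal N_E(\cdot)$ is the $E$-neighborhood; $d_U(x,y)$ abbreviates $d_U(\pi_U(x),\pi_U(y))$ for $x,y\in\mathcal X$. **HHS.** A quasi-geodesic space $(\mathcal X,d_{\mathcal X})$ (any two points are joined by a quasi-geodesic of uniform quality) is a hierarchically hyperbolic space (HHS) if there are a constant $E>0$, an index set $\mathfrak S$ (whose elements are called domains) and $E$-hyperbolic geodesic spaces $(\mathcal CU,d_U)$, $U\in\mathfrak S$, such that: (1) Projections: for each $U$ there is $\pi_U:\mathcal X\to 2^{\mathcal CU}$ sending each point to a set of diameter $\le E$; $\pi_U$ is $(E,E)$-coarsely Lipschitz with $E$-quasi-convex image. $U$ is unbounded (bounded) if $\mathcal CU$ has infinite (finite) diameter. (2) Nesting: $\mathfrak S$ has a partial order $\sqsubseteq$, and either $\mathfrak S=\emptyset$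 or $\mathfrak S$ has a unique $\sqsubseteq$-maximal element. $\mathfrak S_U=\{V: V\sqsubseteq U\}$. If $U\sqsubsetneq V$ there are a specified subset $\rho^U_V\subset\mathcal CV$ of diameter $\le E$ and a map $\rho^V_U:\mathcal CV\to 2^{\mathcal CU}$. (3) Orthogonality: a symmetric anti-reflexive relation $\bot$ on $\mathfrak S$; $U\sqsubseteq V$ and $V\bot W$ imply $U\bot W$; $U\bot V$ implies $U,V$ are not $\sqsubseteq$-comparable. For $T\in\mathfrak S$ and $U\in\mathfrak S_T$ with $\{V\in\mathfrak S_T: V\bot U\}\ne\emptyset$ there is $W\in\mathfrak S_T\setminus\{T\}$ (a container for the orthogonal complement of $U$ in $T$) such that $V\bot U$, $V\sqsubseteq T$ imply $V\sqsubseteq W$. (4) Transversality and consistency: if $U,V$ are not orthogonal and neither is nested in the other, they are transverse ($U\pitchfork V$); then there are non-empty $\rho^U_V\subseteq\mathcal CV$, $\rho^V_U\subseteq\mathcal CU$ of diameter $\le E$ with $\min\{d_V(\pi_V(x),\rho^U_V),d_U(\pi_U(x),\rho^V_U)\}\le E$ for all $x\in\mathcal X$. If $U\sqsubsetneq V$, then $\min\{d_V(\pi_V(x),\rho^U_V),\operatorname{diam}_{\mathcal CU}(\pi_U(x)\cup\rho^V_U(\pi_V(x)))\}\le E$ for all $x$. If $U\sqsubseteq V$, then $d_W(\rho^U_W,\rho^V_W)\le E$ whenever $V\sqsubsetneq W$, or $V\pitchfork W$ and $W\not\bot U$. (5) Finite complexity: any set of pairwise $\sqsubseteq$-comparable domains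 has cardinality $\le E$. (6) Large links: for $U\in\mathfrak S$, $x,y\in\mathcal X$ and $n=E\,d_U(\pi_U(x),\pi_U(y))+E$ there are $T_1,\dots,T_{\lfloor n\rfloor}\in\mathfrak S_U\setminus\{U\}$ such that each $T\in\mathfrak S_U\setminus\{U\}$ satisfies $T\sqsubseteq T_i$ for some $i$ or $d_T(\pi_T(x),\pi_T(y))\le E$. (7) Partial realization: for any finite collection of pairwise orthogonal domains $U_i$ and $p_i\in\mathcal CU_i$ there is $x\in\mathcal X$ with $d_{U_i}(\pi_{U_i}(x),p_i)\le E$ for all $i$, and $d_V(\pi_V(x),\rho^{U_i}_V)\le E$ whenever $U_i\sqsubsetneq V$ or $U_i\pitchfork V$. (8) Bounded geodesic image: if $U\sqsubsetneq V$, every geodesic $\gamma\subseteq\mathcal CV$ either meets $\mathcal N_E(\rho^U_V)$ or satisfies $\operatorname{diam}_{\mathcal CU}(\rho^V_U(\gamma))\le E$. (9) Uniqueness: for each $\kappa\ge0$ there is $\theta_u(\kappa)$ such that $d_{\mathcal X}(x,y)\ge\theta_u(\kappa)$ implies $d_U(\pi_U(x),\pi_U(y))\ge\kappa$ for some $U\in\mathfrak S$. **Automorphisms and HHGs.** An automorphism of $(\mathcal X,\mathfrak S)$ is a quasi-isometry $f:\mathcal X\to\mathcal X$, a bijection $f:\mathfrak S\to\mathfrak S$ preserving $\sqsubseteq,\bot,\pitchfork$, and isometries $f:\mathcal CU\to\mathcal C(fU)$ which coarsely commute (uniform constants) with the maps $\pi_U$, and with $\rho^U_V$ for $U\not\bot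 V$. A finitely generated group $G$ is a hierarchically hyperbolic group (HHG) $(G,\mathfrak S)$ if it has an HHS structure on $G$ with a word metric $d_G$ such that each $g\in G$ is an automorphism via left multiplication (giving an action of $G$ on $\mathfrak S$ and compatible isometries $g:\mathcal CU\to\mathcal C(gU)$), the action of $G$ on $\mathfrak S$ is cofinite, $g\pi_U(h)=\pi_{gU}(gh)$ for all $g,h\in G$, $U\in\mathfrak S$, and $g\rho^V_U=\rho^{gV}_{gU}$ whenever $U\pitchfork V$ or $V\sqsubsetneq U$. **Elements.** $g\in G$ is axial if $n\mapsto g^nx$ is a quasi-isometric embedding $\mathbb Z\to G$ for some (equivalently any) $x\in G$. An isometry $h$ of a hyperbolic space is loxodromic if $n\mapsto h^nx$ is a quasi-isometric embedding for some (any) $x$. An axial $g\in G$ is *fully supported* on an unbounded domain $U$ if (i) $g$ stabilizes $U$ and every unbounded domain $V\bot U$; (ii) $g$ acts loxodromically on $\mathcal CU$; (iii) for each unbounded $V\bot U$ there is $Q_{g,V}\ge0$ such that every $\langle g\rangle$-orbit in $\mathcal CV$ has diameter at most $Q_{g,V}$. It is *rigidly fully supported* on $U$ if moreover $g$ acts trivially on $\mathcal CV$ for every unbounded $V\bot U$. $(G,\mathfrak S)$ satisfies the *weak commutativity property* if, whenever $g,h\in G$ are axial elements fully supported on orthogonal unbounded domains, there is some integer $N>0$ such that $g^N$ and $h^N$ commute. **Graphs.** The orthogonality graph $\mathcal O^{\mathfrak S_\infty}$ has vertex set $\mathfrak S_\infty$, two distinct vertices being adjacent iff they are orthogonal. For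 a simplicial graph $\Gamma$, $A(\Gamma)=\langle \mathcal V(\Gamma)\mid [v,w]=1$ whenever $\{v,w\}$ is an edge$\rangle$. A finitely generated subgroup is undistorted if its inclusion is a quasi-isometric embedding. *)

theory Defs
  imports "HOL-Analysis.Analysis" "HOL-Algebra.Group_Action" "HOL-Algebra.Generated_Groups"
begin

section \<open>Coarse geometry of metric spaces\<close>

definition set_dist :: "'a metric \<Rightarrow> 'a set \<Rightarrow> 'a set \<Rightarrow> ennreal" where
  "set_dist m A B = (INF (a, b) \<in> A \<times> B. ennreal (mdist m a b))"

definition mdiam :: "'a metric \<Rightarrow> 'a set \<Rightarrow> ennreal" where
  "mdiam m A = (SUP (a, b) \<in> A \<times> A. ennreal (mdist m a b))"

definition nbhd :: "'a metric \<Rightarrow> real \<Rightarrow> 'a set \<Rightarrow> 'a set" where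
  "nbhd m r A = {x \<in> mspace m. set_dist m {x} A \<le> ennreal r}"

definition qi_embedding_const :: "real \<Rightarrow> real \<Rightarrow> 'a metric \<Rightarrow> 'b metric \<Rightarrow> ('a \<Rightarrow> 'b) \<Rightarrow> bool" where
  "qi_embedding_const K C m m' f \<longleftrightarrow>
     f \<in> mspace m \<rightarrow> mspace m' \<and>
     (\<forall>x\<in>mspace m. \<forall>y\<in>mspace m.
        mdist m x y / K - C \<le> mdist m' (f x) (f y) \<and> mdist m' (f x) (f y) \<le> K * mdist m x y + C)"

definition qi_embedding :: "'a metric \<Rightarrow> 'b metric \<Rightarrow> ('a \<Rightarrow> 'b) \<Rightarrow> bool" where
  "qi_embedding m m' f \<longleftrightarrow> (\<exists>K\<ge>1. \<exists>C\<ge>0. qi_embedding_const K C m m' f)"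

definition int_metric :: "int metric" where
  "int_metric = metric (UNIV, \<lambda>m n. real_of_int \<bar>m - n\<bar>)"

lemma Metric_space_int: "Metric_space UNIV (\<lambda>m n :: int. real_of_int \<bar>m - n\<bar>)"
  by unfold_locales auto

lemma mspace_int_metric: "mspace int_metric = UNIV"
  unfolding int_metric_def by (rule Metric_space.mspace_metric[OF Metric_space_int])

lemma mdist_int_metric: "mdist int_metric m n = real_of_int \<bar>m - n\<bar>"
  unfolding int_metric_def by (subst Metric_space.mdist_metric[OF Metric_space_int]) simp

definition quasi_isometry :: "'a metric \<Rightarrow> 'b metric \<Rightarrow> ('a \<Rightarrow> 'b) \<Rightarrow> bool" where
  "quasi_isometry m m' f \<longleftrightarrow>
     qi_embedding m m' f \<and>
     (\<exists>C\<ge>0. \<forall>y\<in>mspace m'. \<exists>x\<in>mspace m. mdist m' (f x) y \<le> C)"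

definition isometry_onto :: "'a metric \<Rightarrow> 'b metric \<Rightarrow> ('a \<Rightarrow> 'b) \<Rightarrow> bool" where
  "isometry_onto m m' f \<longleftrightarrow>
     f ` mspace m = mspace m' \<and>
     (\<forall>x\<in>mspace m. \<forall>y\<in>mspace m. mdist m' (f x) (f y) = mdist m x y)"

definition quasi_geodesic_space :: "'a metric \<Rightarrow> bool" where
  "quasi_geodesic_space m \<longleftrightarrow>
     (\<exists>K\<ge>1. \<exists>C\<ge>0. \<forall>x\<in>mspace m. \<forall>y\<in>mspace m. \<exists>l\<ge>0. \<exists>\<gamma>.
        qi_embedding_const K C (submetric euclidean_metric {0..l::real}) m \<gamma> \<and> \<gamma> 0 = x \<and> \<gamma> l = y)"

definition geodesic_segment :: "'a metric \<Rightarrow> 'a \<Rightarrow> 'a \<Rightarrow> 'a set \<Rightarrow> bool" where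
  "geodesic_segment m x y P \<longleftrightarrow>
     (\<exists>l\<ge>0. \<exists>\<gamma>. \<gamma> \<in> {0..l::real} \<rightarrow> mspace m \<and>
        (\<forall>s\<in>{0..l}. \<forall>t\<in>{0..l}. mdist m (\<gamma> s) (\<gamma> t) = \<bar>s - t\<bar>) \<and>
        \<gamma> 0 = x \<and> \<gamma> l = y \<and> P = \<gamma> ` {0..l})"

definition geodesic_space :: "'a metric \<Rightarrow> bool" where
  "geodesic_space m \<longleftrightarrow> (\<forall>x\<in>mspace m. \<forall>y\<in>mspace m. \<exists>P. geodesic_segment m x y P)"

definition hyperbolic_space :: "real \<Rightarrow> 'a metric \<Rightarrow> bool" where
  "hyperbolic_space \<delta> m \<longleftrightarrow>
     (\<forall>x y z P Q R. geodesic_segment m x y P \<and> geodesic_segment m y z Q \<and> geodesic_segment m x z R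
        \<longrightarrow> P \<subseteq> nbhd m \<delta> (Q \<union> R))"

definition quasi_convex :: "real \<Rightarrow> 'a metric \<Rightarrow> 'a set \<Rightarrow> bool" where
  "quasi_convex k m A \<longleftrightarrow>
     A \<subseteq> mspace m \<and> (\<forall>x\<in>A. \<forall>y\<in>A. \<forall>P. geodesic_segment m x y P \<longrightarrow> P \<subseteq> nbhd m k A)"


section \<open>Hierarchically hyperbolic spaces\<close>

text \<open>
  The superscript of \<open>\<rho>\<close> comes first: \<open>rho_set H U V\<close> is the subset \<open>\<rho>\<^sup>U\<^sub>V\<close> of \<open>cspace H V\<close>
  (for \<open>U\<close> properly nested in \<open>V\<close> or transverse to \<open>V\<close>), and \<open>rho_map H V U\<close> is the map
  \<open>\<rho>\<^sup>V\<^sub>U\<close> from \<open>cspace H V\<close> to subsets of \<open>cspace H U\<close> (for \<open>U\<close> properly nested in \<open>V\<close>).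
  Values of the fields outside these ranges are irrelevant.
\<close>

record ('x, 'u, 'c) hhs_data =
  dom_set :: "'u set"
  cspace :: "'u \<Rightarrow> 'c metric"
  cproj :: "'u \<Rightarrow> 'x \<Rightarrow> 'c set"
  nest :: "'u \<Rightarrow> 'u \<Rightarrow> bool"
  orth :: "'u \<Rightarrow> 'u \<Rightarrow> bool"
  rho_set :: "'u \<Rightarrow> 'u \<Rightarrow> 'c set"
  rho_map :: "'u \<Rightarrow> 'u \<Rightarrow> 'c \<Rightarrow> 'c set"

definition pnest :: "('x, 'u, 'c, 'm) hhs_data_scheme \<Rightarrow> 'u \<Rightarrow> 'u \<Rightarrow> bool" where
  "pnest H U V \<longleftrightarrow> nest H U V \<and> U \<noteq> V"

definition transverse :: "('x, 'u, 'c, 'm) hhs_data_scheme \<Rightarrow> 'u \<Rightarrow> 'u \<Rightarrow> bool" where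
  "transverse H U V \<longleftrightarrow> \<not> orth H U V \<and> \<not> nest H U V \<and> \<not> nest H V U"

definition below :: "('x, 'u, 'c, 'm) hhs_data_scheme \<Rightarrow> 'u \<Rightarrow> 'u set" where
  "below H U = {V \<in> dom_set H. nest H V U}"

abbreviation cdist :: "('x, 'u, 'c, 'm) hhs_data_scheme \<Rightarrow> 'u \<Rightarrow> 'c set \<Rightarrow> 'c set \<Rightarrow> ennreal" where
  "cdist H U \<equiv> set_dist (cspace H U)"

abbreviation cdiam :: "('x, 'u, 'c, 'm) hhs_data_scheme \<Rightarrow> 'u \<Rightarrow> 'c set \<Rightarrow> ennreal" where
  "cdiam H U \<equiv> mdiam (cspace H U)"

definition unbounded_domains :: "('x, 'u, 'c, 'm) hhs_data_scheme \<Rightarrow> 'u set" where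
  "unbounded_domains H = {U \<in> dom_set H. cdiam H U (mspace (cspace H U)) = \<infinity>}"

text \<open>
  In \<open>rho_set_diam\<close> non-emptiness need not be demanded: \<open>set_dist\<close> to the empty set is
  \<open>\<infinity>\<close>, so it follows from \<open>partial_realization\<close>.

  In \<open>large_links\<close> the family \<open>T\<^sub>1, \<dots>, T\<^sub>n\<close> is read, as usual, as a family of at most \<open>n\<close> domains;
  asking for exactly \<open>n\<close> would be unsatisfiable for \<open>\<sqsubseteq>\<close>-minimal unbounded \<open>U\<close>.
\<close>

locale hhs_const =
  fixes X :: "'x metric" and H :: "('x, 'u, 'c, 'm) hhs_data_scheme" and E :: real
  assumes E_pos: "E > 0"
    and quasi_geodesic: "quasi_geodesic_space X"
    and geodesic: "\<And>U. U \<in> dom_set H \<Longrightarrow> geodesic_space (cspace H U)"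
    and hyperbolic: "\<And>U. U \<in> dom_set H \<Longrightarrow> hyperbolic_space E (cspace H U)"
    and proj_subset: "\<And>U x. U \<in> dom_set H \<Longrightarrow> x \<in> mspace X \<Longrightarrow>
      cproj H U x \<noteq> {} \<and> cproj H U x \<subseteq> mspace (cspace H U)"
    and proj_diam: "\<And>U x. U \<in> dom_set H \<Longrightarrow> x \<in> mspace X \<Longrightarrow> cdiam H U (cproj H U x) \<le> ennreal E"
    and proj_lipschitz: "\<And>U x y. U \<in> dom_set H \<Longrightarrow> x \<in> mspace X \<Longrightarrow> y \<in> mspace X \<Longrightarrow>
      cdist H U (cproj H U x) (cproj H U y) \<le> ennreal (E * mdist X x y + E)"
    and proj_quasi_convex: "\<And>U. U \<in> dom_set H \<Longrightarrow>
      quasi_convex E (cspace H U) (\<Union>x\<in>mspace X. cproj H U x)"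
    and nest_refl: "reflp_on (dom_set H) (nest H)"
    and nest_trans: "transp_on (dom_set H) (nest H)"
    and nest_antisym: "antisymp_on (dom_set H) (nest H)"
    and nest_maximal: "dom_set H = {} \<or>
      (\<exists>!S. S \<in> dom_set H \<and> (\<forall>V\<in>dom_set H. nest H S V \<longrightarrow> V = S))"
    and rho_set_diam: "\<And>U V. U \<in> dom_set H \<Longrightarrow> V \<in> dom_set H \<Longrightarrow> pnest H U V \<Longrightarrow>
      rho_set H U V \<subseteq> mspace (cspace H V) \<and> cdiam H V (rho_set H U V) \<le> ennreal E"
    and rho_map_subset: "\<And>U V p. U \<in> dom_set H \<Longrightarrow> V \<in> dom_set H \<Longrightarrow> pnest H U V \<Longrightarrow>
      p \<in> mspace (cspace H V) \<Longrightarrow>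
      rho_map H V U p \<noteq> {} \<and> rho_map H V U p \<subseteq> mspace (cspace H U)"
    and orth_sym: "symp_on (dom_set H) (orth H)"
    and orth_irrefl: "irreflp_on (dom_set H) (orth H)"
    and orth_nest: "\<And>U V W. U \<in> dom_set H \<Longrightarrow> V \<in> dom_set H \<Longrightarrow> W \<in> dom_set H \<Longrightarrow>
      nest H U V \<Longrightarrow> orth H V W \<Longrightarrow> orth H U W"
    and orth_not_nest: "\<And>U V. U \<in> dom_set H \<Longrightarrow> V \<in> dom_set H \<Longrightarrow> orth H U V \<Longrightarrow>
      \<not> nest H U V \<and> \<not> nest H V U"
    and containers: "\<And>T U. T \<in> dom_set H \<Longrightarrow> U \<in> below H T \<Longrightarrow> {V \<in> below H T. orth H V U} \<noteq> {} \<Longrightarrow>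
      \<exists>W \<in> below H T - {T}. \<forall>V\<in>dom_set H. orth H V U \<and> nest H V T \<longrightarrow> nest H V W"
    and rho_transverse: "\<And>U V. U \<in> dom_set H \<Longrightarrow> V \<in> dom_set H \<Longrightarrow> transverse H U V \<Longrightarrow>
      rho_set H U V \<noteq> {} \<and> rho_set H U V \<subseteq> mspace (cspace H V) \<and> cdiam H V (rho_set H U V) \<le> ennreal E"
    and transverse_consistency: "\<And>U V x. U \<in> dom_set H \<Longrightarrow> V \<in> dom_set H \<Longrightarrow> transverse H U V \<Longrightarrow>
      x \<in> mspace X \<Longrightarrow>
      min (cdist H V (cproj H V x) (rho_set H U V)) (cdist H U (cproj H U x) (rho_set H V U)) \<le> ennreal E"
    and nest_consistency: "\<And>U V x. U \<in> dom_set H \<Longrightarrow> V \<in> dom_set H \<Longrightarrow> pnest H U V \<Longrightarrow>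
      x \<in> mspace X \<Longrightarrow>
      min (cdist H V (cproj H V x) (rho_set H U V))
          (cdiam H U (cproj H U x \<union> (\<Union>p\<in>cproj H V x. rho_map H V U p))) \<le> ennreal E"
    and rho_consistency: "\<And>U V W. U \<in> dom_set H \<Longrightarrow> V \<in> dom_set H \<Longrightarrow> W \<in> dom_set H \<Longrightarrow> nest H U V \<Longrightarrow>
      pnest H V W \<or> (transverse H V W \<and> \<not> orth H W U) \<Longrightarrow>
      cdist H W (rho_set H U W) (rho_set H V W) \<le> ennreal E"
    and finite_complexity: "\<And>C. C \<subseteq> dom_set H \<Longrightarrow> (\<forall>U\<in>C. \<forall>V\<in>C. nest H U V \<or> nest H V U) \<Longrightarrow>
      finite C \<and> real (card C) \<le> E"
    and large_links: "\<And>U x y. U \<in> dom_set H \<Longrightarrow> x \<in> mspace X \<Longrightarrow> y \<in> mspace X \<Longrightarrow>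
      \<exists>\<T> \<subseteq> below H U - {U}. finite \<T> \<and>
        int (card \<T>) \<le> \<lfloor>E * enn2real (cdist H U (cproj H U x) (cproj H U y)) + E\<rfloor> \<and>
        (\<forall>T \<in> below H U - {U}.
           (\<exists>T'\<in>\<T>. nest H T T') \<or> cdist H T (cproj H T x) (cproj H T y) \<le> ennreal E)"
    and partial_realization: "\<And>\<U> p. finite \<U> \<Longrightarrow> \<U> \<subseteq> dom_set H \<Longrightarrow> pairwise (orth H) \<U> \<Longrightarrow>
      (\<forall>U\<in>\<U>. p U \<in> mspace (cspace H U)) \<Longrightarrow>
      \<exists>x\<in>mspace X. \<forall>U\<in>\<U>. cdist H U (cproj H U x) {p U} \<le> ennreal E \<and>
        (\<forall>V\<in>dom_set H. pnest H U V \<or> transverse H U V \<longrightarrow>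
           cdist H V (cproj H V x) (rho_set H U V) \<le> ennreal E)"
    and bounded_geodesic_image: "\<And>U V a b \<gamma>. U \<in> dom_set H \<Longrightarrow> V \<in> dom_set H \<Longrightarrow> pnest H U V \<Longrightarrow>
      geodesic_segment (cspace H V) a b \<gamma> \<Longrightarrow>
      \<gamma> \<inter> nbhd (cspace H V) E (rho_set H U V) \<noteq> {} \<or>
      cdiam H U (\<Union>p\<in>\<gamma>. rho_map H V U p) \<le> ennreal E"
    and uniqueness: "\<And>\<kappa>. \<kappa> \<ge> 0 \<Longrightarrow> \<exists>\<theta>. \<forall>x\<in>mspace X. \<forall>y\<in>mspace X. mdist X x y \<ge> \<theta> \<longrightarrow>
      (\<exists>U\<in>dom_set H. cdist H U (cproj H U x) (cproj H U y) \<ge> ennreal \<kappa>)"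

definition hhs :: "'x metric \<Rightarrow> ('x, 'u, 'c, 'm) hhs_data_scheme \<Rightarrow> bool" where
  "hhs X H \<longleftrightarrow> (\<exists>E. hhs_const X H E)"

text \<open>
  An automorphism consists of a map \<open>f\<close> of the space, a map \<open>s\<close> of the domains and maps
  \<open>c U\<close> from \<open>cspace H U\<close> to \<open>cspace H (s U)\<close>. The last two clauses are coarse commutation with the
  sets \<open>\<rho>\<^sup>U\<^sub>V\<close> and with the maps \<open>\<rho>\<^sup>V\<^sub>U\<close>.
\<close>

definition hhs_automorphism ::
  "'x metric \<Rightarrow> ('x, 'u, 'c, 'm) hhs_data_scheme \<Rightarrow> ('x \<Rightarrow> 'x) \<Rightarrow> ('u \<Rightarrow> 'u) \<Rightarrow> ('u \<Rightarrow> 'c \<Rightarrow> 'c) \<Rightarrow> bool" where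
  "hhs_automorphism X H f s c \<longleftrightarrow>
     quasi_isometry X X f \<and>
     bij_betw s (dom_set H) (dom_set H) \<and>
     (\<forall>U\<in>dom_set H. \<forall>V\<in>dom_set H.
        (nest H (s U) (s V) \<longleftrightarrow> nest H U V) \<and>
        (orth H (s U) (s V) \<longleftrightarrow> orth H U V) \<and>
        (transverse H (s U) (s V) \<longleftrightarrow> transverse H U V)) \<and>
     (\<forall>U\<in>dom_set H. isometry_onto (cspace H U) (cspace H (s U)) (c U)) \<and>
     (\<exists>K\<ge>0.
        (\<forall>U\<in>dom_set H. \<forall>x\<in>mspace X.
           cdist H (s U) (c U ` cproj H U x) (cproj H (s U) (f x)) \<le> ennreal K) \<and>
        (\<forall>U\<in>dom_set H. \<forall>V\<in>dom_set H. pnest H U V \<or> transverse H U V \<longrightarrow>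
           cdist H (s V) (c V ` rho_set H U V) (rho_set H (s U) (s V)) \<le> ennreal K) \<and>
        (\<forall>U\<in>dom_set H. \<forall>V\<in>dom_set H. pnest H U V \<longrightarrow> (\<forall>p\<in>mspace (cspace H V).
           cdist H (s U) (c U ` rho_map H V U p) (rho_map H (s V) (s U) (c V p)) \<le> ennreal K)))"


section \<open>Word metrics\<close>

definition word_length :: "('g, 'b) monoid_scheme \<Rightarrow> 'g set \<Rightarrow> 'g \<Rightarrow> nat" where
  "word_length G S g =
     (LEAST n. \<exists>ws. length ws = n \<and> set ws \<subseteq> S \<union> m_inv G ` S \<and> foldr (mult G) ws \<one>\<^bsub>G\<^esub> = g)"

definition generating_set :: "('g, 'b) monoid_scheme \<Rightarrow> 'g set \<Rightarrow> bool" where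
  "generating_set G S \<longleftrightarrow> S \<subseteq> carrier G \<and> generate G S = carrier G"

text \<open>
  The value outside the carrier only serves to satisfy the global requirements in the type of
  metrics; see \<open>mspace_word_metric\<close> and \<open>mdist_word_metric\<close> below.
\<close>

definition word_metric :: "('g, 'b) monoid_scheme \<Rightarrow> 'g set \<Rightarrow> 'g metric" where
  "word_metric G S = metric (carrier G, \<lambda>x y.
     if x \<in> carrier G \<and> y \<in> carrier G then real (word_length G S (inv\<^bsub>G\<^esub> x \<otimes>\<^bsub>G\<^esub> y)) else 0)"

lemma foldr_mult_append:
  assumes "group G" "set us \<subseteq> carrier G" "set vs \<subseteq> carrier G"
  shows "foldr (mult G) (us @ vs) \<one>\<^bsub>G\<^esub> = foldr (mult G) us \<one>\<^bsub>G\<^esub> \<otimes>\<^bsub>G\<^esub> foldr (mult G) vs \<one>\<^bsub>G\<^esub>"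
proof -
  interpret group G by fact
  have closed: "foldr (mult G) ws \<one>\<^bsub>G\<^esub> \<in> carrier G" if "set ws \<subseteq> carrier G" for ws
    using that by (induction ws) auto
  show ?thesis
    using assms(2,3) by (induction us) (auto simp: closed m_assoc)
qed

lemma word_exists:
  assumes "group G" "generating_set G S" "g \<in> carrier G"
  shows "\<exists>ws. set ws \<subseteq> S \<union> m_inv G ` S \<and> foldr (mult G) ws \<one>\<^bsub>G\<^esub> = g"
proof -
  interpret group G by fact
  have S: "S \<subseteq> carrier G" and "g \<in> generate G S"
    using assms by (auto simp: generating_set_def)
  from this(2) show ?thesis
  proof (induction rule: generate.induct)
    case one
    then show ?case by (intro exI[of _ "[]"]) auto
  next
    case (incl h)
    then show ?case using S by (intro exI[of _ "[h]"]) auto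
  next
    case (inv h)
    then show ?case using S by (intro exI[of _ "[inv\<^bsub>G\<^esub> h]"]) auto
  next
    case (eng h1 h2)
    then obtain us vs where
      "set us \<subseteq> S \<union> m_inv G ` S" "foldr (mult G) us \<one>\<^bsub>G\<^esub> = h1"
      "set vs \<subseteq> S \<union> m_inv G ` S" "foldr (mult G) vs \<one>\<^bsub>G\<^esub> = h2" by blast
    moreover from this have "set us \<subseteq> carrier G" "set vs \<subseteq> carrier G"
      using S by auto
    ultimately show ?case
      using foldr_mult_append[OF assms(1)] by (intro exI[of _ "us @ vs"]) auto
  qed
qed

lemma word_length_witness:
  assumes "group G" "generating_set G S" "g \<in> carrier G"
  obtains ws where "length ws = word_length G S g" "set ws \<subseteq> S \<union> m_inv G ` S"
    "foldr (mult G) ws \<one>\<^bsub>G\<^esub> = g"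
proof -
  have "\<exists>n ws. length ws = n \<and> set ws \<subseteq> S \<union> m_inv G ` S \<and> foldr (mult G) ws \<one>\<^bsub>G\<^esub> = g"
    using word_exists[OF assms] by auto
  from LeastI_ex[OF this] show ?thesis
    using that by (auto simp: word_length_def)
qed

lemma word_length_le:
  assumes "set ws \<subseteq> S \<union> m_inv G ` S" "foldr (mult G) ws \<one>\<^bsub>G\<^esub> = g"
  shows "word_length G S g \<le> length ws"
  unfolding word_length_def using assms by (intro Least_le) auto

lemma word_length_inv_le:
  assumes "group G" "generating_set G S" "g \<in> carrier G"
  shows "word_length G S (inv\<^bsub>G\<^esub> g) \<le> word_length G S g"
proof -
  interpret group G by fact
  have S: "S \<subseteq> carrier G" using assms by (auto simp: generating_set_def)
  obtain ws where ws: "length ws = word_length G S g" "set ws \<subseteq> S \<union> m_inv G ` S"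
    "foldr (mult G) ws \<one>\<^bsub>G\<^esub> = g" by (rule word_length_witness[OF assms])
  have closed: "foldr (mult G) us \<one>\<^bsub>G\<^esub> \<in> carrier G" if "set us \<subseteq> carrier G" for us
    using that by (induction us) auto
  have "foldr (mult G) (rev (map (m_inv G) us)) \<one>\<^bsub>G\<^esub> = inv\<^bsub>G\<^esub> (foldr (mult G) us \<one>\<^bsub>G\<^esub>)"
    if "set us \<subseteq> carrier G" for us
    using that
  proof (induction us)
    case (Cons a us)
    then have "set (rev (map (m_inv G) us)) \<subseteq> carrier G" by auto
    with Cons show ?case
      using foldr_mult_append[OF assms(1), of "rev (map (m_inv G) us)" "[inv\<^bsub>G\<^esub> a]"]
      by (simp add: inv_mult_group closed del: foldr_append)
  qed auto
  moreover have "set ws \<subseteq> carrier G" using ws S by auto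
  ultimately have "foldr (mult G) (rev (map (m_inv G) ws)) \<one>\<^bsub>G\<^esub> = inv\<^bsub>G\<^esub> g"
    using ws by simp
  moreover have "set (rev (map (m_inv G) ws)) \<subseteq> S \<union> m_inv G ` S"
  proof
    fix y assume "y \<in> set (rev (map (m_inv G) ws))"
    then obtain x where x: "x \<in> set ws" "y = inv\<^bsub>G\<^esub> x" by auto
    with ws(2) have "x \<in> S \<or> (\<exists>s\<in>S. x = inv\<^bsub>G\<^esub> s)" by auto
    then show "y \<in> S \<union> m_inv G ` S"
      using x S by auto
  qed
  ultimately show ?thesis
    using word_length_le[of "rev (map (m_inv G) ws)" S G] ws(1) by simp
qed

lemma Metric_space_word_metric:
  assumes "group G" "generating_set G S"
  shows "Metric_space (carrier G) (\<lambda>x y. if x \<in> carrier G \<and> y \<in> carrier G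
    then real (word_length G S (inv\<^bsub>G\<^esub> x \<otimes>\<^bsub>G\<^esub> y)) else 0)"
proof -
  interpret group G by fact
  have S: "S \<subseteq> carrier G" using assms by (auto simp: generating_set_def)
  have sym_le: "word_length G S (inv\<^bsub>G\<^esub> x \<otimes>\<^bsub>G\<^esub> y) \<le> word_length G S (inv\<^bsub>G\<^esub> y \<otimes>\<^bsub>G\<^esub> x)"
    if "x \<in> carrier G" "y \<in> carrier G" for x y
    using word_length_inv_le[OF assms, of "inv\<^bsub>G\<^esub> y \<otimes>\<^bsub>G\<^esub> x"] that by (simp add: inv_mult_group)
  have eq: "word_length G S (inv\<^bsub>G\<^esub> x \<otimes>\<^bsub>G\<^esub> y) = 0 \<longleftrightarrow> x = y"
    if "x \<in> carrier G" "y \<in> carrier G" for x y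
  proof
    assume 0: "word_length G S (inv\<^bsub>G\<^esub> x \<otimes>\<^bsub>G\<^esub> y) = 0"
    obtain ws where "length ws = word_length G S (inv\<^bsub>G\<^esub> x \<otimes>\<^bsub>G\<^esub> y)"
      "foldr (mult G) ws \<one>\<^bsub>G\<^esub> = inv\<^bsub>G\<^esub> x \<otimes>\<^bsub>G\<^esub> y"
      using word_length_witness[OF assms, of "inv\<^bsub>G\<^esub> x \<otimes>\<^bsub>G\<^esub> y"] \<open>x \<in> carrier G\<close> \<open>y \<in> carrier G\<close>
      by (metis inv_closed m_closed)
    with 0 have "inv\<^bsub>G\<^esub> x \<otimes>\<^bsub>G\<^esub> y = \<one>\<^bsub>G\<^esub>" by auto
    with that show "x = y" by (metis inv_closed inv_equality inv_inv)
  next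
    assume "x = y"
    with that show "word_length G S (inv\<^bsub>G\<^esub> x \<otimes>\<^bsub>G\<^esub> y) = 0"
      using word_length_le[of "[]" S G "\<one>\<^bsub>G\<^esub>"] by auto
  qed
  have tri: "word_length G S (inv\<^bsub>G\<^esub> x \<otimes>\<^bsub>G\<^esub> z) \<le>
      word_length G S (inv\<^bsub>G\<^esub> x \<otimes>\<^bsub>G\<^esub> y) + word_length G S (inv\<^bsub>G\<^esub> y \<otimes>\<^bsub>G\<^esub> z)"
    if c: "x \<in> carrier G" "y \<in> carrier G" "z \<in> carrier G" for x y z
  proof -
    obtain us where us: "length us = word_length G S (inv\<^bsub>G\<^esub> x \<otimes>\<^bsub>G\<^esub> y)" "set us \<subseteq> S \<union> m_inv G ` S"
      "foldr (mult G) us \<one>\<^bsub>G\<^esub> = inv\<^bsub>G\<^esub> x \<otimes>\<^bsub>G\<^esub> y"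
      using word_length_witness[OF assms, of "inv\<^bsub>G\<^esub> x \<otimes>\<^bsub>G\<^esub> y"] c by (metis inv_closed m_closed)
    obtain vs where vs: "length vs = word_length G S (inv\<^bsub>G\<^esub> y \<otimes>\<^bsub>G\<^esub> z)" "set vs \<subseteq> S \<union> m_inv G ` S"
      "foldr (mult G) vs \<one>\<^bsub>G\<^esub> = inv\<^bsub>G\<^esub> y \<otimes>\<^bsub>G\<^esub> z"
      using word_length_witness[OF assms, of "inv\<^bsub>G\<^esub> y \<otimes>\<^bsub>G\<^esub> z"] c by (metis inv_closed m_closed)
    have "set us \<subseteq> carrier G" "set vs \<subseteq> carrier G" using us vs S by auto
    then have "foldr (mult G) (us @ vs) \<one>\<^bsub>G\<^esub> = (inv\<^bsub>G\<^esub> x \<otimes>\<^bsub>G\<^esub> y) \<otimes>\<^bsub>G\<^esub> (inv\<^bsub>G\<^esub> y \<otimes>\<^bsub>G\<^esub> z)"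
      by (simp only: foldr_mult_append[OF assms(1)] us vs)
    also have "\<dots> = inv\<^bsub>G\<^esub> x \<otimes>\<^bsub>G\<^esub> z"
      using c by (simp add: m_assoc flip: m_assoc[of y "inv\<^bsub>G\<^esub> y" z])
    finally show ?thesis
      using word_length_le[of "us @ vs" S G] us vs by simp
  qed
  have "word_length G S (inv\<^bsub>G\<^esub> x \<otimes>\<^bsub>G\<^esub> y) = word_length G S (inv\<^bsub>G\<^esub> y \<otimes>\<^bsub>G\<^esub> x)"
    if "x \<in> carrier G" "y \<in> carrier G" for x y
    using sym_le that by (simp add: antisym)
  then show ?thesis
    by unfold_locales (simp_all add: eq tri flip: of_nat_add)
qed

lemma mspace_word_metric:
  assumes "group G" "generating_set G S"
  shows "mspace (word_metric G S) = carrier G"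
  unfolding word_metric_def
  by (rule Metric_space.mspace_metric[OF Metric_space_word_metric[OF assms]])

lemma mdist_word_metric:
  assumes "group G" "generating_set G S" "x \<in> carrier G" "y \<in> carrier G"
  shows "mdist (word_metric G S) x y = real (word_length G S (inv\<^bsub>G\<^esub> x \<otimes>\<^bsub>G\<^esub> y))"
  unfolding word_metric_def
  by (subst Metric_space.mdist_metric[OF Metric_space_word_metric[OF assms(1,2)]]) (use assms in auto)

section \<open>Hierarchically hyperbolic groups\<close>

record ('g, 'u, 'c) hhg_data = "('g, 'u, 'c) hhs_data" +
  act_dom :: "'g \<Rightarrow> 'u \<Rightarrow> 'u"
  act_space :: "'g \<Rightarrow> 'u \<Rightarrow> 'c \<Rightarrow> 'c"

locale hhg = group G
  for G :: "('g, 'b) monoid_scheme" (structure) and S :: "'g set" and H :: "('g, 'u, 'c, 'm) hhg_data_scheme" +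
  assumes finite_gens: "finite S" and gens: "generating_set G S"
    and is_hhs: "hhs (word_metric G S) H"
    and automorphism: "\<And>g. g \<in> carrier G \<Longrightarrow>
      hhs_automorphism (word_metric G S) H (\<lambda>x. g \<otimes> x) (act_dom H g) (act_space H g)"
    and dom_action: "group_action G (dom_set H) (act_dom H)"
    and space_action: "\<And>g h U p. g \<in> carrier G \<Longrightarrow> h \<in> carrier G \<Longrightarrow> U \<in> dom_set H \<Longrightarrow>
      p \<in> mspace (cspace H U) \<Longrightarrow>
      act_space H (g \<otimes> h) U p = act_space H g (act_dom H h U) (act_space H h U p)"
    and cofinite: "finite (orbits G (dom_set H) (act_dom H))"
    and proj_equivariant: "\<And>g h U. g \<in> carrier G \<Longrightarrow> h \<in> carrier G \<Longrightarrow> U \<in> dom_set H \<Longrightarrow>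
      act_space H g U ` cproj H U h = cproj H (act_dom H g U) (g \<otimes> h)"
    and rho_equivariant: "\<And>g U V. g \<in> carrier G \<Longrightarrow> U \<in> dom_set H \<Longrightarrow> V \<in> dom_set H \<Longrightarrow>
      transverse H U V \<or> pnest H V U \<Longrightarrow>
      act_space H g U ` rho_set H V U = rho_set H (act_dom H g V) (act_dom H g U)"

definition axial :: "('g, 'b) monoid_scheme \<Rightarrow> 'g set \<Rightarrow> 'g \<Rightarrow> bool" where
  "axial G S g \<longleftrightarrow> g \<in> carrier G \<and>
     (\<exists>x\<in>carrier G. qi_embedding int_metric (word_metric G S)
        (\<lambda>n. g [^]\<^bsub>G\<^esub> n \<otimes>\<^bsub>G\<^esub> x))"

definition acts_loxodromically ::
  "('g, 'b) monoid_scheme \<Rightarrow> ('g, 'u, 'c, 'm) hhg_data_scheme \<Rightarrow> 'g \<Rightarrow> 'u \<Rightarrow> bool" where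
  "acts_loxodromically G H g U \<longleftrightarrow>
     (\<exists>p\<in>mspace (cspace H U). qi_embedding int_metric (cspace H U)
        (\<lambda>n. act_space H (g [^]\<^bsub>G\<^esub> n) U p))"

definition fully_supported ::
  "('g, 'b) monoid_scheme \<Rightarrow> 'g set \<Rightarrow> ('g, 'u, 'c, 'm) hhg_data_scheme \<Rightarrow> 'g \<Rightarrow> 'u \<Rightarrow> bool" where
  "fully_supported G S H g U \<longleftrightarrow>
     axial G S g \<and> U \<in> unbounded_domains H \<and>
     act_dom H g U = U \<and> (\<forall>V\<in>unbounded_domains H. orth H V U \<longrightarrow> act_dom H g V = V) \<and>
     acts_loxodromically G H g U \<and>
     (\<forall>V\<in>unbounded_domains H. orth H V U \<longrightarrow>
        (\<exists>Q\<ge>0. \<forall>p\<in>mspace (cspace H V).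
           cdiam H V {act_space H (g [^]\<^bsub>G\<^esub> n) V p | n :: int. True} \<le> ennreal Q))"

definition rigidly_fully_supported ::
  "('g, 'b) monoid_scheme \<Rightarrow> 'g set \<Rightarrow> ('g, 'u, 'c, 'm) hhg_data_scheme \<Rightarrow> 'g \<Rightarrow> 'u \<Rightarrow> bool" where
  "rigidly_fully_supported G S H g U \<longleftrightarrow>
     fully_supported G S H g U \<and>
     (\<forall>V\<in>unbounded_domains H. orth H V U \<longrightarrow> (\<forall>p\<in>mspace (cspace H V). act_space H g V p = p))"

definition weak_commutativity ::
  "('g, 'b) monoid_scheme \<Rightarrow> 'g set \<Rightarrow> ('g, 'u, 'c, 'm) hhg_data_scheme \<Rightarrow> bool" where
  "weak_commutativity G S H \<longleftrightarrow>
     (\<forall>U\<in>unbounded_domains H. \<forall>V\<in>unbounded_domains H. \<forall>g h.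
        orth H U V \<and> fully_supported G S H g U \<and> fully_supported G S H h V \<longrightarrow>
        (\<exists>N::nat. N > 0 \<and>
           g [^]\<^bsub>G\<^esub> N \<otimes>\<^bsub>G\<^esub> h [^]\<^bsub>G\<^esub> N = h [^]\<^bsub>G\<^esub> N \<otimes>\<^bsub>G\<^esub> g [^]\<^bsub>G\<^esub> N))"

definition undistorted_subgroup :: "('g, 'b) monoid_scheme \<Rightarrow> 'g set \<Rightarrow> 'g set \<Rightarrow> bool" where
  "undistorted_subgroup G S K \<longleftrightarrow>
     subgroup K G \<and>
     (\<exists>T. finite T \<and> generating_set (G\<lparr>carrier := K\<rparr>) T \<and>
        qi_embedding (word_metric (G\<lparr>carrier := K\<rparr>) T) (word_metric G S) (\<lambda>x. x))"


section \<open>Graphs and right-angled Artin groups\<close>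

record 'v graph =
  verts :: "'v set"
  edges :: "'v set set"

definition induced_subgraph :: "'v graph \<Rightarrow> 'v graph \<Rightarrow> bool" where
  "induced_subgraph \<Lambda> \<Gamma> \<longleftrightarrow>
     verts \<Lambda> \<subseteq> verts \<Gamma> \<and> edges \<Lambda> = {e \<in> edges \<Gamma>. e \<subseteq> verts \<Lambda>}"

definition orthogonality_graph :: "('x, 'u, 'c, 'm) hhs_data_scheme \<Rightarrow> 'u graph" where
  "orthogonality_graph H = \<lparr>verts = unbounded_domains H,
     edges = {{U, V} | U V. U \<in> unbounded_domains H \<and> V \<in> unbounded_domains H \<and> U \<noteq> V \<and> orth H U V}\<rparr>"

text \<open>
  Group presentations: a letter \<open>(x, True)\<close> stands for the generator \<open>x\<close> and \<open>(x, False)\<close> for its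
  formal inverse.
\<close>

definition gwords :: "'v set \<Rightarrow> ('v \<times> bool) list set" where
  "gwords X = lists (X \<times> UNIV)"

inductive pres_eq ::
  "'v set \<Rightarrow> ('v \<times> bool) list set \<Rightarrow> ('v \<times> bool) list \<Rightarrow> ('v \<times> bool) list \<Rightarrow> bool"
  for X R where
  refl: "w \<in> gwords X \<Longrightarrow> pres_eq X R w w"
| sym: "pres_eq X R v w \<Longrightarrow> pres_eq X R w v"
| trans: "pres_eq X R u v \<Longrightarrow> pres_eq X R v w \<Longrightarrow> pres_eq X R u w"
| cancel: "u \<in> gwords X \<Longrightarrow> v \<in> gwords X \<Longrightarrow> x \<in> X \<Longrightarrow>
    pres_eq X R (u @ [(x, b), (x, \<not> b)] @ v) (u @ v)"
| relator: "u \<in> gwords X \<Longrightarrow> v \<in> gwords X \<Longrightarrow> r \<in> R \<Longrightarrow> r \<in> gwords X \<Longrightarrow>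
    pres_eq X R (u @ r @ v) (u @ v)"

definition pres_class :: "'v set \<Rightarrow> ('v \<times> bool) list set \<Rightarrow> ('v \<times> bool) list \<Rightarrow> ('v \<times> bool) list set" where
  "pres_class X R w = {v. pres_eq X R w v}"

definition presented_group :: "'v set \<Rightarrow> ('v \<times> bool) list set \<Rightarrow> ('v \<times> bool) list set monoid" where
  "presented_group X R =
     \<lparr>carrier = pres_class X R ` gwords X,
      mult = (\<lambda>A B. \<Union>a\<in>A. \<Union>b\<in>B. pres_class X R (a @ b)),
      one = pres_class X R []\<rparr>"

definition raag :: "'v graph \<Rightarrow> ('v \<times> bool) list set monoid" where
  "raag \<Gamma> = presented_group (verts \<Gamma>)
     {[(v, True), (w, True), (v, False), (w, False)] | v w. {v, w} \<in> edges \<Gamma>}"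

lemma pres_eq_gwords: "pres_eq X R v w \<Longrightarrow> v \<in> gwords X \<and> w \<in> gwords X"
  by (induction rule: pres_eq.induct) (auto simp: gwords_def)

lemma pres_eq_append_left:
  "pres_eq X R v w \<Longrightarrow> u \<in> gwords X \<Longrightarrow> pres_eq X R (u @ v) (u @ w)"
proof (induction rule: pres_eq.induct)
  case (cancel a v x b)
  then show ?case
    using pres_eq.cancel[of "u @ a" X v x R b] by (auto simp: gwords_def)
next
  case (relator a v r)
  then show ?case
    using pres_eq.relator[of "u @ a" X v r R] by (auto simp: gwords_def)
next
  case (trans a b c)
  then show ?case by (blast intro: pres_eq.trans)
qed (auto simp: gwords_def intro: pres_eq.refl pres_eq.sym)

lemma pres_eq_append_right:
  "pres_eq X R v w \<Longrightarrow> u \<in> gwords X \<Longrightarrow> pres_eq X R (v @ u) (w @ u)"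
proof (induction rule: pres_eq.induct)
  case (cancel a v x b)
  then show ?case
    using pres_eq.cancel[of a X "v @ u" x R b] by (auto simp: gwords_def)
next
  case (relator a v r)
  then show ?case
    using pres_eq.relator[of a X "v @ u" r R] by (auto simp: gwords_def)
next
  case (trans a b c)
  then show ?case by (blast intro: pres_eq.trans)
qed (auto simp: gwords_def intro: pres_eq.refl pres_eq.sym)

lemma pres_eq_append:
  "pres_eq X R v v' \<Longrightarrow> pres_eq X R w w' \<Longrightarrow> pres_eq X R (v @ w) (v' @ w')"
  by (meson pres_eq.trans pres_eq_append_left pres_eq_append_right pres_eq_gwords)

lemma pres_class_eq_iff:
  assumes "v \<in> gwords X" "w \<in> gwords X"
  shows "pres_class X R v = pres_class X R w \<longleftrightarrow> pres_eq X R v w"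
  unfolding pres_class_def set_eq_iff mem_Collect_eq
  by (meson assms pres_eq.refl pres_eq.sym pres_eq.trans)

lemma presented_group_mult:
  assumes "v \<in> gwords X" "w \<in> gwords X"
  shows "pres_class X R v \<otimes>\<^bsub>presented_group X R\<^esub> pres_class X R w = pres_class X R (v @ w)"
proof -
  have "pres_class X R (a @ b) = pres_class X R (v @ w)"
    if "a \<in> pres_class X R v" "b \<in> pres_class X R w" for a b
  proof -
    have "pres_eq X R (v @ w) (a @ b)"
      using that by (auto simp: pres_class_def intro: pres_eq_append)
    then show ?thesis
      by (metis pres_class_eq_iff pres_eq_gwords)
  qed
  moreover have "v \<in> pres_class X R v" "w \<in> pres_class X R w"
    using assms by (auto simp: pres_class_def intro: pres_eq.refl)
  ultimately have "(\<Union>a\<in>pres_class X R v. \<Union>b\<in>pres_class X R w. pres_class X R (a @ b)) =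
      pres_class X R (v @ w)"
    by (intro SUP_eq_const) blast+
  then show ?thesis
    by (simp add: presented_group_def)
qed

lemma group_presented_group: "group (presented_group X R)"
proof (rule groupI)
  let ?G = "presented_group X R"
  have nil: "[] \<in> gwords X" by (simp add: gwords_def)
  have app: "v @ w \<in> gwords X" if "v \<in> gwords X" "w \<in> gwords X" for v w
    using that by (auto simp: gwords_def)
  have carr: "carrier ?G = pres_class X R ` gwords X" and one: "\<one>\<^bsub>?G\<^esub> = pres_class X R []"
    by (auto simp: presented_group_def)
  show "x \<otimes>\<^bsub>?G\<^esub> y \<in> carrier ?G" if "x \<in> carrier ?G" "y \<in> carrier ?G" for x y
    using that app by (auto simp: carr presented_group_mult)
  show "\<one>\<^bsub>?G\<^esub> \<in> carrier ?G" by (simp add: carr one nil)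
  show "x \<otimes>\<^bsub>?G\<^esub> y \<otimes>\<^bsub>?G\<^esub> z = x \<otimes>\<^bsub>?G\<^esub> (y \<otimes>\<^bsub>?G\<^esub> z)"
    if "x \<in> carrier ?G" "y \<in> carrier ?G" "z \<in> carrier ?G" for x y z
    using that app by (auto simp: carr presented_group_mult)
  show "\<one>\<^bsub>?G\<^esub> \<otimes>\<^bsub>?G\<^esub> x = x" if "x \<in> carrier ?G" for x
    using that nil by (auto simp: carr one presented_group_mult)
  have "\<exists>v\<in>gwords X. pres_eq X R (v @ w) []" if "w \<in> gwords X" for w
    using that
  proof (induction w)
    case Nil
    then show ?case using nil by (intro bexI[of _ "[]"]) (auto intro: pres_eq.refl)
  next
    case (Cons a w)
    obtain x b where a: "a = (x, b)" by (cases a)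
    from Cons have x: "x \<in> X" and w: "w \<in> gwords X" by (auto simp: a gwords_def)
    with Cons obtain v where v: "v \<in> gwords X" "pres_eq X R (v @ w) []" by auto
    have "pres_eq X R (v @ [(x, \<not> b), (x, \<not> \<not> b)] @ w) (v @ w)"
      by (rule pres_eq.cancel) (use v w x in auto)
    then have "pres_eq X R ((v @ [(x, \<not> b)]) @ a # w) []"
      using pres_eq.trans[OF _ v(2)] by (simp add: a)
    moreover have "v @ [(x, \<not> b)] \<in> gwords X" using v x by (auto simp: gwords_def)
    ultimately show ?case by blast
  qed
  then show "\<exists>y\<in>carrier ?G. y \<otimes>\<^bsub>?G\<^esub> x = \<one>\<^bsub>?G\<^esub>" if x: "x \<in> carrier ?G" for x
  proof -
    obtain w where w: "w \<in> gwords X" "x = pres_class X R w"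
      using x unfolding carr by blast
    then obtain v where v: "v \<in> gwords X" "pres_eq X R (v @ w) []"
      using \<open>\<And>w. w \<in> gwords X \<Longrightarrow> \<exists>v\<in>gwords X. pres_eq X R (v @ w) []\<close> by blast
    then have "pres_class X R v \<otimes>\<^bsub>?G\<^esub> x = \<one>\<^bsub>?G\<^esub>"
      by (simp add: w one presented_group_mult pres_class_eq_iff app nil)
    with v(1) show ?thesis by (auto simp: carr)
  qed
qed

end

theory Submission
  imports Defs
begin

text \<open>
  An element \<open>g\<close> that is fully supported on \<open>U\<close> translates a quasi-axis in the hyperbolic space of \<open>U\<close>.
  Projecting \<open>z \<in> G\<close> to that space and taking the index of a nearest point of the orbit of \<open>g\<close> gives
  an integer coordinate \<open>s\<^sub>U(z)\<close>. For \<open>f\<^sub>U\<close> a large power of \<open>g\<close>, left multiplication by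
  \<open>f\<^sub>U\<close> shifts \<open>s\<^sub>U\<close> by a large amount \<open>T\<close>, and left multiplication by any power of \<open>f\<^sub>V\<close> with
  \<open>V \<bottom> U\<close> changes \<open>s\<^sub>U\<close> by a bounded amount only (by nothing at all in the rigid case). If \<open>U \<noteq> V\<close>
  are not orthogonal, then no \<open>z\<close> has both coordinates large. For transverse domains this is
  the consistency inequality. For \<open>V \<sqsubset> U\<close> it is the bounded geodesic image property: if \<open>z\<close>
  projects far along the quasi-axis in \<open>U\<close>, then a geodesic from \<open>z\<close> to a suitable orbit point avoids
  \<open>\<rho>\<^sup>V\<^sub>U\<close>, so \<open>z\<close> looks in \<open>V\<close> like one of two fixed elements of \<open>G\<close>
  (\<open>exclusive_transverse\<close>, \<open>exclusive_nested\<close>). From here on only the coordinates matter.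

  \<^emph>\<open>Injectivity.\<close> The error caused by commuting generators is bounded for each syllable, but
  their number is not, so it does not suffice to play ping-pong with an arbitrary reduced word. Every
  element of a right-angled Artin group is however a product of layers, each a product of powers
  of pairwise commuting generators, in which every syllable is blocked by a non-commuting one in the
  preceding layer (\<open>layered_form_exists\<close>). Along a chain of syllables that meets every layer once, each
  syllable is disturbed by the members of its own layer only, of which there are at most as
  many as there are vertices. So ping-pong along such a chain works with \<open>T\<close> chosen in
  advance, and a non-empty layered product moves the identity (\<open>layered_escapes\<close>).

  \<^emph>\<open>Undistortedness.\<close> In the rigid case every syllable of a reduced word can be used. Along a path
  from the identity to the element in the word metric, the coordinate of each
  syllable has to travel a distance proportional to the exponent, and a step of the path
  moves it by a bounded amount. Ping-pong shows that two syllables which are both on their way at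
  the same moment have adjacent labels (\<open>both_unfinished_imp_adjacent\<close>), so at most as many
  syllables as there are vertices are on their way at any time. Hence the length of the path bounds
  the total exponent linearly (\<open>undistorted_estimate\<close>).

  Rigidly supported elements on orthogonal domains have commuting powers, since \<open>g\<^sup>n h\<close> and
  \<open>h g\<^sup>n\<close> stay uniformly close in every domain and balls in \<open>G\<close> are finite
  (\<open>rigid_imp_commuting_powers\<close>). So both parts of the theorem rest on the same construction.
\<close>

section \<open>Gromov products in hyperbolic spaces\<close>

definition gromov_product :: "'a metric \<Rightarrow> 'a \<Rightarrow> 'a \<Rightarrow> 'a \<Rightarrow> real" where
  "gromov_product m x y w = (mdist m x w + mdist m y w - mdist m x y) / 2"

definition four_point :: "real \<Rightarrow> 'a metric \<Rightarrow> bool" where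
  "four_point \<delta> m \<longleftrightarrow> (\<forall>x\<in>mspace m. \<forall>y\<in>mspace m. \<forall>z\<in>mspace m. \<forall>w\<in>mspace m.
     min (gromov_product m x y w) (gromov_product m y z w) \<le> gromov_product m x z w + \<delta>)"

lemma four_pointD:
  assumes "four_point \<delta> m" "x \<in> mspace m" "y \<in> mspace m" "z \<in> mspace m" "w \<in> mspace m"
  shows "gromov_product m x y w \<le> gromov_product m x z w + \<delta> \<or>
         gromov_product m y z w \<le> gromov_product m x z w + \<delta>"
  using assms unfolding four_point_def by (meson min_le_iff_disj)

lemma gromov_product_le_dist:
  assumes "x \<in> mspace m" "y \<in> mspace m" "w \<in> mspace m"
  shows "gromov_product m x y w \<le> mdist m x w" "gromov_product m x y w \<le> mdist m y w"
  using mdist_triangle[of y m x w] mdist_triangle[of x m y w] assms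
  by (auto simp: gromov_product_def mdist_commute)

lemma gromov_product_nonneg:
  assumes "x \<in> mspace m" "y \<in> mspace m" "w \<in> mspace m"
  shows "gromov_product m x y w \<ge> 0"
  using mdist_triangle[of x m w y] assms
  by (auto simp: gromov_product_def mdist_commute)

lemma gromov_product_commute: "gromov_product m x y w = gromov_product m y x w"
  by (simp add: gromov_product_def mdist_commute)

lemma gromov_product_swap:
  "gromov_product m x y w = mdist m w y - gromov_product m x w y"
  by (simp add: gromov_product_def mdist_commute field_simps)

lemma gromov_product_base:
  assumes "x \<in> mspace m" "y \<in> mspace m" "w \<in> mspace m" "v \<in> mspace m"
  shows "gromov_product m x y w \<le> gromov_product m x y v + mdist m v w"
  using mdist_triangle[OF assms(1,4,3)] mdist_triangle[OF assms(2,4,3)]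
  unfolding gromov_product_def by argo

lemma set_dist_le_imp:
  assumes "set_dist m A B \<le> ennreal r" "A \<noteq> {}" "B \<noteq> {}" "r < r'" "r \<ge> 0"
  shows "\<exists>a\<in>A. \<exists>b\<in>B. mdist m a b < r'"
proof -
  have "set_dist m A B < ennreal r'"
    using assms by (metis ennreal_less_iff le_less_trans)
  then obtain p where "p \<in> A \<times> B" "(case p of (a, b) \<Rightarrow> ennreal (mdist m a b)) < ennreal r'"
    unfolding set_dist_def INF_less_iff by blast
  then show ?thesis
    by (auto simp: ennreal_less_iff split: prod.splits)
qed

lemma set_dist_le_dist: "a \<in> A \<Longrightarrow> b \<in> B \<Longrightarrow> set_dist m A B \<le> ennreal (mdist m a b)"
  unfolding set_dist_def by (rule INF_lower2[of "(a, b)"]) auto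

lemma set_dist_empty: "A = {} \<or> B = {} \<Longrightarrow> set_dist m A B = \<infinity>"
  unfolding set_dist_def by auto

lemma mdiam_le_imp:
  assumes "mdiam m A \<le> ennreal r" "a \<in> A" "b \<in> A" "r \<ge> 0"
  shows "mdist m a b \<le> r"
proof -
  have "ennreal (mdist m a b) \<le> mdiam m A"
    unfolding mdiam_def using assms by (intro SUP_upper2[of "(a, b)"]) auto
  then show ?thesis
    using assms by (metis ennreal_le_iff order_trans)
qed

lemma
  assumes "geodesic_segment m x y P" "x \<in> mspace m" "y \<in> mspace m"
  shows geodesic_segment_points: "P \<subseteq> mspace m" "x \<in> P" "y \<in> P"
      "\<And>p. p \<in> P \<Longrightarrow> mdist m x p + mdist m p y = mdist m x y"
    and geodesic_segment_point_at: "\<And>t. 0 \<le> t \<Longrightarrow> t \<le> mdist m x y \<Longrightarrow> \<exists>p\<in>P. mdist m x p = t"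
proof -
  obtain l \<gamma> where *: "l \<ge> 0" "\<gamma> \<in> {0..l::real} \<rightarrow> mspace m"
    "\<forall>s\<in>{0..l}. \<forall>t\<in>{0..l}. mdist m (\<gamma> s) (\<gamma> t) = \<bar>s - t\<bar>" "\<gamma> 0 = x" "\<gamma> l = y" "P = \<gamma> ` {0..l}"
    using assms(1) unfolding geodesic_segment_def by blast
  have d: "mdist m x (\<gamma> t) = t" "mdist m (\<gamma> t) y = l - t" if "t \<in> {0..l}" for t
    using *(3)[rule_format, of 0 t] *(3)[rule_format, of t l] that *(1,4,5) by auto
  have l: "mdist m x y = l" using d(1)[of l] * by auto
  show "P \<subseteq> mspace m" using *(2,6) by blast
  show "x \<in> P" unfolding *(6) *(4)[symmetric] using *(1) by auto
  show "y \<in> P" unfolding *(6) *(5)[symmetric] using *(1) by auto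
  show "mdist m x p + mdist m p y = mdist m x y" if "p \<in> P" for p
    using that d *(6) l by auto
  show "\<exists>p\<in>P. mdist m x p = t" if "0 \<le> t" "t \<le> mdist m x y" for t
    using that d(1)[of t] *(6) l by auto
qed

lemma geodesic_segment_sym:
  assumes "geodesic_segment m x y P"
  shows "geodesic_segment m y x P"
proof -
  obtain l \<gamma> where *: "l \<ge> 0" "\<gamma> \<in> {0..l::real} \<rightarrow> mspace m"
    "\<forall>s\<in>{0..l}. \<forall>t\<in>{0..l}. mdist m (\<gamma> s) (\<gamma> t) = \<bar>s - t\<bar>" "\<gamma> 0 = x" "\<gamma> l = y" "P = \<gamma> ` {0..l}"
    using assms unfolding geodesic_segment_def by blast
  have im: "(\<lambda>t. l - t) ` {0..l} = {0..l}"
    by (simp add: image_diff_atLeastAtMost)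
  have "P = \<gamma> ` ((\<lambda>t. l - t) ` {0..l})" using * im by simp
  then have "P = (\<lambda>t. \<gamma> (l - t)) ` {0..l}" by (simp only: image_image)
  then show ?thesis
    unfolding geodesic_segment_def
    using * by (intro exI[of _ l] conjI exI[of _ "\<lambda>t. \<gamma> (l - t)"]) auto
qed

text \<open>
  The Gromov product is the distance to the geodesic up to a constant. The point \<open>p\<close> of the geodesic at
  distance \<open>(w|y)\<^sub>x\<close> from \<open>x\<close> is where an inscribed tripod branches. It is close to one of the other two
  sides, and on either side its position determines its distance to \<open>w\<close>.
\<close>

lemma geodesic_near_gromov_product:
  assumes hyp: "hyperbolic_space \<delta> m" and "geodesic_space m" and \<delta>: "\<delta> \<ge> 0"
    and P: "geodesic_segment m x y P"
    and xyw: "x \<in> mspace m" "y \<in> mspace m" "w \<in> mspace m"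
  shows "\<exists>p\<in>P. mdist m w p \<le> gromov_product m x y w + 2 * (\<delta> + 1)"
proof -
  obtain Q R where Q: "geodesic_segment m x w Q" and R: "geodesic_segment m y w R"
    using assms(2) xyw unfolding geodesic_space_def by blast
  have thin: "P \<subseteq> nbhd m \<delta> (Q \<union> R)"
    using hyp[unfolded hyperbolic_space_def, rule_format, of x y P w R Q] Q R P by (simp add: Un_commute)
  let ?t = "gromov_product m w y x"
  have t: "0 \<le> ?t" "?t \<le> mdist m x y"
    using gromov_product_nonneg[of w m y x] gromov_product_le_dist[of w m y x] xyw
    by (auto simp: mdist_commute[of m y x])
  obtain p where p: "p \<in> P" "mdist m x p = ?t" and pm: "p \<in> mspace m"
    and sum: "mdist m x p + mdist m p y = mdist m x y"
    using geodesic_segment_points[OF P xyw(1,2)] geodesic_segment_point_at[OF P xyw(1,2) t] by blast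
  note Qm = geodesic_segment_points(1,2)[OF Q xyw(1,3)] and Qs = geodesic_segment_points(4)[OF Q xyw(1,3)]
  note Rm = geodesic_segment_points(1)[OF R xyw(2,3)] and Rs = geodesic_segment_points(4)[OF R xyw(2,3)]
  have "set_dist m {p} (Q \<union> R) \<le> ennreal \<delta>"
    using thin p unfolding nbhd_def by auto
  from set_dist_le_imp[OF this, of "\<delta> + 1"] Qm \<delta> obtain q where q: "q \<in> Q \<union> R" "mdist m p q < \<delta> + 1"
    by auto
  then have qm: "q \<in> mspace m" using Qm Rm by auto
  have sym: "mdist m q p = mdist m p q" "mdist m w q = mdist m q w" "mdist m p y = mdist m y p"
    "mdist m w x = mdist m x w" "mdist m w y = mdist m y w" "mdist m y x = mdist m x y"
    by (simp_all add: mdist_commute)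
  have "mdist m w p \<le> gromov_product m x y w + 2 * (\<delta> + 1)"
  proof (cases "q \<in> Q")
    case True
    have "mdist m x q + mdist m q w = mdist m x w" using Qs True by auto
    moreover have "mdist m x p \<le> mdist m x q + mdist m q p" "mdist m w p \<le> mdist m w q + mdist m q p"
      using mdist_triangle[OF xyw(1) qm pm] mdist_triangle[OF xyw(3) qm pm] by auto
    ultimately show ?thesis
      using q(2) p(2) sym unfolding gromov_product_def by argo
  next
    case False
    then have "mdist m y q + mdist m q w = mdist m y w" using Rs q by auto
    moreover have "mdist m y p \<le> mdist m y q + mdist m q p" "mdist m w p \<le> mdist m w q + mdist m q p"
      using mdist_triangle[OF xyw(2) qm pm] mdist_triangle[OF xyw(3) qm pm] by auto
    ultimately show ?thesis
      using q(2) p(2) sum sym unfolding gromov_product_def by argo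
  qed
  with p show ?thesis by blast
qed

lemma gromov_product_le_geodesic:
  assumes "geodesic_segment m x y P" "x \<in> mspace m" "y \<in> mspace m" "w \<in> mspace m" "p \<in> P"
  shows "gromov_product m x y w \<le> mdist m w p"
proof -
  note P = geodesic_segment_points[OF assms(1-3)]
  then have p: "p \<in> mspace m" and s: "mdist m x p + mdist m p y = mdist m x y"
    using assms(5) by auto
  show ?thesis
    using mdist_triangle[OF assms(2) p assms(4)] mdist_triangle[OF assms(3) p assms(4)] s
    by (simp add: gromov_product_def mdist_commute[of m w p] mdist_commute[of m p y])
qed

text \<open>
  A point of \<open>[x, z]\<close> nearest to \<open>w\<close> lies close to \<open>[x, y]\<close> or to \<open>[y, z]\<close>, so the distance from \<open>w\<close> to
  one of these exceeds that to \<open>[x, z]\<close> by a constant at most.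
\<close>

lemma hyperbolic_imp_four_point:
  assumes hyp: "hyperbolic_space \<delta> m" and geo: "geodesic_space m" and \<delta>: "\<delta> \<ge> 0"
  shows "four_point (3 * (\<delta> + 1)) m"
  unfolding four_point_def
proof (intro ballI)
  fix x y z w assume c: "x \<in> mspace m" "y \<in> mspace m" "z \<in> mspace m" "w \<in> mspace m"
  obtain P Q R where P: "geodesic_segment m x z P" and Q: "geodesic_segment m x y Q"
    and R: "geodesic_segment m y z R"
    using geo c unfolding geodesic_space_def by blast
  from geodesic_near_gromov_product[OF hyp geo \<delta> P c(1,3,4)] obtain p where
    p: "p \<in> P" "mdist m w p \<le> gromov_product m x z w + 2 * (\<delta> + 1)" by blast
  have "P \<subseteq> nbhd m \<delta> (Q \<union> R)" using hyp[unfolded hyperbolic_space_def, rule_format, of x z P y R Q] P Q geodesic_segment_sym[OF R]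
    by (simp add: Un_commute)
  moreover have Qn: "x \<in> Q" and sub: "P \<subseteq> mspace m" "Q \<subseteq> mspace m" "R \<subseteq> mspace m"
    using geodesic_segment_points(1,2)[OF Q c(1,2)] geodesic_segment_points(1)[OF P c(1,3)]
      geodesic_segment_points(1)[OF R c(2,3)] by auto
  ultimately obtain q where q: "q \<in> Q \<union> R" "mdist m p q < \<delta> + 1"
    using set_dist_le_imp[of m "{p}" "Q \<union> R" \<delta> "\<delta> + 1"] p \<delta> unfolding nbhd_def by auto
  have "mdist m w q \<le> mdist m w p + mdist m p q"
    using mdist_triangle[of w m p q] c sub q p by auto
  with q p have wq: "mdist m w q \<le> gromov_product m x z w + 3 * (\<delta> + 1)" by simp
  show "min (gromov_product m x y w) (gromov_product m y z w) \<le> gromov_product m x z w + 3 * (\<delta> + 1)"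
    using q(1) gromov_product_le_geodesic[OF Q c(1,2,4), of q] gromov_product_le_geodesic[OF R c(2,3,4), of q] wq
    by (auto simp: min_le_iff_disj)
qed

lemma mdist_self: "x \<in> mspace m \<Longrightarrow> mdist m x x = 0"
  by simp

section \<open>Quasi-axes and nearest-point projection\<close>

text \<open>
  The lower bound has slope one and no additive error, so that a difference of indices is at most
  the distance of the points. The last clause says that the sequence is close to being geodesic.
\<close>

definition quasi_axis :: "'a metric \<Rightarrow> real \<Rightarrow> real \<Rightarrow> (int \<Rightarrow> 'a) \<Rightarrow> bool" where
  "quasi_axis m A L p \<longleftrightarrow> range p \<subseteq> mspace m \<and>
     (\<forall>i j. \<bar>of_int (i - j)\<bar> \<le> mdist m (p i) (p j) \<and> mdist m (p i) (p j) \<le> L * \<bar>of_int (i - j)\<bar>) \<and>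
     (\<forall>i l j. i \<le> l \<and> l \<le> j \<longrightarrow> gromov_product m (p i) (p j) (p l) \<le> A)"

text \<open>
  Without such a \<open>k\<close> the values at powers of two would grow linearly in the exponent, against the linear
  lower bound for \<open>a\<close>.
\<close>

lemma linear_growth_doubling_gap:
  fixes a :: "nat \<Rightarrow> real"
  assumes K: "K > 0" and low: "\<And>n. real n / K - C \<le> a n" and c: "c \<ge> 0"
  shows "\<exists>k>0. a (2 * k) \<ge> a k + c"
proof (rule ccontr)
  assume "\<not> ?thesis"
  then have lt: "a (2 * k) < a k + c" if "k > 0" for k
    using that by (meson not_le)
  have up: "a (2 ^ j) \<le> a 1 + real j * c" for j
  proof (induction j)
    case (Suc j)
    then show ?case using lt[of "2 ^ j"] by (simp add: algebra_simps)
  qed simp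
  define D where "D = \<bar>a 1\<bar> + \<bar>C\<bar>"
  obtain i :: nat where i: "real i > K * (2 * c + D) + 1"
    using reals_Archimedean2 by blast
  have D: "D \<ge> 0" by (simp add: D_def)
  have "K * (2 * c + D) \<ge> 0" using K c D by simp
  then have i1: "real i \<ge> 1" using i by linarith
  have "real i < 2 ^ i" using of_nat_less_two_power[of i] by simp
  then have "real i * real i \<le> 2 ^ i * 2 ^ i"
    by (intro mult_mono) auto
  then have sq: "real i * real i \<le> 2 ^ (2 * i)"
    by (simp add: mult_2 power_add)
  have "real i * (K * (2 * c + D)) \<le> real i * real i"
    using i i1 by (intro mult_left_mono) auto
  then have "real i * (K * (2 * c + D)) < 2 ^ (2 * i) + 1" using sq by linarith
  moreover have "2 ^ (2 * i) / K - C \<le> a 1 + real (2 * i) * c"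
    using low[of "2 ^ (2 * i)"] up[of "2 * i"] by simp
  then have "2 ^ (2 * i) \<le> K * (a 1 + C + 2 * (real i * c))"
    using K by (simp add: field_simps)
  moreover have "K * (real i * D) \<ge> K * D"
    using K mult_right_mono[OF i1 D] by (intro mult_left_mono) auto
  moreover have "real i * real i > real i * (K * (2 * c + D))"
    using i i1 by (intro mult_strict_left_mono) auto
  moreover have "K * (a 1 + C) \<le> K * D" using K by (intro mult_left_mono) (auto simp: D_def)
  ultimately show False using sq by (simp add: algebra_simps)
qed

text \<open>
  A local-to-global argument. If \<open>d(x\<^sub>0, x\<^sub>2\<^sub>k)\<close> exceeds \<open>d(x\<^sub>0, x\<^sub>k)\<close> by a sufficient multiple of
  \<open>\<delta>\<close>, then in the sequence of every \<open>k\<close>-th point the Gromov product of the two neighbours of a point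
  is less than half the step length by a definite margin. The four-point inequality carries this bound from
  neighbours to arbitrary points on the two sides, one step at a time.
\<close>

lemma periodic_quasi_axis:
  fixes x :: "int \<Rightarrow> 'a"
  assumes four: "four_point \<delta> m" and \<delta>: "\<delta> \<ge> 0"
    and x: "range x \<subseteq> mspace m"
    and shift: "\<And>i j k. mdist m (x (i + k)) (x (j + k)) = mdist m (x i) (x j)"
    and K: "K > 0" and low: "\<And>n. real n / K - C \<le> mdist m (x 0) (x (int n))"
  shows "\<exists>k>0. \<exists>A\<ge>0. \<exists>L\<ge>1. quasi_axis m A L (\<lambda>n. x (int k * n))"
proof -
  define a where "a n = mdist m (x 0) (x (int n))" for n
  obtain k where k: "k > 0" "a (2 * k) \<ge> a k + (4 * \<delta> + 1)"
    using linear_growth_doubling_gap[of K C a "4 * \<delta> + 1"] K low \<delta> by (auto simp: a_def)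
  define p where "p n = x (int k * n)" for n
  define b where "b n = a (k * n)" for n
  have pm [simp]: "p i \<in> mspace m" for i using x by (auto simp: p_def)
  have dist: "mdist m (p i) (p j) = b (nat \<bar>i - j\<bar>)" for i j
  proof -
    have *: "mdist m (p i) (p j) = b (nat (j - i))" if "i \<le> j" for i j
    proof -
      have "mdist m (x (0 + int k * i)) (x (int k * (j - i) + int k * i)) = mdist m (x 0) (x (int k * (j - i)))"
        by (rule shift)
      then show ?thesis using that by (simp add: p_def b_def a_def algebra_simps)
    qed
    show ?thesis
      using *[of i j] *[of j i] by (cases "i \<le> j") (auto simp: mdist_commute abs_if)
  qed
  have b0: "b 0 = 0" using dist[of 0 0] by (simp add: b_def a_def x range_subsetD[OF x])
  let ?L = "b 1" let ?A = "b 1 - b 2 / 2"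
  have LA: "?L \<ge> 2 * ?A + 4 * \<delta> + 1"
    using k(2) by (simp add: b_def mult.commute)
  have step: "b i \<ge> b (i - 1) + ?L - 2 * ?A - 2 * \<delta>" if "i \<ge> 1" for i
    using that
  proof (induction i rule: nat_induct_at_least)
    case base
    have "?A = gromov_product m (p (-1)) (p 1) (p 0)"
      by (simp add: gromov_product_def dist)
    then have "?A \<ge> 0" using gromov_product_nonneg[of "p (-1)" m "p 1" "p 0"] by simp
    then show ?case using b0 \<delta> by simp
  next
    case (Suc i)
    have ge: "gromov_product m (p 2) (p (int i + 1)) (p 1) \<ge> ?L - ?A - \<delta>"
    proof -
      have "gromov_product m (p 2) (p (int i + 1)) (p 1) = (?L + b i - b (i - 1)) / 2"
        using Suc.hyps by (simp add: gromov_product_def dist nat_diff_distrib of_nat_diff abs_if)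
      then show ?thesis using Suc.IH by (simp add: field_simps)
    qed
    have 02: "gromov_product m (p 0) (p 2) (p 1) = ?A"
      by (simp add: gromov_product_def dist)
    have "gromov_product m (p 0) (p (int i + 1)) (p 1) \<le> gromov_product m (p 0) (p 2) (p 1) + \<delta>"
      using four_pointD[OF four, of "p 0" "p (int i + 1)" "p 2" "p 1"] ge LA \<delta> unfolding 02
      by (auto simp: gromov_product_commute[of m "p (int i + 1)" "p 2"])
    moreover have "gromov_product m (p 0) (p (int i + 1)) (p 1) = (?L + b i - b (Suc i)) / 2"
      using Suc.hyps by (simp add: gromov_product_def dist nat_add_distrib)
    ultimately show ?case using 02 by (simp add: field_simps)
  qed
  have step1: "b (Suc i) \<ge> b i + 1" for i
    using step[of "Suc i"] LA \<delta> by simp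
  have growth: "b n \<ge> real n" for n
  proof (induction n)
    case (Suc n)
    then show ?case using step1[of n] by simp
  qed (simp add: b0)
  have upper: "b n \<le> ?L * real n" for n
  proof (induction n)
    case (Suc n)
    have "mdist m (p 0) (p (int (Suc n))) \<le> mdist m (p 0) (p (int n)) + mdist m (p (int n)) (p (int (Suc n)))"
      by (rule mdist_triangle) auto
    then have "b (Suc n) \<le> b n + ?L"
      using dist[of 0 "int (Suc n)"] dist[of 0 "int n"] dist[of "int n" "int (Suc n)"]
      by (simp add: nat_add_distrib)
    then show ?case using Suc by (simp add: algebra_simps)
  qed (simp add: b0)
  have prod1: "gromov_product m (p i) (p j) (p (i + 1)) \<le> ?A + \<delta>" if "i < j" for i j
  proof -
    have "gromov_product m (p i) (p j) (p (i + 1)) = (?L + b (nat (j - i) - 1) - b (nat (j - i))) / 2"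
      using that by (simp add: gromov_product_def dist abs_if)
        (auto simp: nat_diff_distrib intro!: arg_cong[of _ _ b])
    moreover have "1 \<le> nat (j - i)" using that by simp
    ultimately show ?thesis using step[of "nat (j - i)"] by (simp add: field_simps)
  qed
  have prod2: "gromov_product m (p i) (p j) (p (j - 1)) \<le> ?A + \<delta>" if "i < j" for i j
  proof -
    have "gromov_product m (p i) (p j) (p (j - 1)) = gromov_product m (p (- j)) (p (- i)) (p (- j + 1))"
    proof -
      have "\<bar>i - (j - 1)\<bar> = \<bar>- i - (- j + 1)\<bar>" "\<bar>j - (j - 1)\<bar> = \<bar>- j - (- j + 1)\<bar>" "\<bar>i - j\<bar> = \<bar>- j - - i\<bar>"
        by linarith+
      then show ?thesis by (simp only: gromov_product_def dist) simp
    qed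
    then show ?thesis using prod1[of "- j" "- i"] that by simp
  qed
  have A0: "?A + \<delta> \<ge> 0"
    using prod1[of 0 1] gromov_product_nonneg[of "p 0" m "p 1" "p 1"] by simp
  have main: "gromov_product m (p i) (p j) (p l) \<le> ?A + 2 * \<delta>" if "i \<le> l" "l \<le> j" for i l j
  proof (cases "i = l \<or> l = j")
    case True
    then have "gromov_product m (p i) (p j) (p l) = 0"
      using mdist_zero[of "p l" m "p l"] by (auto simp: gromov_product_def mdist_commute simp del: mdist_zero)
    then show ?thesis using A0 \<delta> by simp
  next
    case False
    then have lt: "i < l" "l < j" using that by auto
    have "gromov_product m (p i) (p (l - 1)) (p l) = ?L - gromov_product m (p i) (p l) (p (l - 1))"
      by (simp add: gromov_product_def dist field_simps)
    then have big: "gromov_product m (p i) (p (l - 1)) (p l) \<ge> ?L - ?A - \<delta>"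
      using prod2[OF lt(1)] by simp
    have small: "gromov_product m (p (l - 1)) (p j) (p l) \<le> ?A + \<delta>"
      using prod1[of "l - 1" j] lt by simp
    show ?thesis
      using four_pointD[OF four, of "p (l - 1)" "p i" "p j" "p l"] big small LA \<delta>
      by (auto simp: gromov_product_commute[of m "p (l - 1)" "p i"])
  qed
  have "quasi_axis m (?A + 2 * \<delta>) ?L p"
    unfolding quasi_axis_def
  proof (intro conjI allI impI)
    show "range p \<subseteq> mspace m" by auto
    show "\<bar>of_int (i - j)\<bar> \<le> mdist m (p i) (p j)" for i j
      using growth[of "nat \<bar>i - j\<bar>"] by (simp add: dist)
    show "mdist m (p i) (p j) \<le> ?L * \<bar>of_int (i - j)\<bar>" for i j
      using upper[of "nat \<bar>i - j\<bar>"] by (simp add: dist)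
    show "gromov_product m (p i) (p j) (p l) \<le> ?A + 2 * \<delta>" if "i \<le> l \<and> l \<le> j" for i l j
      using main that by blast
  qed
  moreover have "?L \<ge> 1" using growth[of 1] by simp
  ultimately show ?thesis using k A0 \<delta> unfolding p_def
    by (intro exI[of _ k] conjI exI[of _ "?A + 2 * \<delta>"] exI[of _ ?L]) auto
qed

text \<open>The slack of one makes an index exist without any compactness.\<close>

definition near_index :: "'a metric \<Rightarrow> (int \<Rightarrow> 'a) \<Rightarrow> 'a \<Rightarrow> int \<Rightarrow> bool" where
  "near_index m p x n \<longleftrightarrow> (\<forall>j. mdist m x (p n) \<le> mdist m x (p j) + 1)"

lemma near_index_exists: "\<exists>n. near_index m p x n"
proof -
  let ?D = "range (\<lambda>j. mdist m x (p j))"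
  have bdd: "bdd_below ?D" by (rule bdd_belowI[of _ 0]) auto
  have "Inf ?D < Inf ?D + 1" by simp
  then obtain n where n: "mdist m x (p n) < Inf ?D + 1"
    using cInf_lessD[of ?D "Inf ?D + 1"] by blast
  have "near_index m p x n" unfolding near_index_def
  proof
    fix j
    have "Inf ?D \<le> mdist m x (p j)" by (rule cInf_lower[OF _ bdd]) auto
    then show "mdist m x (p n) \<le> mdist m x (p j) + 1" using n by linarith
  qed
  then show ?thesis ..
qed

text \<open>
  If \<open>(x|p\<^sub>j)\<close> at \<open>p\<^sub>n\<close> were large, then walking from \<open>p\<^sub>n\<close> a fixed number of steps towards \<open>p\<^sub>j\<close>
  would bring one closer to \<open>x\<close>.
\<close>

lemma quasi_axis_projection:
  assumes four: "four_point \<delta> m" and \<delta>: "\<delta> \<ge> 0" and axis: "quasi_axis m A L p"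
    and A: "A \<ge> 0" and L: "L \<ge> 1"
  shows "\<exists>B\<ge>0. \<forall>x\<in>mspace m. \<forall>n. near_index m p x n \<longrightarrow> (\<forall>j. gromov_product m x (p j) (p n) \<le> B)"
proof (intro exI[of _ "L * of_int \<lceil>2 * A + 2 * \<delta> + 2\<rceil>"] conjI ballI allI impI)
  define k where "k = \<lceil>2 * A + 2 * \<delta> + 2\<rceil>"
  have k: "of_int k > 2 * A + 2 * \<delta> + 1" unfolding k_def by linarith
  then have k0: "k > 0" using A \<delta> by (smt (verit) of_int_0_less_iff)
  show "0 \<le> L * of_int \<lceil>2 * A + 2 * \<delta> + 2\<rceil>" using k0 L by (simp add: k_def)
  fix x n j assume x: "x \<in> mspace m" and n: "near_index m p x n"
  have pm: "p i \<in> mspace m" for i using axis by (auto simp: quasi_axis_def)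
  have lo: "\<bar>of_int (i - j)\<bar> \<le> mdist m (p i) (p j)" and up: "mdist m (p i) (p j) \<le> L * \<bar>of_int (i - j)\<bar>" for i j
    using axis unfolding quasi_axis_def by blast+
  have bet: "gromov_product m (p i) (p j) (p l) \<le> A" if "i \<le> l \<and> l \<le> j \<or> j \<le> l \<and> l \<le> i" for i l j
    using axis that gromov_product_commute[of m "p i" "p j" "p l"] unfolding quasi_axis_def by metis
  have "gromov_product m x (p j) (p n) \<le> L * of_int k"
  proof (cases "\<bar>j - n\<bar> \<le> k")
    case True
    have "gromov_product m x (p j) (p n) \<le> mdist m (p j) (p n)"
      by (rule gromov_product_le_dist) (use x pm in auto)
    also have "\<dots> \<le> L * \<bar>of_int (j - n)\<bar>" by (rule up)
    also have "\<dots> \<le> L * of_int k"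
      using L True by (intro mult_left_mono) (metis of_int_abs of_int_le_iff, linarith)
    finally show ?thesis .
  next
    case False
    \<comment> \<open>\<open>l\<close> is \<open>k\<close> steps away from \<open>n\<close> in the direction of \<open>j\<close>.\<close>
    define l where "l = (if j > n then n + k else n - k)"
    have l: "n \<le> l \<and> l \<le> j \<or> j \<le> l \<and> l \<le> n" using False k0 by (auto simp: l_def)
    have ln: "\<bar>l - n\<bar> = k" using k0 by (auto simp: l_def)
    let ?D = "mdist m (p l) (p n)"
    have D: "?D \<ge> of_int k" using lo[of l n] ln by (metis of_int_abs)
    have Du: "?D \<le> L * of_int k" using up[of l n] ln by (metis of_int_abs)
    show ?thesis
    proof (rule ccontr)
      assume "\<not> ?thesis"
      then have big: "gromov_product m x (p j) (p n) > ?D" using Du by simp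
      have "gromov_product m (p j) (p l) (p n) = mdist m (p n) (p l) - gromov_product m (p j) (p n) (p l)"
        by (rule gromov_product_swap)
      moreover have "gromov_product m (p j) (p n) (p l) \<le> A" using bet[of j l n] l by auto
      ultimately have big2: "gromov_product m (p j) (p l) (p n) \<ge> ?D - A"
        by (simp add: mdist_commute)
      have "gromov_product m x (p l) (p n) \<ge> ?D - A - \<delta>"
        using four_pointD[OF four x pm[of j] pm[of l] pm[of n]] big big2 A by auto
      moreover have "mdist m x (p n) \<le> mdist m x (p l) + 1" using n by (simp add: near_index_def)
      ultimately have "?D \<le> 2 * A + 2 * \<delta> + 1" by (simp add: gromov_product_def)
      then show False using D k by linarith
    qed
  qed
  then show "gromov_product m x (p j) (p n) \<le> L * of_int \<lceil>2 * A + 2 * \<delta> + 2\<rceil>"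
    by (simp only: k_def)
qed

text \<open>
  The nearest-point projection to the axis is coarsely Lipschitz: the path from \<open>x\<close> to \<open>p\<^sub>j\<close> passes near
  \<open>p\<^sub>i\<close>, the path from \<open>y\<close> to \<open>p\<^sub>i\<close> passes near \<open>p\<^sub>j\<close>, and the two estimates add up.
\<close>

lemma near_index_close:
  assumes axis: "quasi_axis m A L p"
    and B: "\<And>x n j. x \<in> mspace m \<Longrightarrow> near_index m p x n \<Longrightarrow> gromov_product m x (p j) (p n) \<le> B"
    and x: "x \<in> mspace m" "y \<in> mspace m" "near_index m p x i" "near_index m p y j"
  shows "\<bar>of_int (i - j)\<bar> \<le> mdist m x y + 2 * B"
proof -
  have pm: "p i \<in> mspace m" for i using axis by (auto simp: quasi_axis_def)
  have "\<bar>of_int (i - j)\<bar> \<le> mdist m (p i) (p j)" using axis unfolding quasi_axis_def by blast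
  moreover have "gromov_product m x (p j) (p i) \<le> B" "gromov_product m y (p i) (p j) \<le> B"
    using B x by auto
  moreover have "mdist m x (p j) \<le> mdist m x y + mdist m y (p j)"
    "mdist m y (p i) \<le> mdist m y x + mdist m x (p i)"
    by (rule mdist_triangle; use x pm in auto)+
  ultimately show ?thesis
    by (simp add: gromov_product_def mdist_commute[of m "p j" "p i"] mdist_commute[of m y x])
qed

section \<open>Layered products of partially commuting elements\<close>

lemma (in group) commute_inv:
  assumes "x \<in> carrier G" "y \<in> carrier G" "x \<otimes> y = y \<otimes> x"
  shows "inv x \<otimes> y = y \<otimes> inv x"
proof -
  have "inv x \<otimes> y = inv x \<otimes> (y \<otimes> x) \<otimes> inv x"
    using assms(1,2) by (simp add: m_assoc)
  also have "\<dots> = inv x \<otimes> (x \<otimes> y) \<otimes> inv x" by (simp only: assms(3))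
  also have "\<dots> = (inv x \<otimes> x) \<otimes> y \<otimes> inv x" using assms(1,2) by (simp only: m_assoc inv_closed m_closed)
  also have "\<dots> = y \<otimes> inv x" using assms(1,2) by simp
  finally show ?thesis .
qed

lemma (in group) commute_nat_pow:
  assumes "x \<in> carrier G" "y \<in> carrier G" "x \<otimes> y = y \<otimes> x"
  shows "x [^] (n::nat) \<otimes> y = y \<otimes> x [^] n"
proof (induction n)
  case (Suc n)
  have "x [^] Suc n \<otimes> y = x [^] n \<otimes> (x \<otimes> y)" using assms(1,2) by (simp add: m_assoc)
  also have "\<dots> = (x [^] n \<otimes> y) \<otimes> x" unfolding assms(3) using assms(1,2) by (simp add: m_assoc)
  also have "\<dots> = y \<otimes> x [^] Suc n" unfolding Suc using assms(1,2) by (simp add: m_assoc)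
  finally show ?case .
qed (use assms(1,2) in simp)

lemma (in group) commute_int_pow_left:
  assumes "x \<in> carrier G" "y \<in> carrier G" "x \<otimes> y = y \<otimes> x"
  shows "x [^] (n::int) \<otimes> y = y \<otimes> x [^] n"
  unfolding int_pow_def2
  by (cases "n < 0") (simp_all only: if_True if_False, intro commute_inv nat_pow_closed commute_nat_pow assms, rule commute_nat_pow[OF assms])

lemma (in group) commute_int_pow:
  assumes "x \<in> carrier G" "y \<in> carrier G" "x \<otimes> y = y \<otimes> x"
  shows "x [^] (n::int) \<otimes> y [^] (k::int) = y [^] k \<otimes> x [^] n"
  by (rule commute_int_pow_left[OF _ _ commute_int_pow_left[OF assms, symmetric], symmetric]) (use assms(1,2) in auto)

definition syl_eval :: "('g, 'b) monoid_scheme \<Rightarrow> ('v \<Rightarrow> 'g) \<Rightarrow> ('v \<times> int) list \<Rightarrow> 'g" where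
  "syl_eval G f xs = foldr (\<lambda>x a. f (fst x) [^]\<^bsub>G\<^esub> snd x \<otimes>\<^bsub>G\<^esub> a) xs \<one>\<^bsub>G\<^esub>"

locale commuting_family = group G for G :: "('g, 'b) monoid_scheme" (structure) +
  fixes V :: "'v set" and adj :: "'v \<Rightarrow> 'v \<Rightarrow> bool" and f :: "'v \<Rightarrow> 'g"
  assumes adj_sym: "adj u v \<Longrightarrow> adj v u"
    and adj_irrefl: "\<not> adj v v"
    and f_closed: "v \<in> V \<Longrightarrow> f v \<in> carrier G"
    and f_commute: "u \<in> V \<Longrightarrow> v \<in> V \<Longrightarrow> adj u v \<Longrightarrow> f u \<otimes> f v = f v \<otimes> f u"
begin

abbreviation ev where "ev \<equiv> syl_eval G f"

lemma ev_Nil [simp]: "ev [] = \<one>" by (simp add: syl_eval_def)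

lemma ev_Cons [simp]: "ev (x # xs) = f (fst x) [^] snd x \<otimes> ev xs" by (simp add: syl_eval_def)

lemma ev_closed [simp]: "fst ` set xs \<subseteq> V \<Longrightarrow> ev xs \<in> carrier G"
  by (induction xs) (auto simp: f_closed)

lemma ev_append: "fst ` set xs \<subseteq> V \<Longrightarrow> fst ` set ys \<subseteq> V \<Longrightarrow> ev (xs @ ys) = ev xs \<otimes> ev ys"
  by (induction xs) (auto simp: f_closed m_assoc)

lemma pow_commute_ev:
  assumes "fst ` set xs \<subseteq> V" "v \<in> V" "\<And>x. x \<in> set xs \<Longrightarrow> adj v (fst x)"
  shows "f v [^] (e::int) \<otimes> ev xs = ev xs \<otimes> f v [^] e"
  using assms
proof (induction xs)
  case (Cons x xs)
  then have c: "fst x \<in> V" "ev xs \<in> carrier G" by auto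
  have cl: "f v \<in> carrier G" "f (fst x) \<in> carrier G" using c Cons.prems f_closed by auto
  have comm: "f v [^] e \<otimes> f (fst x) [^] snd x = f (fst x) [^] snd x \<otimes> f v [^] e"
    using Cons.prems c cl by (intro commute_int_pow f_commute) auto
  have IH: "f v [^] e \<otimes> ev xs = ev xs \<otimes> f v [^] e" using Cons by auto
  have "f v [^] e \<otimes> (f (fst x) [^] snd x \<otimes> ev xs) = (f v [^] e \<otimes> f (fst x) [^] snd x) \<otimes> ev xs"
    using cl c by (simp add: m_assoc)
  also have "\<dots> = f (fst x) [^] snd x \<otimes> (f v [^] e \<otimes> ev xs)"
    unfolding comm using cl c by (simp add: m_assoc)
  also have "\<dots> = f (fst x) [^] snd x \<otimes> ev xs \<otimes> f v [^] e"
    unfolding IH using cl c by (simp add: m_assoc)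
  finally show ?case by simp
qed (simp add: f_closed)

definition clique :: "('v \<times> int) list \<Rightarrow> bool" where
  "clique F \<longleftrightarrow> distinct (map fst F) \<and> fst ` set F \<subseteq> V \<and>
     (\<forall>x\<in>set F. \<forall>y\<in>set F. fst x \<noteq> fst y \<longrightarrow> adj (fst x) (fst y))"

text \<open>
  This is the Foata normal form of trace theory: every syllable of a layer fails to commute with some syllable
  of the layer before it.
\<close>

fun layered :: "('v \<times> int) list list \<Rightarrow> bool" where
  "layered [] \<longleftrightarrow> True"
| "layered (F # L) \<longleftrightarrow> clique F \<and> F \<noteq> [] \<and> (\<forall>x\<in>set F. snd x \<noteq> 0) \<and> layered L \<and>
     (\<forall>y\<in>set (case L of [] \<Rightarrow> [] | F' # _ \<Rightarrow> F'). \<exists>x\<in>set F. fst x \<noteq> fst y \<and> \<not> adj (fst x) (fst y))"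

text \<open>A syllable in the \<open>i\<close>-th layer is counted \<open>i\<close> times.\<close>

fun depth_weight :: "'x list list \<Rightarrow> nat" where
  "depth_weight [] = 0"
| "depth_weight (F # L) = length F + length (concat L) + depth_weight L"

lemma clique_append: "clique (b @ c) \<Longrightarrow> clique b \<and> clique c"
  by (auto simp: clique_def)

lemma clique_remove:
  "clique (b @ y # c) \<Longrightarrow> clique (b @ c)"
  by (auto simp: clique_def)

lemma clique_pow_commute:
  assumes "clique (b @ y # c)"
  shows "ev (b @ y # c) = f (fst y) [^] snd y \<otimes> ev (b @ c)"
proof -
  have V: "fst ` set b \<subseteq> V" "fst ` set c \<subseteq> V" "fst y \<in> V"
    using assms by (auto simp: clique_def)
  have adj: "adj (fst y) (fst x)" if "x \<in> set b" for x
    using assms that unfolding clique_def by (auto simp: image_iff)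
  have "ev (b @ y # c) = ev b \<otimes> f (fst y) [^] snd y \<otimes> ev c"
    using V by (simp add: ev_append f_closed m_assoc)
  also have "\<dots> = f (fst y) [^] snd y \<otimes> ev b \<otimes> ev c"
    using pow_commute_ev[OF V(1,3) adj] by simp
  also have "\<dots> = f (fst y) [^] snd y \<otimes> ev (b @ c)"
    using V by (simp add: ev_append f_closed m_assoc)
  finally show ?thesis .
qed

lemma clique_pow_commute_right:
  assumes "clique (b @ y # c)"
  shows "ev (b @ y # c) = ev (b @ c) \<otimes> f (fst y) [^] snd y"
proof -
  have V: "fst ` set (b @ c) \<subseteq> V" "fst y \<in> V" using assms by (auto simp: clique_def)
  have "adj (fst y) (fst x)" if "x \<in> set (b @ c)" for x
    using assms that unfolding clique_def by (auto simp: image_iff)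
  from pow_commute_ev[OF V this] show ?thesis
    using clique_pow_commute[OF assms] by simp
qed

text \<open>
  A syllable that commutes with the whole preceding layer can be moved there, where it either joins the layer or
  merges with a syllable of the same label. Each such move lowers the depth weight, so the process ends.
\<close>

lemma layered_form_exists:
  assumes "\<forall>F\<in>set L. clique F"
  shows "\<exists>L'. layered L' \<and> ev (concat L') = ev (concat L) \<and> length (concat L') \<le> length (concat L) \<and>
    depth_weight L' + length L' \<le> depth_weight L + length L"
  using assms
proof (induction "depth_weight L + length L" arbitrary: L rule: less_induct)
  case less
  have V: "fst ` set F \<subseteq> V" if "clique F" for F using that by (auto simp: clique_def)
  have Vc: "fst ` set (concat L) \<subseteq> V" if "\<forall>F\<in>set L. clique F" for L
  proof -
    have "fst ` set (concat L) = (\<Union>F\<in>set L. fst ` set F)" by auto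
    also have "\<dots> \<subseteq> V" using that V by blast
    finally show ?thesis .
  qed
  have rec: ?case if "\<forall>F\<in>set L1. clique F" "ev (concat L1) = ev (concat L)"
    "length (concat L1) \<le> length (concat L)"
    "depth_weight L1 + length L1 < depth_weight L + length L" for L1
  proof -
    from less.hyps[OF that(4,1)] obtain L2 where "layered L2" "ev (concat L2) = ev (concat L1)"
      "length (concat L2) \<le> length (concat L1)"
      "depth_weight L2 + length L2 \<le> depth_weight L1 + length L1" by blast
    with that show ?thesis by (intro exI[of _ L2]) auto
  qed
  show ?case
  proof (cases L)
    case Nil
    then show ?thesis by (intro exI[of _ "[]"]) auto
  next
    case (Cons F L0)
    have cl: "clique F" "\<forall>F\<in>set L0. clique F" using less.prems Cons by auto
    have "depth_weight L0 + length L0 < depth_weight L + length L" by (simp add: Cons)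
    from less.hyps[OF this cl(2)] obtain L1 where L1: "layered L1" "ev (concat L1) = ev (concat L0)"
      "length (concat L1) \<le> length (concat L0)"
      "depth_weight L1 + length L1 \<le> depth_weight L0 + length L0" by blast
    have cl1: "\<forall>F\<in>set L1. clique F" using L1(1) by (induction L1) auto
    have evL: "ev (concat L) = ev F \<otimes> ev (concat L1)"
      using L1(2) Cons ev_append[OF V[OF cl(1)] Vc[OF cl(2)]] by simp
    consider "F = []" | y where "y \<in> set F" "snd y = 0" | "F \<noteq> []" "\<forall>y\<in>set F. snd y \<noteq> 0"
      by blast
    then show ?thesis
    proof cases
      case 1
      then show ?thesis using L1 Cons evL by (intro exI[of _ L1]) auto
    next
      case (2 y)
      then obtain b c where F: "F = b @ y # c" by (meson split_list)
      have bc: "clique (b @ c)" using cl(1) clique_remove F by blast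
      have "ev F = ev (b @ c)"
        using clique_pow_commute[of b y c] cl(1) V[OF bc] 2 by (simp add: F)
      then have "ev (concat ((b @ c) # L1)) = ev (concat L)"
        using evL ev_append[OF V[OF bc] Vc[OF cl1]] by simp
      then show ?thesis
        by (rule rec[rotated]) (use bc cl1 L1(3,4) in \<open>auto simp: F Cons\<close>)
    next
      case 3
      show ?thesis
      proof (cases L1)
        case Nil
        then show ?thesis using 3 cl evL L1 Cons by (intro exI[of _ "[F]"]) (auto simp: V)
      next
        case L1_def: (Cons F' L2)
        have cl2: "clique F'" "\<forall>F\<in>set L2. clique F" using cl1 L1_def by auto
        show ?thesis
        proof (cases "\<forall>y\<in>set F'. \<exists>x\<in>set F. fst x \<noteq> fst y \<and> \<not> adj (fst x) (fst y)")
          case True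
          then show ?thesis using 3 cl evL L1 Cons ev_append[OF V[OF cl(1)] Vc[OF cl1]]
            by (intro exI[of _ "F # L1"]) (auto simp: V L1_def)
        next
          case False
          then obtain y where y: "y \<in> set F'" "\<forall>x\<in>set F. fst x = fst y \<or> adj (fst x) (fst y)" by blast
          then obtain b c where F': "F' = b @ y # c" by (meson split_list)
          have bc: "clique (b @ c)" using cl2(1) clique_remove F' by blast
          have yV: "fst y \<in> V" using V[OF cl2(1)] y by auto
          note [simp] = ev_closed[OF V[OF cl(1)]] ev_closed[OF V[OF bc]] ev_closed[OF Vc[OF cl2(2)]]
            f_closed[OF yV]
          have evL': "ev (concat L) = ev F \<otimes> f (fst y) [^] snd y \<otimes> (ev (b @ c) \<otimes> ev (concat L2))"
          proof -
            have "ev (concat L1) = ev F' \<otimes> ev (concat L2)"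
              using ev_append[OF V[OF cl2(1)] Vc[OF cl2(2)]] by (simp add: L1_def)
            also have "ev F' = f (fst y) [^] snd y \<otimes> ev (b @ c)"
              using clique_pow_commute cl2(1) F' by simp
            finally show ?thesis by (simp add: evL m_assoc)
          qed
          show ?thesis
          proof (cases "\<exists>x\<in>set F. fst x = fst y")
            case True
            then obtain x b1 c1 where x: "fst x = fst y" and F: "F = b1 @ x # c1" by (meson split_list)
            let ?F = "b1 @ (fst x, snd x + snd y) # c1"
            have clF: "clique ?F" using cl(1) unfolding clique_def F by auto
            note b1c1 = V[OF clique_remove[OF cl(1)[unfolded F]]]
            have "ev F \<otimes> f (fst y) [^] snd y = ev (b1 @ c1) \<otimes> (f (fst x) [^] snd x \<otimes> f (fst x) [^] snd y)"
              using clique_pow_commute_right[OF cl(1)[unfolded F]] b1c1 x by (simp add: F m_assoc)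
            also have "\<dots> = ev ?F"
              using clique_pow_commute_right[OF clF] x by (simp add: int_pow_mult)
            finally have "ev (concat (?F # (b @ c) # L2)) = ev (concat L)"
              using ev_append[OF V[OF clF], of "(b @ c) @ concat L2"] ev_append[of "b @ c" "concat L2"] evL'
                V[OF bc] Vc[OF cl2(2)] by (simp add: image_Un)
            then show ?thesis
              by (rule rec[rotated]) (use clF bc cl2 L1(3,4) in \<open>auto simp: F F' Cons L1_def\<close>)
          next
            case False
            have clF: "clique (F @ [y])"
              using False y cl(1) yV adj_sym unfolding clique_def by (auto simp: image_iff)
            have "ev F \<otimes> f (fst y) [^] snd y = ev (F @ [y])"
              using yV ev_append[OF V[OF cl(1)], of "[y]"] by simp
            then have "ev (concat ((F @ [y]) # (b @ c) # L2)) = ev (concat L)"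
              using ev_append[OF V[OF clF], of "(b @ c) @ concat L2"] ev_append[of "b @ c" "concat L2"] evL'
                V[OF bc] Vc[OF cl2(2)] by (simp add: image_Un)
            then show ?thesis
              by (rule rec[rotated]) (use clF bc cl2 L1(3,4) in \<open>auto simp: F' Cons L1_def\<close>)
          qed
        qed
      qed
    qed
  qed
qed

end

section \<open>Ping-pong with coarse coordinates\<close>

text \<open>
  The function \<open>s v\<close> is the coordinate of the generator \<open>f v\<close>: it is shifted by \<open>f v\<close> (\<open>translate\<close>), almost
  ignores the generators commuting with \<open>f v\<close> (\<open>almost_invariant\<close>), and cannot be large at the same time as the
  coordinate of a generator that does not commute with \<open>f v\<close> (\<open>exclusive\<close>). The shift \<open>T\<close> exceeds what a clique of
  commuting generators can undo.
\<close>

locale coarse_ping_pong = commuting_family G V adj f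
  for G :: "('g, 'b) monoid_scheme" (structure) and V :: "'v set" and adj f +
  fixes s :: "'v \<Rightarrow> 'g \<Rightarrow> real" and R C T :: real
  assumes finite_V: "finite V"
    and R_nonneg: "R \<ge> 0" and C_nonneg: "C \<ge> 0"
    and base: "v \<in> V \<Longrightarrow> \<bar>s v \<one>\<bar> \<le> R"
    and translate: "v \<in> V \<Longrightarrow> z \<in> carrier G \<Longrightarrow>
      \<bar>s v (f v [^] (e::int) \<otimes> z) - s v z - of_int e * T\<bar> \<le> C"
    and almost_invariant: "u \<in> V \<Longrightarrow> v \<in> V \<Longrightarrow> adj u v \<Longrightarrow> z \<in> carrier G \<Longrightarrow>
      \<bar>s v (f u [^] (e::int) \<otimes> z) - s v z\<bar> \<le> C"
    and exclusive: "u \<in> V \<Longrightarrow> v \<in> V \<Longrightarrow> u \<noteq> v \<Longrightarrow> \<not> adj u v \<Longrightarrow> z \<in> carrier G \<Longrightarrow>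
      \<bar>s u z\<bar> \<le> R \<or> \<bar>s v z\<bar> \<le> R"
    and T_big: "T > 2 * R + (real (card V) + 1) * C"
begin

lemma shift_by_adjacent:
  assumes "fst ` set F \<subseteq> V" "\<And>x. x \<in> set F \<Longrightarrow> adj (fst x) v" "v \<in> V" "z \<in> carrier G"
  shows "\<bar>s v (ev F \<otimes> z) - s v z\<bar> \<le> real (length F) * C"
  using assms
proof (induction F)
  case (Cons x F)
  have c: "ev F \<in> carrier G" "fst x \<in> V" using Cons.prems by auto
  have "\<bar>s v (f (fst x) [^] snd x \<otimes> (ev F \<otimes> z)) - s v (ev F \<otimes> z)\<bar> \<le> C"
    using Cons.prems c by (intro almost_invariant) auto
  moreover have "\<bar>s v (ev F \<otimes> z) - s v z\<bar> \<le> real (length F) * C" using Cons by auto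
  moreover have "ev (x # F) \<otimes> z = f (fst x) [^] snd x \<otimes> (ev F \<otimes> z)"
    using c Cons.prems by (simp add: m_assoc f_closed)
  ultimately show ?case by (simp add: algebra_simps)
qed simp

lemma shift_by_clique:
  assumes "clique F" "x \<in> set F" "z \<in> carrier G"
  shows "\<bar>s (fst x) (ev F \<otimes> z) - s (fst x) z - of_int (snd x) * T\<bar> \<le> real (card V) * C"
proof -
  obtain b c where F: "F = b @ x # c" using assms(2) by (meson split_list)
  have V: "fst ` set (b @ c) \<subseteq> V" "fst x \<in> V" using assms(1) by (auto simp: clique_def F)
  have "adj (fst y) (fst x)" if "y \<in> set (b @ c)" for y
    using assms(1) that unfolding clique_def F by (auto simp: image_iff)
  from shift_by_adjacent[OF V(1) this V(2) assms(3)]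
  have 1: "\<bar>s (fst x) (ev (b @ c) \<otimes> z) - s (fst x) z\<bar> \<le> real (length (b @ c)) * C" .
  have eq: "ev F \<otimes> z = f (fst x) [^] snd x \<otimes> (ev (b @ c) \<otimes> z)"
    using clique_pow_commute[of b x c] assms V by (simp add: F m_assoc f_closed)
  have 2: "\<bar>s (fst x) (ev F \<otimes> z) - s (fst x) (ev (b @ c) \<otimes> z) - of_int (snd x) * T\<bar> \<le> C"
    unfolding eq using V assms by (intro translate) auto
  have "card (fst ` set F) = length F"
    using assms(1) distinct_card[of "map fst F"] by (simp add: clique_def)
  then have "length F \<le> card V"
    using card_mono[OF finite_V, of "fst ` set F"] assms(1) by (simp add: clique_def)
  then have "real (length (b @ c)) * C + C \<le> real (card V) * C"
    using mult_right_mono[OF _ C_nonneg, of "real (length F)" "real (card V)"] by (simp add: F algebra_simps)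
  then show ?thesis using 1 2 by linarith
qed

text \<open>
  This is the ping-pong argument. Some syllable \<open>y\<close> of the second layer has a large coordinate at the product of
  the layers after the first. It is blocked by a syllable \<open>x\<close> of the first layer, whose coordinate is therefore small
  there. Multiplying by the first layer shifts this coordinate by a multiple of \<open>T\<close>, up to an error for
  each other member of the layer.
\<close>

lemma layered_escapes:
  assumes "layered L" "L \<noteq> []"
  shows "\<exists>x\<in>set (hd L). \<bar>s (fst x) (ev (concat L))\<bar> > R"
  using assms
proof (induction L)
  case (Cons F L)
  have F: "clique F" "F \<noteq> []" "layered L" and nz: "\<And>x. x \<in> set F \<Longrightarrow> snd x \<noteq> 0" using Cons.prems by auto
  have "clique F" if "F \<in> set L" for F
    using \<open>layered L\<close> that by (induction L) auto
  then have VL: "fst ` set F \<subseteq> V" if "F \<in> set L" for F using that by (auto simp: clique_def)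
  then have V: "fst ` set F \<subseteq> V" "fst ` set (concat L) \<subseteq> V" using F(1) unfolding clique_def by auto
  have "\<exists>x\<in>set F. \<bar>s (fst x) (ev (concat L))\<bar> \<le> R"
  proof (cases L)
    case Nil
    then show ?thesis using base V F(2) by (cases F) auto
  next
    case (Cons F' L')
    then obtain y where y: "y \<in> set F'" "\<bar>s (fst y) (ev (concat L))\<bar> > R"
      using Cons.IH F(3) by auto
    then obtain x where x: "x \<in> set F" "fst x \<noteq> fst y" "\<not> adj (fst x) (fst y)"
      using Cons.prems Cons by auto
    have "fst y \<in> V" using V(2) y(1) Cons by auto
    then show ?thesis
      using exclusive[of "fst x" "fst y" "ev (concat L)"] x y V by fastforce
  qed
  then obtain x where x: "x \<in> set F" "\<bar>s (fst x) (ev (concat L))\<bar> \<le> R" by blast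
  have "\<bar>s (fst x) (ev F \<otimes> ev (concat L)) - s (fst x) (ev (concat L)) - of_int (snd x) * T\<bar> \<le> real (card V) * C"
    using shift_by_clique[OF F(1) x(1)] V by simp
  moreover have "\<bar>of_int (snd x) * T\<bar> \<ge> T"
  proof -
    have "1 \<le> \<bar>snd x\<bar>" using nz[OF x(1)] by linarith
    then have "1 \<le> \<bar>of_int (snd x) :: real\<bar>" by linarith
    moreover have "T \<ge> 0"
    proof -
      have "(real (card V) + 1) * C \<ge> 0" using C_nonneg by simp
      then show ?thesis using T_big R_nonneg by linarith
    qed
    ultimately show ?thesis by (simp add: abs_mult mult_right_mono[of 1, simplified] mult_le_cancel_right1)
  qed
  moreover have "T > 2 * R + real (card V) * C" using T_big C_nonneg by (simp add: algebra_simps)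
  ultimately have "\<bar>s (fst x) (ev F \<otimes> ev (concat L))\<bar> > R" using x(2) by linarith
  moreover have "ev (concat (F # L)) = ev F \<otimes> ev (concat L)" using ev_append[OF V] by simp
  ultimately show ?case using x(1) by auto
qed simp

lemma layered_eval_trivial:
  assumes "layered L" "ev (concat L) = \<one>"
  shows "L = []"
proof (rule ccontr)
  assume L: "L \<noteq> []"
  from layered_escapes[OF assms(1) L] obtain x where x: "x \<in> set (hd L)" "\<bar>s (fst x) \<one>\<bar> > R"
    using assms(2) by auto
  have "clique (hd L)" using assms(1) L by (cases L) auto
  then show False using x base[of "fst x"] by (auto simp: clique_def)
qed

end

section \<open>Reduced products\<close>

context commuting_family
begin

text \<open>
  The first syllable whose label is not adjacent to \<open>v\<close> must not have label \<open>v\<close>. Otherwise a syllable with label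
  \<open>v\<close> in front could be moved next to it and merged with it.
\<close>

fun no_merge :: "'v \<Rightarrow> ('v \<times> int) list \<Rightarrow> bool" where
  "no_merge v [] \<longleftrightarrow> True"
| "no_merge v (y # ys) \<longleftrightarrow> (if adj v (fst y) then no_merge v ys else fst y \<noteq> v)"

fun reduced :: "('v \<times> int) list \<Rightarrow> bool" where
  "reduced [] \<longleftrightarrow> True"
| "reduced (x # xs) \<longleftrightarrow> snd x \<noteq> 0 \<and> no_merge (fst x) xs \<and> reduced xs"

lemma no_merge_iff:
  "no_merge v xs \<longleftrightarrow> (\<forall>b y c. xs = b @ y # c \<longrightarrow> fst y = v \<longrightarrow> (\<exists>z\<in>set b. \<not> adj v (fst z)))"
proof (induction xs)
  case (Cons x xs)
  show ?case (is "_ \<longleftrightarrow> ?R")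
  proof (cases "adj v (fst x)")
    case True
    then have x: "fst x \<noteq> v" using adj_irrefl by metis
    have "?R \<longleftrightarrow> (\<forall>b y c. xs = b @ y # c \<longrightarrow> fst y = v \<longrightarrow> (\<exists>z\<in>set b. \<not> adj v (fst z)))"
    proof (intro iffI allI impI)
      fix b y c assume R: ?R and eq: "xs = b @ y # c" "fst y = v"
      have "x # xs = (x # b) @ y # c" using eq by simp
      with R eq(2) have "\<exists>z\<in>set (x # b). \<not> adj v (fst z)" by blast
      then show "\<exists>z\<in>set b. \<not> adj v (fst z)" using True by simp
    next
      fix b y c
      assume R: "\<forall>b y c. xs = b @ y # c \<longrightarrow> fst y = v \<longrightarrow> (\<exists>z\<in>set b. \<not> adj v (fst z))"
        and eq: "x # xs = b @ y # c" "fst y = v"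
      then obtain b' where "b = x # b'" "xs = b' @ y # c" using x by (cases b) auto
      with R eq(2) show "\<exists>z\<in>set b. \<not> adj v (fst z)" by fastforce
    qed
    then show ?thesis using Cons True by simp
  next
    case False
    have "?R" if "fst x \<noteq> v"
    proof (intro allI impI)
      fix b y c assume eq: "x # xs = b @ y # c" "fst y = v"
      then have "x \<in> set b" using that by (cases b) auto
      then show "\<exists>z\<in>set b. \<not> adj v (fst z)" using False by blast
    qed
    moreover have "fst x \<noteq> v" if ?R using that[rule_format, of "[]" x xs] by auto
    ultimately show ?thesis using False by auto
  qed
qed simp

text \<open>In this form the condition is visibly invariant under reversal of the list.\<close>

lemma reduced_iff:
  "reduced xs \<longleftrightarrow> (\<forall>x\<in>set xs. snd x \<noteq> 0) \<and>
     (\<forall>a x b y c. xs = a @ x # b @ y # c \<longrightarrow> fst x = fst y \<longrightarrow> (\<exists>z\<in>set b. \<not> adj (fst x) (fst z)))"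
proof (induction xs)
  case (Cons x xs)
  define Q where "Q xs \<longleftrightarrow> (\<forall>a x b y c. xs = a @ x # b @ y # c \<longrightarrow> fst x = fst y \<longrightarrow>
    (\<exists>z\<in>set b. \<not> adj (fst x) (fst z)))" for xs :: "('v \<times> int) list"
  have "Q (x # xs) \<longleftrightarrow> no_merge (fst x) xs \<and> Q xs"
  proof (intro iffI conjI)
    assume *: "Q (x # xs)"
    show "no_merge (fst x) xs"
      unfolding no_merge_iff using *[unfolded Q_def, rule_format, of "[]" x] by auto
    show "Q xs"
      unfolding Q_def
    proof (intro allI impI)
      fix a x' b y c assume "xs = a @ x' # b @ y # c" "fst x' = fst y"
      then show "\<exists>z\<in>set b. \<not> adj (fst x') (fst z)"
        using *[unfolded Q_def, rule_format, of "x # a" x' b y c] by simp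
    qed
  next
    assume *: "no_merge (fst x) xs \<and> Q xs"
    show "Q (x # xs)"
      unfolding Q_def
    proof (intro allI impI)
      fix a x' b y c assume eq: "x # xs = a @ x' # b @ y # c" "fst x' = fst y"
      show "\<exists>z\<in>set b. \<not> adj (fst x') (fst z)"
      proof (cases a)
        case Nil
        then have x: "x' = x" "xs = b @ y # c" using eq(1) by auto
        have "no_merge (fst x) xs" using * by simp
        from this[unfolded no_merge_iff, rule_format, OF x(2)] show ?thesis
          using eq(2) by (simp add: x(1))
      next
        case (Cons x0 a')
        then have "xs = a' @ x' # b @ y # c" using eq by auto
        then show ?thesis using * eq(2) unfolding Q_def by blast
      qed
    qed
  qed
  then show ?case using Cons unfolding Q_def[symmetric] by auto
qed simp

lemma reduced_appendD: "reduced (xs @ ys) \<Longrightarrow> reduced xs \<and> reduced ys"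
proof (induction xs)
  case (Cons x xs)
  have "no_merge v (xs @ ys) \<Longrightarrow> no_merge v xs" for v
    by (induction xs) auto
  with Cons show ?case by auto
qed simp

text \<open>
  Between two syllables of the same label there is a whole layer, just before the second of them, and in
  that layer the second syllable is blocked.
\<close>

lemma layered_reduced:
  assumes "layered L"
  shows "reduced (concat L)"
proof -
  have nz: "layered L \<Longrightarrow> x \<in> set (concat L) \<Longrightarrow> snd x \<noteq> 0" for x L
    by (induction L) auto
  have clique_no_merge: "no_merge v (F @ ys)" if "clique F" "v \<notin> fst ` set F" "no_merge v ys" for v F ys
    using that
  proof (induction F)
    case (Cons x F)
    have "clique F" using Cons.prems(1) clique_append[of "[x]" F] by simp
    then show ?case using Cons by auto
  qed simp
  have main: "reduced (F @ ys)" if "clique F" "\<And>x. x \<in> set F \<Longrightarrow> snd x \<noteq> 0 \<and> no_merge (fst x) ys" "reduced ys" for F ys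
    using that
  proof (induction F)
    case (Cons x F)
    have F: "clique F" using Cons.prems(1) clique_append[of "[x]" F] by simp
    moreover have "fst x \<notin> fst ` set F" using Cons.prems(1) by (auto simp: clique_def)
    ultimately have "no_merge (fst x) (F @ ys)" using Cons.prems(2) by (intro clique_no_merge) auto
    then show ?case using Cons F by auto
  qed simp
  have skip: "no_merge v (F @ ys)" if "v \<notin> fst ` set F" "\<exists>y\<in>set F. \<not> adj v (fst y)" for v F ys
    using that by (induction F) auto
  \<comment> \<open>a layer all of whose labels are adjacent to \<open>v\<close> cannot block a \<open>v\<close> in the next layer\<close>
  have absent: "no_merge v (concat L)" if "layered L" "L \<noteq> [] \<Longrightarrow> v \<notin> fst ` set (hd L)" for v L
    using that
  proof (induction L)
    case (Cons F L)
    have F: "clique F" "v \<notin> fst ` set F" "layered L" using Cons.prems by auto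
    show ?case
    proof (cases "\<forall>y\<in>set F. adj v (fst y)")
      case True
      have "v \<notin> fst ` set (hd L)" if "L \<noteq> []"
        using Cons.prems(1) True that adj_sym by (cases L) force+
      then show ?thesis using Cons.IH F clique_no_merge by simp
    next
      case False
      then show ?thesis using skip F(2) by auto
    qed
  qed simp
  have nm: "no_merge (fst x) (concat L)" if "layered (F # L)" "x \<in> set F" for x F L
  proof (rule absent)
    show "layered L" using that by simp
    have F: "clique F" using that by simp
    show "fst x \<notin> fst ` set (hd L)" if "L \<noteq> []"
    proof
      assume "fst x \<in> fst ` set (hd L)"
      then obtain y u where "u \<in> set F" "fst u \<noteq> fst y" "\<not> adj (fst u) (fst y)" "fst y = fst x"
        using \<open>layered (F # L)\<close> \<open>L \<noteq> []\<close> by (cases L) auto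
      then show False using F \<open>x \<in> set F\<close> unfolding clique_def by metis
    qed
  qed
  show ?thesis
    using assms
  proof (induction L)
    case (Cons F L)
    then show ?case using main[of F "concat L"] nm[of F L] nz[of "F # L"] by auto
  qed simp
qed

end

context commuting_family
begin

text \<open>
  Read the list as the part of a word in front of a syllable with label \<open>u\<close>. A syllable is dropped if it can be
  commuted past \<open>u\<close> and past all later syllables that are kept. So the kept syllables are those that are below
  the final one in the partial order which partial commutation leaves of the word.
\<close>

fun keep :: "'v \<Rightarrow> ('v \<times> int) list \<Rightarrow> ('v \<times> int) list" where
  "keep u [] = []"
| "keep u (x # xs) =
     (if adj (fst x) u \<and> (\<forall>y\<in>set (keep u xs). adj (fst x) (fst y)) then keep u xs else x # keep u xs)"

fun tight :: "'v \<Rightarrow> ('v \<times> int) list \<Rightarrow> bool" where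
  "tight u [] \<longleftrightarrow> True"
| "tight u (x # xs) \<longleftrightarrow> tight u xs \<and> \<not> (adj (fst x) u \<and> (\<forall>y\<in>set xs. adj (fst x) (fst y)))"

lemma tight_keep: "tight u (keep u xs)"
  by (induction xs) auto

lemma tight_append: "tight u (xs @ ys) \<Longrightarrow> tight u ys"
  by (induction xs) auto

lemma set_keep: "set (keep u xs) \<subseteq> set xs"
  by (induction xs) auto

lemma no_merge_notin: "v \<notin> fst ` set xs \<Longrightarrow> no_merge v xs"
  by (induction xs) auto

lemma no_merge_keep:
  "no_merge v (xs @ [(u, e)]) \<Longrightarrow> no_merge v (keep u xs @ [(u, e)])"
proof (induction xs)
  case (Cons y ys)
  show ?case
  proof (cases "adj v (fst y)")
    case True
    then show ?thesis using Cons by simp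
  next
    case False
    then have y: "fst y \<noteq> v" using Cons.prems by simp
    show ?thesis
    proof (cases "adj (fst y) u \<and> (\<forall>z\<in>set (keep u ys). adj (fst y) (fst z))")
      case drop: True
      then have "v \<notin> fst ` set (keep u ys @ [(u, e)])"
        using False adj_sym by auto
      then show ?thesis using drop by (simp add: no_merge_notin)
    next
      case keep: False
      then have "keep u (y # ys) = y # keep u ys" by (simp only: keep.simps if_False)
      then show ?thesis using y False by simp
    qed
  qed
qed simp

lemma reduced_keep: "reduced (xs @ [(u, e)]) \<Longrightarrow> reduced (keep u xs @ [(u, e)])"
  by (induction xs) (auto simp: no_merge_keep)

lemma ev_keep:
  assumes "fst ` set xs \<subseteq> V"
  shows "\<exists>d. fst ` set d \<subseteq> V \<and> (\<forall>x\<in>set d. adj (fst x) u) \<and> ev xs = ev (keep u xs) \<otimes> ev d"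
  using assms
proof (induction xs)
  case (Cons x xs)
  then obtain d where d: "fst ` set d \<subseteq> V" "\<forall>x\<in>set d. adj (fst x) u" "ev xs = ev (keep u xs) \<otimes> ev d"
    by auto
  have xV: "fst x \<in> V" and kV: "fst ` set (keep u xs) \<subseteq> V" using Cons.prems set_keep[of u xs] by auto
  have cl: "f (fst x) [^] snd x \<in> carrier G" "ev (keep u xs) \<in> carrier G" "ev d \<in> carrier G"
    using f_closed[OF xV] ev_closed[OF kV] ev_closed[OF d(1)] by auto
  show ?case
  proof (cases "adj (fst x) u \<and> (\<forall>y\<in>set (keep u xs). adj (fst x) (fst y))")
    case True
    have comm: "f (fst x) [^] snd x \<otimes> ev (keep u xs) = ev (keep u xs) \<otimes> f (fst x) [^] snd x"
      by (rule pow_commute_ev[OF kV xV]) (use True in auto)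
    have "ev (x # xs) = (f (fst x) [^] snd x \<otimes> ev (keep u xs)) \<otimes> ev d"
      using cl by (simp add: d(3) m_assoc)
    also have "\<dots> = ev (keep u xs) \<otimes> ev (x # d)"
      unfolding comm using cl by (simp add: m_assoc)
    finally show ?thesis using True d xV by (intro exI[of _ "x # d"]) auto
  next
    case False
    then have "keep u (x # xs) = x # keep u xs" by (simp only: keep.simps if_False)
    then show ?thesis using d cl by (intro exI[of _ d]) (simp add: m_assoc)
  qed
qed (auto intro: exI[of _ "[]"])

definition syl_inverse :: "('v \<times> int) list \<Rightarrow> ('v \<times> int) list" where
  "syl_inverse xs = rev (map (\<lambda>x. (fst x, - snd x)) xs)"

lemma ev_syl_inverse:
  assumes "fst ` set xs \<subseteq> V"
  shows "ev (syl_inverse xs) = inv (ev xs)"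
  using assms
proof (induction xs)
  case (Cons x xs)
  have 1: "ev (syl_inverse xs @ [(fst x, - snd x)]) = ev (syl_inverse xs) \<otimes> ev [(fst x, - snd x)]"
    using Cons.prems by (intro ev_append) (auto simp: syl_inverse_def)
  have cl: "ev xs \<in> carrier G" "f (fst x) \<in> carrier G" using Cons.prems f_closed by auto
  have "ev (syl_inverse (x # xs)) = ev (syl_inverse xs @ [(fst x, - snd x)])"
    by (simp add: syl_inverse_def)
  also have "\<dots> = inv (ev xs) \<otimes> inv (f (fst x) [^] snd x)"
    unfolding 1 using Cons cl by (simp add: int_pow_neg)
  also have "\<dots> = inv (ev (x # xs))" using cl by (simp add: inv_mult_group)
  finally show ?case .
qed (simp add: syl_inverse_def)

lemma reduced_syl_inverse:
  assumes "reduced xs"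
  shows "reduced (syl_inverse xs)"
  unfolding reduced_iff
proof (intro conjI allI impI)
  show "\<forall>x\<in>set (syl_inverse xs). snd x \<noteq> 0"
    using assms unfolding reduced_iff by (auto simp: syl_inverse_def)
  fix a x b y c assume eq: "syl_inverse xs = a @ x # b @ y # c" and xy: "fst x = fst y"
  have inv: "syl_inverse (syl_inverse zs) = zs" for zs
    by (induction zs) (auto simp: syl_inverse_def rev_map)
  have "xs = syl_inverse (a @ x # b @ y # c)" by (simp flip: eq add: inv)
  also have "\<dots> = syl_inverse c @ (fst y, - snd y) # syl_inverse b @ (fst x, - snd x) # syl_inverse a"
    by (simp add: syl_inverse_def)
  finally have "\<exists>z\<in>set (syl_inverse b). \<not> adj (fst y) (fst z)"
    using assms xy unfolding reduced_iff by (metis fst_conv)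
  then show "\<exists>z\<in>set b. \<not> adj (fst x) (fst z)"
    using xy by (auto simp: syl_inverse_def)
qed

end

section \<open>Counting the unfinished syllables along a path\<close>

text \<open>
  Truncate \<open>t\<close> to the interval between \<open>R\<close> and \<open>M - R'\<close>. The truncated function has to climb the
  whole interval. A step on which it grows starts or ends in the interior, because the interval is longer than a step.
\<close>

lemma path_crosses_interval:
  fixes t :: "nat \<Rightarrow> real"
  assumes start: "\<bar>t 0\<bar> \<le> R" and final: "\<bar>t n - M\<bar> \<le> R'" and step: "\<And>k. k < n \<Longrightarrow> \<bar>t (Suc k) - t k\<bar> \<le> K"
    and K: "K \<ge> 0" and gap: "\<bar>M\<bar> - R - R' > K"
  shows "\<bar>M\<bar> - R - R' \<le> 2 * K * real (card {k. k \<le> n \<and> \<bar>t k\<bar> > R \<and> \<bar>t k - M\<bar> > R'})"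
proof -
  define inside where "inside t M = {k. k \<le> n \<and> \<bar>t k\<bar> > R \<and> \<bar>t k - M\<bar> > R'}" for t :: "nat \<Rightarrow> real" and M
  have pos: "M - R - R' \<le> 2 * K * real (card (inside t M))"
    if start: "\<bar>t 0\<bar> \<le> R" and final: "\<bar>t n - M\<bar> \<le> R'" and step: "\<And>k. k < n \<Longrightarrow> \<bar>t (Suc k) - t k\<bar> \<le> K"
      and gap: "M - R - R' > K" for t :: "nat \<Rightarrow> real" and M
  proof -
    define c where "c x = max R (min x (M - R'))" for x
    define I where "I k = (if \<bar>t k\<bar> > R \<and> \<bar>t k - M\<bar> > R' then 1 else 0 :: real)" for k
    have I0: "I k \<ge> 0" for k by (simp add: I_def)
    have one: "c (t (Suc k)) - c (t k) \<le> K * (I k + I (Suc k))" if k: "k < n" for k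
    proof (cases "I k = 0 \<and> I (Suc k) = 0")
      case True
      then have "\<not> (R < t k \<and> t k < M - R')" "\<not> (R < t (Suc k) \<and> t (Suc k) < M - R')"
        by (auto simp: I_def split: if_splits)
      then have "c (t (Suc k)) - c (t k) \<le> 0"
        using step[OF k] gap unfolding c_def by (simp add: max_def min_def abs_le_iff) linarith
      then show ?thesis using True by simp
    next
      case False
      then have "I k + I (Suc k) \<ge> 1" by (auto simp: I_def split: if_splits)
      then have "K * 1 \<le> K * (I k + I (Suc k))" using K by (intro mult_left_mono) auto
      moreover have "c (t (Suc k)) - c (t k) \<le> K"
        using step[OF k] K unfolding c_def by (auto simp: max_def min_def abs_le_iff)
      ultimately show ?thesis by simp
    qed
    have "c (t n) - c (t 0) = (\<Sum>k<n. c (t (Suc k)) - c (t k))"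
      by (rule sum_lessThan_telescope[of "\<lambda>k. c (t k)" n, symmetric])
    also have "\<dots> \<le> (\<Sum>k<n. K * (I k + I (Suc k)))" by (rule sum_mono) (use one in auto)
    also have "\<dots> = K * ((\<Sum>k<n. I k) + (\<Sum>k<n. I (Suc k)))"
      by (simp add: sum_distrib_left sum.distrib distrib_left)
    also have "\<dots> \<le> K * ((\<Sum>k\<le>n. I k) + (\<Sum>k\<le>n. I k))"
    proof (intro mult_left_mono add_mono K)
      show "(\<Sum>k<n. I k) \<le> (\<Sum>k\<le>n. I k)" using I0 by (intro sum_mono2) auto
      show "(\<Sum>k<n. I (Suc k)) \<le> (\<Sum>k\<le>n. I k)"
        using I0[of 0] by (simp add: sum.atMost_shift)
    qed
    also have "(\<Sum>k\<le>n. I k) = real (card (inside t M))"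
    proof -
      have "(\<Sum>k\<le>n. I k) = (\<Sum>k\<in>{k\<in>{..n}. \<bar>t k\<bar> > R \<and> \<bar>t k - M\<bar> > R'}. 1)"
        unfolding I_def by (rule sum.inter_filter[symmetric]) simp
      then show ?thesis by (simp add: atMost_def inside_def)
    qed
    finally have "c (t n) - c (t 0) \<le> 2 * K * real (card (inside t M))"
      by (simp add: algebra_simps)
    moreover have "c (t n) = M - R'" "c (t 0) = R"
      using start final gap K by (auto simp: c_def max_def min_def abs_le_iff)
    ultimately show ?thesis by simp
  qed
  show ?thesis
  proof (cases "M \<ge> 0")
    case True
    then show ?thesis using pos[of t M] start final step gap by (simp add: inside_def)
  next
    case False
    have "- M - R - R' \<le> 2 * K * real (card (inside (\<lambda>k. - t k) (- M)))"
      using start final step gap False by (intro pos) (auto simp: abs_le_iff)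
    moreover have "\<bar>- t k - - M\<bar> = \<bar>t k - M\<bar>" for k by linarith
    ultimately show ?thesis using False by (simp add: inside_def)
  qed
qed

locale rigid_ping_pong = coarse_ping_pong G V adj f s R C T
  for G :: "('g, 'b) monoid_scheme" (structure) and V :: "'v set" and adj f s R C T +
  assumes invariant: "u \<in> V \<Longrightarrow> v \<in> V \<Longrightarrow> adj u v \<Longrightarrow> z \<in> carrier G \<Longrightarrow>
      s v (f u [^] (e::int) \<otimes> z) = s v z"
begin

lemma ev_adjacent_invariant:
  assumes "fst ` set d \<subseteq> V" "\<And>x. x \<in> set d \<Longrightarrow> adj (fst x) v" "v \<in> V" "z \<in> carrier G"
  shows "s v (ev d \<otimes> z) = s v z"
  using assms
proof (induction d)
  case (Cons x d)
  have c: "ev d \<in> carrier G" "fst x \<in> V" using Cons.prems by auto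
  have "s v (f (fst x) [^] snd x \<otimes> (ev d \<otimes> z)) = s v (ev d \<otimes> z)"
    using Cons.prems c by (intro invariant) auto
  moreover have "ev (x # d) \<otimes> z = f (fst x) [^] snd x \<otimes> (ev d \<otimes> z)"
    using c Cons.prems by (simp add: m_assoc f_closed)
  ultimately show ?case using Cons by simp
qed simp

lemma inv_ev_adjacent_invariant:
  assumes "fst ` set d \<subseteq> V" "\<And>x. x \<in> set d \<Longrightarrow> adj (fst x) v" "v \<in> V" "z \<in> carrier G"
  shows "s v (inv (ev d) \<otimes> z) = s v z"
  using ev_adjacent_invariant[OF assms(1-3), of "inv (ev d) \<otimes> z"] assms
  by (simp flip: m_assoc)

lemma big_after_power:
  assumes "v \<in> V" "z \<in> carrier G" "\<bar>s v z\<bar> \<le> R" "e \<noteq> 0"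
  shows "\<bar>s v (f v [^] (e::int) \<otimes> z)\<bar> > R"
proof -
  have T0: "T > 2 * R + C"
    using T_big C_nonneg mult_right_mono[of 1 "real (card V) + 1" C] by simp
  have "1 \<le> \<bar>of_int e :: real\<bar>" using assms(4) by linarith
  then have "T \<le> \<bar>of_int e * T\<bar>"
    using T0 R_nonneg C_nonneg mult_right_mono[of 1 "\<bar>of_int e\<bar>" T] by (simp add: abs_mult)
  then show ?thesis using translate[OF assms(1,2), of e] T0 assms(3) by linarith
qed

lemma inv_ev_append:
  assumes "fst ` set xs \<subseteq> V" "fst ` set ys \<subseteq> V" "z \<in> carrier G"
  shows "inv (ev (xs @ ys)) \<otimes> z = inv (ev ys) \<otimes> (inv (ev xs) \<otimes> z)"
  using assms ev_append[OF assms(1,2)] by (simp add: inv_mult_group m_assoc)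

text \<open>
  Here a large \<open>s v y\<close> is passed on through the word: the first syllable of \<open>xs\<close> that does not commute with \<open>v\<close> has
  a small coordinate when it is reached, hence a large one once it is removed, and it takes over the role of \<open>v\<close>.
  Tightness guarantees that the last syllable in this chain does not commute with \<open>u\<close>.
\<close>

lemma propagation:
  assumes "reduced ((v, e0) # xs @ [(u, e1)])" "tight u ((v, e0) # xs)"
    "fst ` set xs \<subseteq> V" "u \<in> V" "v \<in> V" "y \<in> carrier G" "\<bar>s v y\<bar> > R"
  shows "\<bar>s u (inv (ev xs) \<otimes> y)\<bar> \<le> R"
  using assms
proof (induction "length xs" arbitrary: xs v e0 y rule: less_induct)
  case less
  show ?case
  proof (cases "\<forall>x\<in>set xs. adj v (fst x)")
    case True
    then have nadj: "\<not> adj v u" using less.prems(2) by auto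
    have "no_merge v (xs @ [(u, e1)])" using less.prems(1) by simp
    then have "no_merge v [(u, e1)]" using True by (induction xs) auto
    then have "u \<noteq> v" using nadj by simp
    moreover have "s v (inv (ev xs) \<otimes> y) = s v y"
      using True adj_sym less.prems by (intro inv_ev_adjacent_invariant) auto
    ultimately show ?thesis
      using exclusive[of u v "inv (ev xs) \<otimes> y"] nadj adj_sym less.prems by auto
  next
    case False
    then obtain b q c where xs: "xs = b @ q # c" and q: "\<not> adj v (fst q)" and b: "\<forall>x\<in>set b. adj v (fst x)"
      using split_list_first_prop[of xs "\<lambda>x. \<not> adj v (fst x)"] by blast
    have V: "fst ` set b \<subseteq> V" "fst q \<in> V" "fst ` set c \<subseteq> V" using less.prems(3) xs by auto
    have "no_merge v (b @ q # c @ [(u, e1)])" using less.prems(1) xs by simp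
    then have "no_merge v (q # c @ [(u, e1)])" using b by (induction b) auto
    then have qv: "fst q \<noteq> v" using q by simp
    let ?y1 = "inv (ev b) \<otimes> y"
    \<comment> \<open>\<open>?y1\<close> and \<open>?y2\<close> are the positions before and after the syllable \<open>q\<close> is removed\<close>
    let ?y2 = "f (fst q) [^] (- snd q) \<otimes> ?y1"
    have y1: "?y1 \<in> carrier G" using V less.prems by simp
    have "s v ?y1 = s v y"
      using b adj_sym less.prems V by (intro inv_ev_adjacent_invariant) auto
    then have "\<bar>s (fst q) ?y1\<bar> \<le> R"
      using exclusive[of "fst q" v ?y1] q qv adj_sym V less.prems y1 by auto
    moreover have "reduced (((v, e0) # b) @ q # c @ [(u, e1)])" using less.prems(1) by (simp add: xs)
    then have red: "reduced (q # c @ [(u, e1)])" using reduced_appendD by blast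
    ultimately have big: "\<bar>s (fst q) ?y2\<bar> > R"
      using V y1 red by (intro big_after_power) auto
    have "\<bar>s u (inv (ev c) \<otimes> ?y2)\<bar> \<le> R"
    proof (rule less.hyps[of c "fst q" "snd q" ?y2])
      show "tight u ((fst q, snd q) # c)"
        using less.prems(2) tight_append[of u "(v, e0) # b" "q # c"] by (simp add: xs)
    qed (use xs red V big less.prems y1 f_closed in auto)
    moreover have "inv (ev xs) \<otimes> y = inv (ev c) \<otimes> ?y2"
    proof -
      have "inv (ev xs) \<otimes> y = inv (ev (q # c)) \<otimes> ?y1"
        unfolding xs using V less.prems by (intro inv_ev_append) auto
      also have "\<dots> = inv (ev c) \<otimes> ?y2"
        using V y1 f_closed[OF V(2)] by (simp add: inv_mult_group int_pow_neg m_assoc)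
      finally show ?thesis .
    qed
    ultimately show ?thesis by simp
  qed
qed

lemma inv_ev_keep:
  assumes "fst ` set xs \<subseteq> V" "u \<in> V" "y \<in> carrier G"
  shows "s u (inv (ev xs) \<otimes> y) = s u (inv (ev (keep u xs)) \<otimes> y)"
proof -
  obtain d where d: "fst ` set d \<subseteq> V" "\<forall>x\<in>set d. adj (fst x) u" "ev xs = ev (keep u xs) \<otimes> ev d"
    using ev_keep[OF assms(1)] by blast
  have k: "fst ` set (keep u xs) \<subseteq> V" using set_keep[of u xs] assms(1) by auto
  have "inv (ev xs) \<otimes> y = inv (ev d) \<otimes> (inv (ev (keep u xs)) \<otimes> y)"
    using d k assms by (simp add: inv_mult_group m_assoc)
  then show ?thesis
    using inv_ev_adjacent_invariant[of d u "inv (ev (keep u xs)) \<otimes> y"] d k assms by simp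
qed

text \<open>
  Syllables that can be commuted past \<open>u\<close> do not influence the coordinate of \<open>u\<close> and can be dropped. If
  \<open>v\<close> survives the dropping, then \<open>propagation\<close> shows that the syllable \<open>u\<close> has not been started yet.
\<close>

lemma both_unfinished_imp_adjacent:
  assumes "reduced ((v, e0) # xs @ [(u, e1)])" "fst ` set xs \<subseteq> V" "u \<in> V" "v \<in> V" "y \<in> carrier G"
    "\<bar>s v y\<bar> > R" "\<bar>s u (inv (ev xs) \<otimes> y)\<bar> > R"
  shows "adj v u"
proof (rule ccontr)
  assume "\<not> adj v u"
  then have "keep u ((v, e0) # xs) = (v, e0) # keep u xs" by simp
  then have "tight u ((v, e0) # keep u xs)" "reduced ((v, e0) # keep u xs @ [(u, e1)])"
    using tight_keep[of u "(v, e0) # xs"] reduced_keep[of "(v, e0) # xs" u e1] assms(1) by auto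
  then have "\<bar>s u (inv (ev (keep u xs)) \<otimes> y)\<bar> \<le> R"
    using propagation[of v e0 "keep u xs" u e1 y] assms set_keep[of u xs] by auto
  then show False using inv_ev_keep[OF assms(2,3,5)] assms(7) by simp
qed

text \<open>Seen from the identity, the first kept syllable is unfinished, and \<open>propagation\<close> applies to it.\<close>

lemma initially_unstarted:
  assumes "reduced (xs @ [(u, e1)])" "fst ` set xs \<subseteq> V" "u \<in> V"
  shows "\<bar>s u (inv (ev xs))\<bar> \<le> R"
proof -
  have "fst ` set (keep u xs) \<subseteq> V" using set_keep[of u xs] assms(2) by auto
  then have eq: "s u (inv (ev xs)) = s u (inv (ev (keep u xs)))"
    using inv_ev_keep[OF assms(2,3), of \<one>] assms(2) by simp
  show ?thesis
  proof (cases "keep u xs")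
    case Nil
    then show ?thesis using eq base[OF assms(3)] by simp
  next
    case (Cons x ys)
    have red: "reduced ((fst x, snd x) # ys @ [(u, e1)])" and t: "tight u ((fst x, snd x) # ys)"
      using reduced_keep[OF assms(1)] tight_keep[of u xs] by (auto simp: Cons)
    have V: "fst x \<in> V" "fst ` set ys \<subseteq> V" using set_keep[of u xs] assms(2) by (auto simp: Cons)
    have "\<bar>s (fst x) (f (fst x) [^] (- snd x) \<otimes> \<one>)\<bar> > R"
      using red base V by (intro big_after_power) auto
    then have "\<bar>s u (inv (ev ys) \<otimes> (f (fst x) [^] (- snd x) \<otimes> \<one>))\<bar> \<le> R"
      using red t V assms(3) f_closed by (intro propagation[of "fst x" "snd x" ys u e1]) auto
    moreover have "inv (ev ys) \<otimes> (f (fst x) [^] (- snd x) \<otimes> \<one>) = inv (ev (x # ys))"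
      using V f_closed by (simp add: inv_mult_group int_pow_neg)
    ultimately show ?thesis using eq Cons by simp
  qed
qed

text \<open>This is \<open>initially_unstarted\<close> for the inverse word.\<close>

lemma finally_no_overshoot:
  assumes "reduced ((v, e) # xs)" "fst ` set xs \<subseteq> V" "v \<in> V"
  shows "\<bar>s v (ev xs)\<bar> \<le> R"
proof -
  have "reduced (syl_inverse xs @ [(v, - e)])"
    using reduced_syl_inverse[OF assms(1)] by (simp add: syl_inverse_def)
  moreover have "fst ` set (syl_inverse xs) \<subseteq> V" using assms(2) by (auto simp: syl_inverse_def)
  ultimately have "\<bar>s v (inv (ev (syl_inverse xs)))\<bar> \<le> R"
    by (rule initially_unstarted[OF _ _ assms(3)])
  then show ?thesis using ev_syl_inverse[OF assms(2)] assms(2) by simp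
qed

text \<open>
  A double count of the pairs of a syllable and a time at which its coordinate is well inside its interval: a
  syllable needs a number of times proportional to its exponent, and at any time the labels of the syllables
  under way are pairwise adjacent, hence distinct.
\<close>

lemma undistorted_estimate:
  assumes red: "reduced w" and wV: "fst ` set w \<subseteq> V"
    and Sig: "\<Sigma> \<subseteq> carrier G" and K: "K \<ge> 0"
    and lip: "\<And>v z \<sigma>. v \<in> V \<Longrightarrow> z \<in> carrier G \<Longrightarrow> \<sigma> \<in> \<Sigma> \<Longrightarrow> \<bar>s v (z \<otimes> \<sigma>) - s v z\<bar> \<le> K"
    and TK: "T \<ge> 2 * R + C + K + 1"
    and ss: "set ss \<subseteq> \<Sigma>" "foldr (mult G) ss \<one> = ev w"
  shows "(\<Sum>x\<leftarrow>w. \<bar>of_int (snd x)\<bar>) \<le> 2 * K * real (card V) * (real (length ss) + 1)"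
proof -
  define n where "n = length ss"
  define z where "z k = foldr (mult G) (take k ss) \<one>" for k
  define lab where "lab i = fst (w ! i)" for i
  define ex where "ex i = snd (w ! i)" for i
  define a where "a i = ev (take i w)" for i
  \<comment> \<open>\<open>t i y\<close> is the progress of the \<open>i\<close>-th syllable at \<open>y\<close>: near \<open>0\<close> before it has been started and near
  \<open>ex i * T\<close> once it is completed\<close>
  define t where "t i y = s (lab i) (inv (a i) \<otimes> y)" for i y
  define active where "active i y \<longleftrightarrow> \<bar>t i y\<bar> > R \<and> \<bar>t i y - of_int (ex i) * T\<bar> > R + C" for i y
  have ssc: "set ss \<subseteq> carrier G" using ss Sig by auto
  have foldr_closed: "foldr (mult G) us \<one> \<in> carrier G" if "set us \<subseteq> carrier G" for us
    using that by (induction us) auto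
  have zc: "z k \<in> carrier G" for k
    unfolding z_def using set_take_subset[of k ss] ssc by (intro foldr_closed) auto
  have zSuc: "z (Suc k) = z k \<otimes> ss ! k" if "k < n" for k
  proof -
    have "set (take k ss) \<subseteq> carrier G" "set [ss ! k] \<subseteq> carrier G"
      using ssc that set_take_subset[of k ss] by (auto simp: n_def)
    moreover have "ss ! k \<in> carrier G" using ssc that by (auto simp: n_def)
    ultimately show ?thesis
      using that foldr_mult_append[OF is_group, of "take k ss" "[ss ! k]"] by (simp add: z_def n_def take_Suc_conv_app_nth del: foldr_append)
  qed
  have labV: "lab i \<in> V" if "i < length w" for i
    using that wV nth_mem[OF that] by (auto simp: lab_def)
  have takeV: "fst ` set (take i w) \<subseteq> V" "fst ` set (drop i w) \<subseteq> V" for i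
    using wV set_take_subset[of i w] set_drop_subset[of i w] by auto
  have ac: "a i \<in> carrier G" for i unfolding a_def using takeV by simp
  have split: "w = take i w @ (lab i, ex i) # drop (Suc i) w" if "i < length w" for i
    using id_take_nth_drop[OF that] by (simp add: lab_def ex_def)
  have t_start: "\<bar>t i \<one>\<bar> \<le> R" if i: "i < length w" for i
  proof -
    have "reduced ((take i w @ [(lab i, ex i)]) @ drop (Suc i) w)" using red split[OF i] by simp
    then have "reduced (take i w @ [(lab i, ex i)])" using reduced_appendD by blast
    then have "\<bar>s (lab i) (inv (ev (take i w)))\<bar> \<le> R"
      using labV[OF i] takeV by (intro initially_unstarted)
    then show ?thesis using ac by (simp add: t_def a_def)
  qed
  have t_end: "\<bar>t i (ev w) - of_int (ex i) * T\<bar> \<le> R + C" if i: "i < length w" for i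
  proof -
    let ?r = "ev (drop (Suc i) w)"
    have c: "?r \<in> carrier G" "f (lab i) \<in> carrier G" using takeV f_closed labV[OF i] by auto
    have "ev w = a i \<otimes> ev ((lab i, ex i) # drop (Suc i) w)"
      unfolding a_def
      by (subst split[OF i], rule ev_append) (use takeV labV[OF i] in auto)
    then have "ev w = a i \<otimes> (f (lab i) [^] ex i \<otimes> ?r)" by simp
    then have "inv (a i) \<otimes> ev w = f (lab i) [^] ex i \<otimes> ?r"
      using ac[of i] c m_assoc[of "inv (a i)" "a i" "f (lab i) [^] ex i \<otimes> ?r"] by simp
    moreover have "reduced ((lab i, ex i) # drop (Suc i) w)"
      using red split[OF i] reduced_appendD by metis
    then have "\<bar>s (lab i) ?r\<bar> \<le> R"
      using takeV labV[OF i] by (intro finally_no_overshoot)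
    ultimately show ?thesis
      using translate[OF labV[OF i] c(1), of "ex i"] unfolding t_def by simp
  qed
  have t_step: "\<bar>t i (z (Suc k)) - t i (z k)\<bar> \<le> K" if "i < length w" "k < n" for i k
    using lip[OF labV[OF that(1)], of "inv (a i) \<otimes> z k" "ss ! k"] ss(1) ssc ac zc that
    by (simp add: t_def zSuc m_assoc n_def subset_iff)
  have ex0: "ex i \<noteq> 0" if "i < length w" for i
    using red that unfolding reduced_iff ex_def by simp
  have many: "\<bar>of_int (ex i)\<bar> \<le> 2 * K * real (card {k. k \<le> n \<and> active i (z k)})"
    if i: "i < length w" for i
  proof -
    let ?M = "of_int (ex i) * T"
    have e1: "1 \<le> \<bar>of_int (ex i) :: real\<bar>" using ex0[OF i] by linarith
    have T0: "T - 2 * R - C \<ge> K + 1" using TK by simp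
    have l1: "\<bar>of_int (ex i)\<bar> * (T - 2 * R - C) \<le> \<bar>?M\<bar> - R - (R + C)"
    proof -
      have "1 * (2 * R + C) \<le> \<bar>of_int (ex i)\<bar> * (2 * R + C)"
        using e1 R_nonneg C_nonneg by (intro mult_right_mono) auto
      moreover have "\<bar>?M\<bar> = \<bar>of_int (ex i)\<bar> * T"
        using T0 R_nonneg C_nonneg K by (simp add: abs_mult)
      ultimately show ?thesis by (simp add: algebra_simps)
    qed
    have l2: "\<bar>of_int (ex i)\<bar> * 1 \<le> \<bar>of_int (ex i)\<bar> * (T - 2 * R - C)"
      using T0 K by (intro mult_left_mono) auto
    have l3: "1 * (T - 2 * R - C) \<le> \<bar>of_int (ex i)\<bar> * (T - 2 * R - C)"
      using e1 T0 K by (intro mult_right_mono) auto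
    have gap: "\<bar>?M\<bar> - R - (R + C) > K" 
      by (rule less_le_trans[OF _ order_trans[OF l3 l1]]) (use T0 in simp)
    have "\<bar>?M\<bar> - R - (R + C) \<le> 2 * K * real (card {k. k \<le> n \<and> \<bar>t i (z k)\<bar> > R \<and> \<bar>t i (z k) - ?M\<bar> > R + C})"
    proof (rule path_crosses_interval[where t = "\<lambda>k. t i (z k)"])
      show "\<bar>t i (z 0)\<bar> \<le> R" using t_start[OF i] by (simp add: z_def)
      show "\<bar>t i (z n) - ?M\<bar> \<le> R + C" using t_end[OF i] ss(2) by (simp add: z_def n_def)
    qed (use t_step[OF i] K gap in auto)
    from order_trans[OF order_trans[OF l2 l1] this] show ?thesis unfolding active_def by simp
  qed
  have few: "card {i. i < length w \<and> active i y} \<le> card V" if y: "y \<in> carrier G" for y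
  proof (rule card_inj_on_le)
    have adj: "adj (lab i) (lab j)" if i: "i < j" "j < length w" "active i y" "active j y" for i j
    proof -
      let ?m = "drop (Suc i) (take j w)"
      let ?y = "f (lab i) [^] (- ex i) \<otimes> (inv (a i) \<otimes> y)"
      have il: "i < length w" using i by simp
      have tj: "take j w = take i w @ (lab i, ex i) # ?m"
        using id_take_nth_drop[of i "take j w"] i by (simp add: lab_def ex_def min_def)
      have mV: "fst ` set ?m \<subseteq> V" using takeV(1)[of j] set_drop_subset[of "Suc i" "take j w"] by auto
      have wj: "w = (take i w @ (lab i, ex i) # ?m) @ (lab j, ex j) # drop (Suc j) w"
        by (subst tj[symmetric]) (rule split[OF i(2)])
      have "reduced ((take i w @ (lab i, ex i) # ?m) @ (lab j, ex j) # drop (Suc j) w)"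
        by (rule back_subst[where P = reduced, OF red wj])
      then have "reduced (take i w @ (((lab i, ex i) # ?m @ [(lab j, ex j)]) @ drop (Suc j) w))" by simp
      then have "reduced (((lab i, ex i) # ?m @ [(lab j, ex j)]) @ drop (Suc j) w)"
        using reduced_appendD by blast
      then have r: "reduced ((lab i, ex i) # ?m @ [(lab j, ex j)])" using reduced_appendD by blast
      have c: "f (lab i) \<in> carrier G" "inv (a i) \<otimes> y \<in> carrier G" using f_closed labV[OF il] ac y by auto
      have "inv (a j) \<otimes> y = inv (ev ((lab i, ex i) # ?m)) \<otimes> (inv (a i) \<otimes> y)"
        unfolding a_def by (subst tj, rule inv_ev_append) (use takeV mV labV[OF il] y in auto)
      also have "\<dots> = inv (ev ?m) \<otimes> ?y"
        using c ev_closed[OF mV] by (simp add: inv_mult_group int_pow_neg m_assoc)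
      finally have aj: "inv (a j) \<otimes> y = inv (ev ?m) \<otimes> ?y" .
      have "\<bar>s (lab i) ?y - t i y - of_int (- ex i) * T\<bar> \<le> C"
        unfolding t_def by (rule translate[OF labV[OF il] c(2)])
      moreover have "R < \<bar>x\<bar>" if "\<bar>x - t0 - M\<bar> \<le> C" "R + C < \<bar>t0 - - M\<bar>" for x t0 M :: real
        using that by linarith
      moreover have "R + C < \<bar>t i y - - (of_int (- ex i) * T)\<bar>" using i(3) unfolding active_def by simp
      ultimately have "\<bar>s (lab i) ?y\<bar> > R" by blast
      moreover have "\<bar>s (lab j) (inv (ev ?m) \<otimes> ?y)\<bar> > R" using i(4) aj unfolding active_def t_def by simp
      ultimately show ?thesis
        using c by (intro both_unfinished_imp_adjacent[OF r mV labV[OF i(2)] labV[OF il], of ?y]) auto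
    qed
    show "inj_on lab {i. i < length w \<and> active i y}"
    proof (rule inj_onI)
      fix i j assume "i \<in> {i. i < length w \<and> active i y}" "j \<in> {i. i < length w \<and> active i y}" "lab i = lab j"
      then show "i = j" using adj[of i j] adj[of j i] adj_irrefl by (metis (mono_tags) linorder_neqE_nat mem_Collect_eq)
    qed
    show "lab ` {i. i < length w \<and> active i y} \<subseteq> V" using labV by auto
  qed (rule finite_V)
  have "(\<Sum>x\<leftarrow>w. \<bar>of_int (snd x)\<bar>) = (\<Sum>i<length w. \<bar>of_int (ex i)\<bar> :: real)"
    by (simp add: sum_list_sum_nth ex_def lessThan_atLeast0)
  also have "\<dots> \<le> (\<Sum>i<length w. 2 * K * real (card {k. k \<le> n \<and> active i (z k)}))"
    by (rule sum_mono) (use many in auto)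
  also have "\<dots> = 2 * K * real (\<Sum>i<length w. card {k. k \<le> n \<and> active i (z k)})"
    by (simp add: sum_distrib_left)
  also have "(\<Sum>i<length w. card {k. k \<le> n \<and> active i (z k)}) = (\<Sum>k\<le>n. card {i. i < length w \<and> active i (z k)})"
  proof -
    have "(\<Sum>i<length w. card {k\<in>{..n}. active i (z k)}) = (\<Sum>k\<le>n. card {i\<in>{..<length w}. active i (z k)})"
      by (rule sum_multicount_gen) auto
    then show ?thesis by simp
  qed
  also have "2 * K * real \<dots> \<le> 2 * K * real ((n + 1) * card V)"
  proof -
    have "(\<Sum>k\<le>n. card {i. i < length w \<and> active i (z k)}) \<le> (\<Sum>k\<le>n. card V)"
      by (rule sum_mono) (use few zc in auto)
    then have "real (\<Sum>k\<le>n. card {i. i < length w \<and> active i (z k)}) \<le> real ((n + 1) * card V)"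
      by (simp only: of_nat_le_iff) simp
    then show ?thesis using K by (intro mult_left_mono) auto
  qed
  finally show ?thesis by (simp add: n_def algebra_simps)
qed

end

section \<open>Embedding the right-angled Artin group\<close>

definition letters :: "('v \<times> bool) list \<Rightarrow> ('v \<times> int) list" where
  "letters w = map (\<lambda>x. (fst x, if snd x then 1 else - 1)) w"

lemma fst_set_letters: "w \<in> gwords V \<Longrightarrow> fst ` set (letters w) \<subseteq> V"
  by (auto simp: letters_def gwords_def)

definition raag_relators :: "'v graph \<Rightarrow> ('v \<times> bool) list set" where
  "raag_relators \<Lambda> = {[(v, True), (w, True), (v, False), (w, False)] | v w. {v, w} \<in> edges \<Lambda>}"

lemma raag_eq: "raag \<Lambda> = presented_group (verts \<Lambda>) (raag_relators \<Lambda>)"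
  by (simp add: raag_def raag_relators_def)

text \<open>The universal property of the right-angled Artin group, on the level of words.\<close>

lemma (in commuting_family) eval_respects_relations:
  fixes \<Lambda> :: "'v graph"
  assumes "V = verts \<Lambda>" "\<And>u v. u \<in> V \<Longrightarrow> v \<in> V \<Longrightarrow> {u, v} \<in> edges \<Lambda> \<Longrightarrow> adj u v"
    and "pres_eq (verts \<Lambda>) (raag_relators \<Lambda>) v w"
  shows "ev (letters v) = ev (letters w)"
  using assms(3)
proof (induction rule: pres_eq.induct)
  case (cancel u v x b)
  have V: "fst ` set (letters u) \<subseteq> V" "fst ` set (letters v) \<subseteq> V" "x \<in> V"
    using cancel fst_set_letters assms(1) by auto
  have "ev (letters [(x, b), (x, \<not> b)]) = \<one>"
    using f_closed[OF V(3)] by (cases b) (auto simp: letters_def int_pow_neg)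
  moreover have "letters (u @ [(x, b), (x, \<not> b)] @ v) = letters u @ letters [(x, b), (x, \<not> b)] @ letters v"
    "letters (u @ v) = letters u @ letters v" by (simp_all add: letters_def)
  moreover have "fst ` set (letters [(x, b), (x, \<not> b)]) \<subseteq> V" using V by (simp add: letters_def)
  ultimately show ?case using V by (simp add: ev_append image_Un)
next
  case (relator u v r)
  have V: "fst ` set (letters u) \<subseteq> V" "fst ` set (letters v) \<subseteq> V" "fst ` set (letters r) \<subseteq> V"
    using relator fst_set_letters assms(1) by auto
  obtain x y where r: "r = [(x, True), (y, True), (x, False), (y, False)]" "{x, y} \<in> edges \<Lambda>"
    using relator(3) by (auto simp: raag_relators_def)
  have xy: "x \<in> V" "y \<in> V" using relator(4) assms(1) by (auto simp: r gwords_def)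
  have c: "f x \<in> carrier G" "f y \<in> carrier G" using xy f_closed by auto
  have comm: "f x \<otimes> f y = f y \<otimes> f x" using f_commute[OF xy] assms(2)[OF xy r(2)] by simp
  have "ev (letters r) = f x \<otimes> f y \<otimes> (inv (f x) \<otimes> inv (f y))"
    using c by (simp add: r letters_def int_pow_neg m_assoc)
  also have "\<dots> = f y \<otimes> f x \<otimes> inv (f y \<otimes> f x)" unfolding comm using c by (simp add: inv_mult_group)
  also have "\<dots> = \<one>" using c by simp
  finally have 1: "ev (letters r) = \<one>" .
  moreover have "letters (u @ r @ v) = letters u @ letters r @ letters v"
    "letters (u @ v) = letters u @ letters v" by (simp_all add: letters_def)
  ultimately show ?case using V by (simp add: ev_append image_Un)
qed auto

definition raag_gen :: "'v graph \<Rightarrow> 'v \<Rightarrow> ('v \<times> bool) list set" where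
  "raag_gen \<Lambda> v = pres_class (verts \<Lambda>) (raag_relators \<Lambda>) [(v, True)]"

lemma gwords_simps:
  "[] \<in> gwords X" "x # w \<in> gwords X \<longleftrightarrow> fst x \<in> X \<and> w \<in> gwords X"
  "v @ w \<in> gwords X \<longleftrightarrow> v \<in> gwords X \<and> w \<in> gwords X"
  by (cases x; auto simp: gwords_def)+

lemma raag_gen_inverse:
  assumes "v \<in> verts \<Lambda>"
  shows "m_inv (raag \<Lambda>) (raag_gen \<Lambda> v) = pres_class (verts \<Lambda>) (raag_relators \<Lambda>) [(v, False)]"
proof -
  let ?X = "verts \<Lambda>" let ?R = "raag_relators \<Lambda>"
  interpret A: group "raag \<Lambda>" unfolding raag_eq by (rule group_presented_group)
  have w: "[(v, b)] \<in> gwords ?X" for b using assms by (simp add: gwords_simps)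
  have c: "pres_class ?X ?R [(v, b)] \<in> carrier (raag \<Lambda>)" for b
    unfolding raag_eq presented_group_def using w by simp
  have "pres_eq ?X ?R ([] @ [(v, False), (v, \<not> False)] @ []) ([] @ [])"
    by (rule pres_eq.cancel) (use assms in \<open>auto simp: gwords_simps\<close>)
  then have "pres_class ?X ?R [(v, False), (v, True)] = pres_class ?X ?R []"
    by (subst pres_class_eq_iff) (use assms in \<open>auto simp: gwords_simps\<close>)
  then have "pres_class ?X ?R [(v, False)] \<otimes>\<^bsub>raag \<Lambda>\<^esub> raag_gen \<Lambda> v = \<one>\<^bsub>raag \<Lambda>\<^esub>"
    using presented_group_mult[OF w w, of ?R False True] by (simp add: raag_eq raag_gen_def presented_group_def)
  then show ?thesis using c by (intro A.inv_equality) (auto simp: raag_gen_def)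
qed

lemma raag_class_eq_eval:
  assumes "w \<in> gwords (verts \<Lambda>)"
  shows "pres_class (verts \<Lambda>) (raag_relators \<Lambda>) w = syl_eval (raag \<Lambda>) (raag_gen \<Lambda>) (letters w)"
  using assms
proof (induction w)
  case Nil
  then show ?case by (simp add: syl_eval_def letters_def raag_eq presented_group_def)
next
  case (Cons x w)
  let ?X = "verts \<Lambda>" let ?R = "raag_relators \<Lambda>"
  interpret A: group "raag \<Lambda>" unfolding raag_eq by (rule group_presented_group)
  obtain v b where x: "x = (v, b)" by (cases x)
  have w: "v \<in> ?X" "w \<in> gwords ?X" "[(v, b)] \<in> gwords ?X" using Cons.prems by (auto simp: x gwords_simps)
  have c: "raag_gen \<Lambda> v \<in> carrier (raag \<Lambda>)"
    unfolding raag_eq presented_group_def raag_gen_def using w(1) by (simp add: gwords_simps)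
  have "pres_class ?X ?R (x # w) = pres_class ?X ?R [(v, b)] \<otimes>\<^bsub>raag \<Lambda>\<^esub> pres_class ?X ?R w"
    using presented_group_mult[OF w(3,2), of ?R] by (simp add: x raag_eq)
  also have "pres_class ?X ?R [(v, b)] = raag_gen \<Lambda> v [^]\<^bsub>raag \<Lambda>\<^esub> (if b then 1 else - 1 :: int)"
    using raag_gen_inverse[OF w(1)] c by (cases b) (auto simp: raag_gen_def A.int_pow_neg)
  finally show ?case using Cons.IH[OF w(2)] by (simp add: syl_eval_def letters_def x)
qed

lemma raag_commuting_family:
  assumes "\<And>u v. adj u v \<Longrightarrow> adj v u" "\<And>v. \<not> adj v v"
    and adj: "\<And>u v. u \<in> verts \<Lambda> \<Longrightarrow> v \<in> verts \<Lambda> \<Longrightarrow> adj u v \<longleftrightarrow> {u, v} \<in> edges \<Lambda>"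
  shows "commuting_family (raag \<Lambda>) (verts \<Lambda>) adj (raag_gen \<Lambda>)"
proof -
  let ?X = "verts \<Lambda>" let ?R = "raag_relators \<Lambda>"
  interpret A: group "raag \<Lambda>" unfolding raag_eq by (rule group_presented_group)
  have c: "raag_gen \<Lambda> v \<in> carrier (raag \<Lambda>)" if "v \<in> ?X" for v
    unfolding raag_eq presented_group_def raag_gen_def using that by (simp add: gwords_simps)
  show ?thesis
  proof unfold_locales
    fix u v assume uv: "u \<in> ?X" "v \<in> ?X" "adj u v"
    let ?u = "raag_gen \<Lambda> u" let ?v = "raag_gen \<Lambda> v"
    let ?r = "[(u, True), (v, True), (u, False), (v, False)]"
    have "?r \<in> ?R" using adj[OF uv(1,2)] uv(3) by (auto simp: raag_relators_def)
    moreover have rw: "?r \<in> gwords ?X" using uv by (simp add: gwords_simps)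
    ultimately have "pres_eq ?X ?R ([] @ ?r @ []) ([] @ [])"
      by (intro pres_eq.relator) (auto simp: gwords_simps)
    then have "pres_class ?X ?R ?r = pres_class ?X ?R []"
      by (subst pres_class_eq_iff) (use rw in \<open>auto simp: gwords_simps\<close>)
    then have "syl_eval (raag \<Lambda>) (raag_gen \<Lambda>) (letters ?r) = \<one>\<^bsub>raag \<Lambda>\<^esub>"
      using raag_class_eq_eval[OF rw] by (simp add: raag_eq presented_group_def)
    then have "(?u \<otimes>\<^bsub>raag \<Lambda>\<^esub> ?v) \<otimes>\<^bsub>raag \<Lambda>\<^esub> inv\<^bsub>raag \<Lambda>\<^esub> (?v \<otimes>\<^bsub>raag \<Lambda>\<^esub> ?u) = \<one>\<^bsub>raag \<Lambda>\<^esub>"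
      using c[OF uv(1)] c[OF uv(2)]
      by (simp add: syl_eval_def letters_def A.int_pow_neg A.inv_mult_group A.m_assoc)
    then show "?u \<otimes>\<^bsub>raag \<Lambda>\<^esub> ?v = ?v \<otimes>\<^bsub>raag \<Lambda>\<^esub> ?u"
      using c[OF uv(1)] c[OF uv(2)] by (metis A.inv_closed A.inv_equality A.inv_inv A.m_closed)
  qed (use assms c in auto)
qed

lemma (in commuting_family) layered_form_of_word:
  assumes "fst ` set xs \<subseteq> V"
  shows "\<exists>L. layered L \<and> ev (concat L) = ev xs"
proof -
  have "\<forall>F\<in>set (map (\<lambda>x. [x]) xs). clique F" using assms by (auto simp: clique_def)
  from layered_form_exists[OF this] show ?thesis by auto
qed

lemma (in commuting_family) layered_labels: "layered L \<Longrightarrow> fst ` set (concat L) \<subseteq> V"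
  by (induction L) (auto simp: clique_def)

lemma (in commuting_family) ev_in_generate:
  "fst ` set xs \<subseteq> V \<Longrightarrow> ev xs \<in> generate G (f ` V)"
proof (induction xs)
  case Nil
  then show ?case by (simp add: generate.one)
next
  case (Cons x xs)
  have "f ` V \<subseteq> carrier G" using f_closed by auto
  then have "subgroup (generate G (f ` V)) G" by (rule generate_is_subgroup)
  then have "f (fst x) [^] snd x \<in> generate G (f ` V)"
    using Cons.prems by (intro subgroup_int_pow_closed) (auto intro: generate.incl)
  then show ?case using Cons by (auto intro: generate.eng)
qed

context coarse_ping_pong
begin

text \<open>
  An element of the right-angled Artin group and its image are values of the same layered product, which is empty
  if its value in \<open>G\<close> is trivial.
\<close>

lemma raag_embedding:
  fixes \<Lambda> :: "'v graph"
  assumes V: "V = verts \<Lambda>" and adj: "\<And>u v. u \<in> V \<Longrightarrow> v \<in> V \<Longrightarrow> adj u v \<longleftrightarrow> {u, v} \<in> edges \<Lambda>"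
  shows "G\<lparr>carrier := generate G (f ` V)\<rparr> \<cong> raag \<Lambda>"
    and "\<And>g. g \<in> generate G (f ` V) \<Longrightarrow> \<exists>w. reduced w \<and> fst ` set w \<subseteq> V \<and> ev w = g"
proof -
  let ?X = "verts \<Lambda>" let ?R = "raag_relators \<Lambda>" let ?A = "raag \<Lambda>"
  interpret A: commuting_family ?A V adj "raag_gen \<Lambda>"
    unfolding V by (rule raag_commuting_family) (use adj_sym adj_irrefl adj V in auto)
  define \<phi> where "\<phi> c = ev (letters (SOME w. w \<in> gwords ?X \<and> pres_class ?X ?R w = c))" for c
  have phi: "\<phi> (pres_class ?X ?R w) = ev (letters w)" if w: "w \<in> gwords ?X" for w
  proof -
    define u where "u = (SOME u. u \<in> gwords ?X \<and> pres_class ?X ?R u = pres_class ?X ?R w)"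
    have "u \<in> gwords ?X \<and> pres_class ?X ?R u = pres_class ?X ?R w"
      unfolding u_def by (rule someI[of _ w]) (use w in simp)
    then have "pres_eq ?X ?R u w" using pres_class_eq_iff w by metis
    then have "ev (letters u) = ev (letters w)"
      by (rule eval_respects_relations[OF V, rotated]) (use adj in auto)
    then show ?thesis by (simp add: \<phi>_def u_def)
  qed
  have carrA: "carrier ?A = pres_class ?X ?R ` gwords ?X"
    by (simp add: raag_eq presented_group_def)
  have ev_letters: "ev (letters w) \<in> carrier G" if "w \<in> gwords ?X" for w
    using fst_set_letters[OF that] V by simp
  have hom: "\<phi> \<in> hom ?A G"
  proof (rule homI)
    fix a b assume "a \<in> carrier ?A" "b \<in> carrier ?A"
    then obtain v w where v: "v \<in> gwords ?X" "a = pres_class ?X ?R v"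
      and w: "w \<in> gwords ?X" "b = pres_class ?X ?R w" unfolding carrA by blast
    have "\<phi> (a \<otimes>\<^bsub>?A\<^esub> b) = ev (letters v @ letters w)"
      using phi[of "v @ w"] v w by (simp add: raag_eq presented_group_mult gwords_simps letters_def)
    also have "\<dots> = \<phi> a \<otimes> \<phi> b"
      using v w phi by (simp add: ev_append fst_set_letters V)
    finally show "\<phi> (a \<otimes>\<^bsub>?A\<^esub> b) = \<phi> a \<otimes> \<phi> b" .
  qed (use phi carrA ev_letters in auto)
  interpret \<phi>: group_hom ?A G \<phi> by unfold_locales (rule hom)
  have phi_gen: "\<phi> (raag_gen \<Lambda> v) = f v" if "v \<in> V" for v
    using phi[of "[(v, True)]"] that V f_closed by (simp add: raag_gen_def gwords_simps letters_def)
  have phi_ev: "\<phi> (A.ev xs) = ev xs" if "fst ` set xs \<subseteq> V" for xs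
    using that
  proof (induction xs)
    case (Cons x xs)
    have x: "fst x \<in> V" and c: "raag_gen \<Lambda> (fst x) \<in> carrier ?A" "A.ev xs \<in> carrier ?A"
      using Cons.prems A.f_closed by auto
    have "\<phi> (raag_gen \<Lambda> (fst x) [^]\<^bsub>?A\<^esub> snd x) = f (fst x) [^] snd x"
      using \<phi>.hom_int_pow[OF c(1), of "snd x"] phi_gen[OF x] by simp
    then show ?case using Cons c by simp
  qed simp
  have layered_rep: "\<exists>L. layered L \<and> A.ev (concat L) = a" if a: "a \<in> carrier ?A" for a
  proof -
    obtain w where w: "w \<in> gwords ?X" "a = A.ev (letters w)"
      using a raag_class_eq_eval unfolding carrA by blast
    then show ?thesis using A.layered_form_of_word[of "letters w"] fst_set_letters[OF w(1)] V by simp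
  qed
  have ker: "a = \<one>\<^bsub>?A\<^esub>" if a: "a \<in> carrier ?A" "\<phi> a = \<one>" for a
  proof -
    obtain L where L: "layered L" "A.ev (concat L) = a" using layered_rep a by blast
    then have "ev (concat L) = \<one>" using phi_ev[OF layered_labels[OF L(1)]] a by simp
    then have "L = []" using layered_eval_trivial L(1) by blast
    then show ?thesis using L(2) by simp
  qed
  have img: "\<phi> ` carrier ?A = generate G (f ` V)"
  proof
    show "\<phi> ` carrier ?A \<subseteq> generate G (f ` V)"
      unfolding carrA using phi ev_in_generate[OF fst_set_letters[folded V]] V by auto
    show "generate G (f ` V) \<subseteq> \<phi> ` carrier ?A"
    proof (rule generate_subgroup_incl[OF _ \<phi>.img_is_subgroup])
      show "f ` V \<subseteq> \<phi> ` carrier ?A"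
        using phi_gen A.f_closed by (metis image_eqI image_subsetI)
    qed
  qed
  have "inj_on \<phi> (carrier ?A)" using ker by (simp add: \<phi>.inj_on_one_iff)
  then have "\<phi> \<in> iso ?A (G\<lparr>carrier := generate G (f ` V)\<rparr>)"
    using img hom unfolding iso_def bij_betw_def hom_def by auto
  then show "G\<lparr>carrier := generate G (f ` V)\<rparr> \<cong> ?A"
    using A.iso_set_sym is_isoI by blast
  fix g assume "g \<in> generate G (f ` V)"
  then have "g \<in> \<phi> ` carrier ?A" by (simp only: img)
  then obtain a where a: "a \<in> carrier ?A" "\<phi> a = g" by auto
  obtain L where L: "layered L" "A.ev (concat L) = a" using layered_rep a by blast
  have "ev (concat L) = g" using phi_ev[OF layered_labels[OF L(1)]] L(2) a(2) by simp
  then show "\<exists>w. reduced w \<and> fst ` set w \<subseteq> V \<and> ev w = g"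
    using layered_reduced[OF L(1)] layered_labels[OF L(1)] by blast
qed

end

lemma word_length_one: "word_length G S \<one>\<^bsub>G\<^esub> = 0"
  using word_length_le[of "[]" S G "\<one>\<^bsub>G\<^esub>"] by simp

lemma word_length_mult_le:
  assumes "group G" "generating_set G S" "g \<in> carrier G" "h \<in> carrier G"
  shows "word_length G S (g \<otimes>\<^bsub>G\<^esub> h) \<le> word_length G S g + word_length G S h"
proof -
  interpret group G by fact
  have S: "S \<union> m_inv G ` S \<subseteq> carrier G" using assms(2) by (auto simp: generating_set_def)
  obtain us where us: "length us = word_length G S g" "set us \<subseteq> S \<union> m_inv G ` S"
    "foldr (mult G) us \<one>\<^bsub>G\<^esub> = g" by (rule word_length_witness[OF assms(1-3)])
  obtain vs where vs: "length vs = word_length G S h" "set vs \<subseteq> S \<union> m_inv G ` S"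
    "foldr (mult G) vs \<one>\<^bsub>G\<^esub> = h" by (rule word_length_witness[OF assms(1,2,4)])
  have "foldr (mult G) (us @ vs) \<one>\<^bsub>G\<^esub> = g \<otimes>\<^bsub>G\<^esub> h"
    using foldr_mult_append[OF assms(1), of us vs] us vs S by auto
  then show ?thesis using word_length_le[of "us @ vs" S G "g \<otimes>\<^bsub>G\<^esub> h"] us vs by simp
qed

lemma word_length_inv:
  assumes "group G" "generating_set G S" "g \<in> carrier G"
  shows "word_length G S (inv\<^bsub>G\<^esub> g) = word_length G S g"
  using word_length_inv_le[OF assms] word_length_inv_le[OF assms(1,2), of "inv\<^bsub>G\<^esub> g"]
    group.inv_inv[OF assms(1,3)] group.inv_closed[OF assms(1,3)] by simp

lemma (in commuting_family) word_length_ev_le: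
  assumes H: "subgroup H G" and T: "f ` V \<subseteq> H" and gen: "generating_set (G\<lparr>carrier := H\<rparr>) (f ` V)"
    and xs: "fst ` set xs \<subseteq> V"
  shows "real (word_length (G\<lparr>carrier := H\<rparr>) (f ` V) (ev xs)) \<le> (\<Sum>x\<leftarrow>xs. \<bar>of_int (snd x)\<bar>)"
proof -
  let ?H = "G\<lparr>carrier := H\<rparr>" let ?len = "word_length ?H (f ` V)"
  have gH: "group ?H" using subgroup_imp_group[OF H] .
  have gen1: "?len (f v) \<le> 1" if "v \<in> V" for v
    using word_length_le[of "[f v]" "f ` V" ?H "f v"] that f_closed by simp
  have pow_H: "f v [^] n \<in> H" if "v \<in> V" for v and n :: nat
    using subgroup_int_pow_closed[OF H, of "f v" "int n"] that T by (auto simp: int_pow_int)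
  have nat: "?len (f v [^] n) \<le> n" if v: "v \<in> V" for v and n :: nat
  proof (induction n)
    case 0
    then show ?case using word_length_one[of ?H] by simp
  next
    case (Suc n)
    have "f v [^] n \<in> H" using pow_H v by blast
    then have "?len (f v [^] n \<otimes> f v) \<le>
        ?len (f v [^] n) + ?len (f v)"
      using word_length_mult_le[OF gH gen, of "f v [^] n" "f v"] v T by auto
    then show ?case using Suc gen1[OF v] by simp
  qed
  have int: "?len (f v [^] e) \<le> nat \<bar>e\<bar>" if v: "v \<in> V" for v and e :: int
  proof (cases e rule: int_cases2)
    case (nonneg n)
    then show ?thesis using nat[OF v, of n] by (simp add: int_pow_int)
  next
    case (nonpos n)
    have m: "f v [^] n \<in> H" using pow_H v by blast
    have "f v [^] e = inv\<^bsub>?H\<^esub> (f v [^] n)"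
      using m_inv_consistent[OF H m] f_closed[OF v] by (simp add: nonpos int_pow_neg_int)
    then have "?len (f v [^] e) = ?len (f v [^] n)"
      using word_length_inv[OF gH gen, of "f v [^] n"] m by simp
    then show ?thesis using nat[OF v, of n] nonpos by simp
  qed
  show ?thesis
    using xs
  proof (induction xs)
    case Nil
    then show ?case using word_length_one[of ?H] by simp
  next
    case (Cons x xs)
    have x: "fst x \<in> V" using Cons.prems by simp
    have 1: "f (fst x) [^] snd x \<in> H" using subgroup_int_pow_closed[OF H] x T by auto
    have "generate G (f ` V) \<subseteq> H" using generate_subgroup_incl[OF T H] .
    then have 2: "ev xs \<in> H" using ev_in_generate[of xs] Cons.prems by auto
    have "?len (ev (x # xs)) \<le>
        ?len (f (fst x) [^] snd x) + ?len (ev xs)"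
      using word_length_mult_le[OF gH gen, of "f (fst x) [^] snd x" "ev xs"] 1 2 by simp
    also have "\<dots> \<le> nat \<bar>snd x\<bar> + ?len (ev xs)" using int[OF x] by simp
    finally have "real (?len (ev (x # xs))) \<le> real (nat \<bar>snd x\<bar> + ?len (ev xs))"
      by (rule of_nat_mono)
    also have "\<dots> = \<bar>of_int (snd x)\<bar> + real (?len (ev xs))" by simp
    finally show ?case using Cons by simp
  qed
qed

lemma (in rigid_ping_pong) raag_undistorted:
  fixes \<Lambda> :: "'v graph"
  assumes V: "V = verts \<Lambda>" and adj: "\<And>u v. u \<in> V \<Longrightarrow> v \<in> V \<Longrightarrow> adj u v \<longleftrightarrow> {u, v} \<in> edges \<Lambda>"
    and gens: "generating_set G S" and K: "K \<ge> 0"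
    and lip: "\<And>v z \<sigma>. v \<in> V \<Longrightarrow> z \<in> carrier G \<Longrightarrow> \<sigma> \<in> S \<union> m_inv G ` S \<Longrightarrow> \<bar>s v (z \<otimes> \<sigma>) - s v z\<bar> \<le> K"
    and TK: "T \<ge> 2 * R + C + K + 1"
  shows "undistorted_subgroup G S (generate G (f ` V))"
proof -
  let ?H = "generate G (f ` V)" let ?GH = "G\<lparr>carrier := ?H\<rparr>"
  let ?len = "word_length ?GH (f ` V)" let ?mH = "word_metric ?GH (f ` V)"
  have fV: "f ` V \<subseteq> carrier G" using f_closed by auto
  have H: "subgroup ?H G" by (rule generate_is_subgroup[OF fV])
  have fH: "f ` V \<subseteq> ?H" by (auto intro: generate.incl)
  have gH: "group ?GH" using subgroup_imp_group[OF H] .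
  have genH: "generating_set ?GH (f ` V)"
    unfolding generating_set_def using fH generate_consistent[OF fH H] by simp
  have Hc: "?H \<subseteq> carrier G" using H subgroup.subset by blast
  have Sc: "S \<union> m_inv G ` S \<subseteq> carrier G" using gens by (auto simp: generating_set_def)
  define M where "M = Max (insert 0 ((\<lambda>v. word_length G S (f v)) ` V))"
  have M: "word_length G S (f v) \<le> M" if "v \<in> V" for v
    unfolding M_def using that finite_V by (intro Max_ge) auto
  have upper: "word_length G S g \<le> M * ?len g" if g: "g \<in> ?H" for g
  proof -
    have gc: "g \<in> carrier ?GH" using g by simp
    obtain ws where ws: "length ws = ?len g"
      "set ws \<subseteq> f ` V \<union> m_inv ?GH ` f ` V" "foldr (mult ?GH) ws \<one>\<^bsub>?GH\<^esub> = g"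
      by (rule word_length_witness[OF gH genH gc])
    have "m_inv ?GH ` f ` V = m_inv G ` f ` V"
      using m_inv_consistent[OF H] fH by (intro image_cong) auto
    then have ws2: "set ws \<subseteq> f ` V \<union> m_inv G ` f ` V" using ws(2) by simp
    have "foldr (mult G) ws \<one> \<in> carrier G \<and> word_length G S (foldr (mult G) ws \<one>) \<le> M * length ws"
      using ws2
    proof (induction ws)
      case Nil
      then show ?case by (simp add: word_length_one)
    next
      case (Cons a ws)
      have a: "a \<in> carrier G" "word_length G S a \<le> M"
        using Cons.prems M f_closed word_length_inv[OF is_group gens] by auto
      then have "word_length G S (a \<otimes> foldr (mult G) ws \<one>) \<le> word_length G S a + word_length G S (foldr (mult G) ws \<one>)"
        using Cons by (intro word_length_mult_le[OF is_group gens]) auto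
      then show ?case using Cons a by simp
    qed
    then show ?thesis using ws by (simp add: mult.commute)
  qed
  let ?c = "2 * K * real (card V)"
  have lower: "real (?len g) \<le> ?c * (real (word_length G S g) + 1)" if g: "g \<in> ?H" for g
  proof -
    obtain w where w: "reduced w" "fst ` set w \<subseteq> V" "ev w = g"
      using raag_embedding(2)[OF V _ g] adj by blast
    have gc: "g \<in> carrier G" using g Hc by blast
    obtain ss where ss: "length ss = word_length G S g" "set ss \<subseteq> S \<union> m_inv G ` S"
      "foldr (mult G) ss \<one> = g"
      by (rule word_length_witness[OF is_group gens gc])
    have "real (?len (ev w)) \<le> (\<Sum>x\<leftarrow>w. \<bar>of_int (snd x)\<bar>)"
      by (rule word_length_ev_le[OF H fH genH w(2)])
    also have "\<dots> \<le> ?c * (real (length ss) + 1)"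
      using w(3) ss(3) by (intro undistorted_estimate[OF w(1,2) Sc K lip TK ss(2)]) simp_all
    finally show ?thesis using w(3) ss(1) by simp
  qed
  let ?k = "max 1 (max ?c (real M))"
  have "qi_embedding (word_metric ?GH (f ` V)) (word_metric G S) (\<lambda>x. x)"
    unfolding qi_embedding_def qi_embedding_const_def
  proof (intro exI[of _ ?k] conjI ballI)
    show "(\<lambda>x. x) \<in> mspace ?mH \<rightarrow> mspace (word_metric G S)"
      using Hc by (auto simp: mspace_word_metric[OF gH genH] mspace_word_metric[OF is_group gens])
    fix x y assume "x \<in> mspace ?mH" "y \<in> mspace ?mH"
    then have xy: "x \<in> ?H" "y \<in> ?H" by (auto simp: mspace_word_metric[OF gH genH])
    let ?g = "inv x \<otimes> y"
    have g: "?g \<in> ?H" using H xy by (simp add: subgroup.m_closed subgroup.m_inv_closed)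
    have dG: "mdist (word_metric G S) x y = real (word_length G S ?g)"
      using mdist_word_metric[OF is_group gens] xy Hc by auto
    have dH: "mdist ?mH x y = real (?len ?g)"
      using mdist_word_metric[OF gH genH, of x y] xy m_inv_consistent[OF H xy(1)] by simp
    have "real (?len ?g) \<le> ?k * (real (word_length G S ?g) + 1)"
      using order_trans[OF lower[OF g] mult_right_mono[of ?c ?k]] by simp
    then have "real (?len ?g) / ?k \<le> real (word_length G S ?g) + 1"
      by (simp add: pos_divide_le_eq mult.commute)
    then show "mdist ?mH x y / ?k - ?k \<le> mdist (word_metric G S) x y"
      unfolding dG dH by linarith
    have "real (word_length G S ?g) \<le> real M * real (?len ?g)"
      using upper[OF g] by (metis of_nat_le_iff of_nat_mult)
    also have "\<dots> \<le> ?k * real (?len ?g)"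
      by (intro mult_right_mono) auto
    finally show "mdist (word_metric G S) x y \<le> ?k * mdist ?mH x y + ?k"
      unfolding dG dH by linarith
  qed auto
  then show ?thesis
    unfolding undistorted_subgroup_def using H genH finite_V by blast
qed

section \<open>Equivariance and projections in hierarchically hyperbolic groups\<close>

locale hhg_with_constant = hhg G S H + hhs_const "word_metric G S" H E
  for G :: "('g, 'b) monoid_scheme" (structure) and S :: "'g set"
    and H :: "('g, 'u, 'c, 'm) hhg_data_scheme" and E :: real
begin

abbreviation dG :: "'g \<Rightarrow> 'g \<Rightarrow> real" where "dG \<equiv> mdist (word_metric G S)"
abbreviation pts :: "'u \<Rightarrow> 'c set" where "pts U \<equiv> mspace (cspace H U)"
abbreviation dC :: "'u \<Rightarrow> 'c \<Rightarrow> 'c \<Rightarrow> real" where "dC U \<equiv> mdist (cspace H U)"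
abbreviation gp :: "'u \<Rightarrow> 'c \<Rightarrow> 'c \<Rightarrow> 'c \<Rightarrow> real" where "gp U \<equiv> gromov_product (cspace H U)"

lemma mspace_G [simp]: "mspace (word_metric G S) = carrier G"
  by (rule mspace_word_metric[OF is_group gens])

lemma dG_left_invariant:
  assumes "g \<in> carrier G" "x \<in> carrier G" "y \<in> carrier G"
  shows "dG (g \<otimes> x) (g \<otimes> y) = dG x y"
proof -
  have "inv (g \<otimes> x) \<otimes> (g \<otimes> y) = inv x \<otimes> (inv g \<otimes> g) \<otimes> y"
    using assms by (simp only: inv_mult_group m_assoc inv_closed m_closed)
  then show ?thesis using assms by (simp add: mdist_word_metric[OF is_group gens])
qed

lemma dG_le_one:
  assumes "z \<in> carrier G" "\<sigma> \<in> S \<union> m_inv G ` S"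
  shows "dG z (z \<otimes> \<sigma>) \<le> 1"
proof -
  have c: "\<sigma> \<in> carrier G" using assms gens by (auto simp: generating_set_def)
  have "inv z \<otimes> (z \<otimes> \<sigma>) = \<sigma>" using assms(1) c by (simp flip: m_assoc)
  moreover have "word_length G S \<sigma> \<le> 1"
    using word_length_le[of "[\<sigma>]" S G \<sigma>] assms(2) c by simp
  ultimately show ?thesis using assms(1) c by (simp add: mdist_word_metric[OF is_group gens])
qed

lemma unbounded_in_dom: "U \<in> unbounded_domains H \<Longrightarrow> U \<in> dom_set H"
  by (simp add: unbounded_domains_def)

lemma act_dom_closed: "g \<in> carrier G \<Longrightarrow> U \<in> dom_set H \<Longrightarrow> act_dom H g U \<in> dom_set H"
  using group_action.element_image[OF dom_action] by blast

lemma act_dom_mult: "g \<in> carrier G \<Longrightarrow> h \<in> carrier G \<Longrightarrow> U \<in> dom_set H \<Longrightarrow>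
    act_dom H (g \<otimes> h) U = act_dom H g (act_dom H h U)"
  using group_action.composition_rule[OF dom_action] by blast

lemma act_dom_one: "U \<in> dom_set H \<Longrightarrow> act_dom H \<one> U = U"
  using group_action.id_eq_one[OF dom_action] by (metis restrict_apply')

lemma act_dom_inv:
  assumes "g \<in> carrier G" "U \<in> dom_set H"
  shows "act_dom H (inv g) (act_dom H g U) = U" "act_dom H g (act_dom H (inv g) U) = U"
  using act_dom_mult[of "inv g" g U] act_dom_mult[of g "inv g" U] act_dom_one[of U] assms by simp_all

lemma act_dom_inv_fixed:
  assumes "g \<in> carrier G" "U \<in> dom_set H" "act_dom H g U = U"
  shows "act_dom H (inv g) U = U"
  using act_dom_inv(1)[OF assms(1,2)] assms(3) by simp

lemma act_dom_relations:
  assumes "g \<in> carrier G" "U \<in> dom_set H" "V \<in> dom_set H"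
  shows "nest H (act_dom H g U) (act_dom H g V) \<longleftrightarrow> nest H U V"
    "orth H (act_dom H g U) (act_dom H g V) \<longleftrightarrow> orth H U V"
    "transverse H (act_dom H g U) (act_dom H g V) \<longleftrightarrow> transverse H U V"
  using automorphism[OF assms(1)] assms(2,3) unfolding hhs_automorphism_def by blast+

lemma act_space_isometry:
  assumes "g \<in> carrier G" "U \<in> dom_set H"
  shows "isometry_onto (cspace H U) (cspace H (act_dom H g U)) (act_space H g U)"
  using automorphism[OF assms(1)] assms(2) unfolding hhs_automorphism_def by blast

lemma act_space_closed:
  assumes "g \<in> carrier G" "U \<in> dom_set H" "p \<in> pts U"
  shows "act_space H g U p \<in> pts (act_dom H g U)"
  using act_space_isometry[OF assms(1,2)] assms(3) unfolding isometry_onto_def by blast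

lemma act_space_dist:
  assumes "g \<in> carrier G" "U \<in> dom_set H" "p \<in> pts U" "q \<in> pts U"
  shows "dC (act_dom H g U) (act_space H g U p) (act_space H g U q) = dC U p q"
  using act_space_isometry[OF assms(1,2)] assms(3,4) unfolding isometry_onto_def by blast

lemma act_space_one:
  assumes "U \<in> dom_set H" "p \<in> pts U"
  shows "act_space H \<one> U p = p"
proof -
  have "p \<in> act_space H \<one> U ` pts U"
    using act_space_isometry[OF one_closed assms(1)] assms act_dom_one unfolding isometry_onto_def by simp
  then obtain q where q: "q \<in> pts U" "p = act_space H \<one> U q" by blast
  show ?thesis
    using space_action[OF one_closed one_closed assms(1) q(1)] q(2) act_dom_one[OF assms(1)] by simp
qed

lemma act_dom_int_pow:
  assumes "g \<in> carrier G" "U \<in> dom_set H" "act_dom H g U = U"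
  shows "act_dom H (g [^] (n::int)) U = U"
proof -
  have nat: "act_dom H (g [^] (n::nat)) U = U" for n
    by (induction n) (use assms act_dom_one act_dom_mult in auto)
  show ?thesis
    by (cases n rule: int_cases2)
      (use nat assms act_dom_inv_fixed in \<open>simp_all add: int_pow_int int_pow_neg_int\<close>)
qed

lemma act_space_int_pow_trivial:
  assumes "g \<in> carrier G" "U \<in> dom_set H" "act_dom H g U = U"
    and "\<And>p. p \<in> pts U \<Longrightarrow> act_space H g U p = p" and "p \<in> pts U"
  shows "act_space H (g [^] (n::int)) U p = p"
proof -
  have nat: "act_space H (g [^] (n::nat)) U p = p" for n
  proof (induction n)
    case (Suc n)
    have "act_space H (g [^] n \<otimes> g) U p = act_space H (g [^] n) (act_dom H g U) (act_space H g U p)"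
      by (rule space_action) (use assms in auto)
    then show ?case using Suc assms by simp
  qed (use act_space_one assms in simp)
  show ?thesis
  proof (cases n rule: int_cases2)
    case (nonneg m)
    then show ?thesis using nat by (simp add: int_pow_int)
  next
    case (nonpos m)
    let ?h = "g [^] m"
    have hU: "act_dom H ?h U = U" using act_dom_int_pow[OF assms(1-3), of "int m"] by (simp add: int_pow_int)
    have "act_space H (inv ?h \<otimes> ?h) U p = act_space H (inv ?h) (act_dom H ?h U) (act_space H ?h U p)"
      by (rule space_action) (use assms in auto)
    then have "p = act_space H (inv ?h) U p" using hU nat act_space_one assms by simp
    then show ?thesis using assms(1) by (simp add: nonpos int_pow_neg_int)
  qed
qed

subsection \<open>Distances between points\<close>

lemma proj_mem: "U \<in> dom_set H \<Longrightarrow> z \<in> carrier G \<Longrightarrow> x \<in> cproj H U z \<Longrightarrow> x \<in> pts U"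
  using proj_subset[of U z] by auto

lemma proj_nonempty: "U \<in> dom_set H \<Longrightarrow> z \<in> carrier G \<Longrightarrow> cproj H U z \<noteq> {}"
  using proj_subset[of U z] by auto

lemma proj_close:
  "U \<in> dom_set H \<Longrightarrow> z \<in> carrier G \<Longrightarrow> x \<in> cproj H U z \<Longrightarrow> y \<in> cproj H U z \<Longrightarrow> dC U x y \<le> E"
  using mdiam_le_imp[OF proj_diam[of U z]] E_pos by simp

lemma proj_lipschitz_points:
  assumes U: "U \<in> dom_set H" and z: "z \<in> carrier G" "z' \<in> carrier G"
    and x: "x \<in> cproj H U z" "x' \<in> cproj H U z'"
  shows "dC U x x' \<le> E * dG z z' + 3 * E + 1"
proof -
  have "E * dG z z' + E \<ge> 0" using E_pos by simp
  then obtain a b where ab: "a \<in> cproj H U z" "b \<in> cproj H U z'" "dC U a b < E * dG z z' + E + 1"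
    using set_dist_le_imp[OF proj_lipschitz[of U z z'] proj_nonempty[OF U z(1)] proj_nonempty[OF U z(2)],
      of "E * dG z z' + E + 1"] U z by auto
  have "dC U x x' \<le> dC U x a + dC U a x'" "dC U a x' \<le> dC U a b + dC U b x'"
    by (rule mdist_triangle; use proj_mem U z x ab in blast)+
  then show ?thesis using ab proj_close[OF U z(1) x(1) ab(1)] proj_close[OF U z(2) ab(2) x(2)] by simp
qed

lemma rho_points_close:
  assumes U: "U \<in> dom_set H" and z: "z \<in> carrier G"
    and A: "A \<noteq> {}" "A \<subseteq> pts U" "cdiam H U A \<le> ennreal E"
    and d: "cdist H U (cproj H U z) A \<le> ennreal E" and x: "x \<in> cproj H U z" "r \<in> A"
  shows "dC U x r \<le> 3 * E + 1"
proof -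
  obtain a b where ab: "a \<in> cproj H U z" "b \<in> A" "dC U a b < E + 1"
    using set_dist_le_imp[OF d proj_nonempty[OF U z] A(1), of "E + 1"] E_pos by auto
  have "dC U b r \<le> E" using mdiam_le_imp[OF A(3) ab(2) x(2)] E_pos by simp
  moreover have "dC U x r \<le> dC U x a + dC U a r" "dC U a r \<le> dC U a b + dC U b r"
    by (rule mdist_triangle; use proj_mem U z x ab A in blast)+
  ultimately show ?thesis using ab proj_close[OF U z x(1) ab(1)] by simp
qed

text \<open>The distance to an empty set is infinite, which partial realization rules out.\<close>

lemma rho_set_nonempty:
  assumes "U \<in> dom_set H" "V \<in> dom_set H" "pnest H V U"
  shows "rho_set H V U \<noteq> {}"
proof
  assume e: "rho_set H V U = {}"
  have "cproj H V \<one> \<noteq> {}" by (rule proj_nonempty[OF assms(2) one_closed])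
  then obtain p where p: "p \<in> pts V" using proj_subset[OF assms(2), of \<one>] by auto
  have "\<exists>x\<in>mspace (word_metric G S). \<forall>U\<in>{V}. cdist H U (cproj H U x) {p} \<le> ennreal E \<and>
        (\<forall>W\<in>dom_set H. pnest H U W \<or> transverse H U W \<longrightarrow>
           cdist H W (cproj H W x) (rho_set H U W) \<le> ennreal E)"
    by (rule partial_realization[of "{V}" "\<lambda>_. p"]) (use assms p in auto)
  then obtain x where "cdist H U (cproj H U x) (rho_set H V U) \<le> ennreal E"
    using assms by auto
  then show False using e set_dist_empty[of "cproj H U x" "{}"] by (simp add: top_unique)
qed

lemma transverse_consistency_points:
  assumes U: "U \<in> dom_set H" and V: "V \<in> dom_set H" and t: "transverse H U V" and z: "z \<in> carrier G"
  shows "(\<forall>x\<in>cproj H U z. \<forall>r\<in>rho_set H V U. dC U x r \<le> 3 * E + 1) \<or>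
         (\<forall>x\<in>cproj H V z. \<forall>r\<in>rho_set H U V. dC V x r \<le> 3 * E + 1)"
proof -
  have t': "transverse H V U" using t orth_sym U V unfolding transverse_def by (metis symp_onD)
  have "cdist H V (cproj H V z) (rho_set H U V) \<le> ennreal E \<or>
      cdist H U (cproj H U z) (rho_set H V U) \<le> ennreal E"
    using transverse_consistency[OF U V t, of z] z by (simp add: min_le_iff_disj)
  then show ?thesis
    using rho_points_close[OF V z, of "rho_set H U V"] rho_points_close[OF U z, of "rho_set H V U"]
      rho_transverse[OF U V t] rho_transverse[OF V U t'] by blast
qed

text \<open>
  By consistency and the bounded geodesic image property: the geodesic from \<open>x\<close> to \<open>x'\<close> passes \<open>\<rho>\<^sup>V\<^sub>U\<close> at
  a distance of at least the Gromov product, so it and its end points have coarsely the same image in \<open>V\<close>.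
\<close>

lemma nested_projection_close:
  assumes U: "U \<in> dom_set H" and V: "V \<in> dom_set H" and n: "pnest H V U"
    and z: "z \<in> carrier G" "z' \<in> carrier G"
    and x: "x \<in> cproj H U z" "x' \<in> cproj H U z'" and y: "y \<in> cproj H V z" "y' \<in> cproj H V z'"
    and r: "r \<in> rho_set H V U" and far: "gp U x x' r > 3 * E + 1"
  shows "dC V y y' \<le> 3 * E"
proof -
  note R = rho_set_diam[OF V U n]
  have rm: "r \<in> pts U" using R r by auto
  have xm: "x \<in> pts U" "x' \<in> pts U" using proj_mem U z x by blast+
  have ym: "y \<in> pts V" "y' \<in> pts V" using proj_mem V z y by blast+
  have ne: "rho_set H V U \<noteq> {}" using r by auto
  have far_pt: "dC U x r > 3 * E + 1" "dC U x' r > 3 * E + 1"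
    using far gromov_product_le_dist[OF xm rm] by auto
  have cons: "dC V y q \<le> E" if z: "z \<in> carrier G" and x: "x \<in> cproj H U z" "dC U x r > 3 * E + 1"
    and y: "y \<in> cproj H V z" and q: "q \<in> rho_map H U V x" for z x y q
  proof -
    have "\<not> cdist H U (cproj H U z) (rho_set H V U) \<le> ennreal E"
      using rho_points_close[OF U z ne _ _ _ x(1) r] R x(2) by auto
    then have "cdiam H V (cproj H V z \<union> (\<Union>p\<in>cproj H U z. rho_map H U V p)) \<le> ennreal E"
      using nest_consistency[OF V U n, of z] z by (auto simp: min_le_iff_disj)
    then show ?thesis by (rule mdiam_le_imp) (use x y q E_pos in auto)
  qed
  obtain \<gamma> where \<gamma>: "geodesic_segment (cspace H U) x x' \<gamma>"
    using geodesic[OF U] xm unfolding geodesic_space_def by blast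
  note \<gamma>pts = geodesic_segment_points[OF \<gamma> xm]
  have "\<not> (\<gamma> \<inter> nbhd (cspace H U) E (rho_set H V U) \<noteq> {})"
  proof
    assume "\<gamma> \<inter> nbhd (cspace H U) E (rho_set H V U) \<noteq> {}"
    then obtain c where c: "c \<in> \<gamma>" "set_dist (cspace H U) {c} (rho_set H V U) \<le> ennreal E"
      unfolding nbhd_def by auto
    then obtain b where b: "b \<in> rho_set H V U" "dC U c b < E + 1"
      using set_dist_le_imp[OF c(2), of "E + 1"] ne E_pos by auto
    have cm: "c \<in> pts U" and bm: "b \<in> pts U" using c \<gamma>pts b R by auto
    have "dC U b r \<le> E" using mdiam_le_imp[of "cspace H U" "rho_set H V U" E b r] R b r E_pos by simp
    moreover have "dC U r c \<le> dC U r b + dC U b c" by (rule mdist_triangle[OF rm bm cm])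
    moreover have "gp U x x' r \<le> dC U r c" by (rule gromov_product_le_geodesic[OF \<gamma> xm rm c(1)])
    ultimately show False
      using far b(2) E_pos by (simp add: mdist_commute[of "cspace H U" r b] mdist_commute[of "cspace H U" b c])
  qed
  then have bgi: "cdiam H V (\<Union>p\<in>\<gamma>. rho_map H U V p) \<le> ennreal E"
    using bounded_geodesic_image[OF V U n \<gamma>] by blast
  obtain q q' where q: "q \<in> rho_map H U V x" "q' \<in> rho_map H U V x'"
    using rho_map_subset[OF V U n] xm by blast
  have qm: "q \<in> pts V" "q' \<in> pts V"
    using rho_map_subset[OF V U n] xm q by blast+
  have "dC V q q' \<le> E" by (rule mdiam_le_imp[OF bgi]) (use q \<gamma>pts E_pos in auto)
  moreover have "dC V y q \<le> E" "dC V y' q' \<le> E"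
    using cons z x far_pt y q by blast+
  moreover have "dC V y y' \<le> dC V y q + dC V q y'" "dC V q y' \<le> dC V q q' + dC V q' y'"
    by (rule mdist_triangle; use ym qm in blast)+
  ultimately show ?thesis by (simp add: mdist_commute[of "cspace H V" q' y'])
qed

end

section \<open>Commuting powers of rigidly supported elements\<close>

lemma uniform_bound:
  assumes "finite A" "\<And>a. a \<in> A \<Longrightarrow> \<exists>c::real. P a c" "\<And>a c c'. a \<in> A \<Longrightarrow> P a c \<Longrightarrow> c \<le> c' \<Longrightarrow> P a c'"
  shows "\<exists>c\<ge>0. \<forall>a\<in>A. P a c"
proof -
  from assms(2) obtain c where c: "\<And>a. a \<in> A \<Longrightarrow> P a (c a)" by metis
  have "\<forall>a\<in>A. P a (Max (insert 0 (c ` A)))"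
    using assms(1) by (intro ballI assms(3)[OF _ c]) auto
  moreover have "Max (insert 0 (c ` A)) \<ge> 0" using assms(1) by simp
  ultimately show ?thesis by blast
qed

lemma common_multiple_of_positive:
  assumes "finite A" "\<And>a. a \<in> A \<Longrightarrow> \<exists>n::nat. n > 0 \<and> P a n" "\<And>a n m. a \<in> A \<Longrightarrow> P a n \<Longrightarrow> n dvd m \<Longrightarrow> P a m"
  shows "\<exists>N>0. \<forall>a\<in>A. P a N"
proof -
  from assms(2) obtain n where n: "\<And>a. a \<in> A \<Longrightarrow> n a > 0 \<and> P a (n a)" by metis
  have "(\<Prod>a\<in>A. n a) > 0" using n by (intro prod_pos) auto
  moreover have "P a (\<Prod>a\<in>A. n a)" if a: "a \<in> A" for a
    by (rule assms(3)[OF a conjunct2[OF n[OF a]]]) (rule dvd_prodI[OF assms(1) a])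
  ultimately show ?thesis by blast
qed

context hhg_with_constant
begin

lemma orth_commute: "U \<in> dom_set H \<Longrightarrow> V \<in> dom_set H \<Longrightarrow> orth H U V \<longleftrightarrow> orth H V U"
  using orth_sym by (metis symp_onD)

lemma act_unbounded:
  assumes g: "g \<in> carrier G" and W: "W \<in> unbounded_domains H"
  shows "act_dom H g W \<in> unbounded_domains H"
proof -
  have Wd: "W \<in> dom_set H" using W by (rule unbounded_in_dom)
  let ?m = "cspace H W" and ?m' = "cspace H (act_dom H g W)"
  have im: "mspace ?m' = act_space H g W ` mspace ?m"
    using act_space_isometry[OF g Wd] unfolding isometry_onto_def by simp
  have "mdiam ?m (mspace ?m) \<le> mdiam ?m' (mspace ?m')"
    unfolding mdiam_def
  proof (rule SUP_least, clarify)
    fix a b assume "a \<in> mspace ?m" "b \<in> mspace ?m"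
    then show "ennreal (mdist ?m a b) \<le> (SUP (a, b)\<in>mspace ?m' \<times> mspace ?m'. ennreal (mdist ?m' a b))"
      by (intro SUP_upper2[of "(act_space H g W a, act_space H g W b)"])
        (auto simp: im act_space_dist[OF g Wd])
  qed
  then show ?thesis using W g Wd by (auto simp: unbounded_domains_def act_dom_closed top_unique)
qed

text \<open>There are finitely many orbits of domains, and the diameter is constant on each of them.\<close>

lemma bounded_domains_uniform:
  "\<exists>D\<ge>0. \<forall>W\<in>dom_set H - unbounded_domains H. \<forall>p\<in>pts W. \<forall>q\<in>pts W. dC W p q \<le> D"
proof -
  let ?O = "orbits G (dom_set H) (act_dom H)"
  let ?P = "\<lambda>\<O> D. \<forall>W\<in>\<O> - unbounded_domains H. \<forall>p\<in>pts W. \<forall>q\<in>pts W. dC W p q \<le> D"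
  have "\<exists>D\<ge>0. \<forall>\<O>\<in>?O. ?P \<O> D"
  proof (rule uniform_bound[OF cofinite])
    fix \<O> assume "\<O> \<in> ?O"
    then obtain W0 where W0: "W0 \<in> dom_set H" "\<O> = orbit G (act_dom H) W0" by (auto simp: orbits_def)
    show "\<exists>c. ?P \<O> c"
    proof (cases "W0 \<in> unbounded_domains H")
      case True
      then have "\<O> \<subseteq> unbounded_domains H" using W0 act_unbounded by (auto simp: orbit_def)
      then show ?thesis by auto
    next
      case False
      then have fin: "mdiam (cspace H W0) (pts W0) \<noteq> \<infinity>"
        using W0 by (simp add: unbounded_domains_def)
      then obtain D where D: "mdiam (cspace H W0) (pts W0) = ennreal D" "D \<ge> 0"
        by (cases "mdiam (cspace H W0) (pts W0)") auto
      have "dC W p q \<le> D" if W: "W \<in> \<O>" and p: "p \<in> pts W" and q: "q \<in> pts W" for W p q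
      proof -
        obtain g where g: "g \<in> carrier G" "W = act_dom H g W0" using W W0 by (auto simp: orbit_def)
        have im: "pts W = act_space H g W0 ` pts W0"
          using act_space_isometry[OF g(1) W0(1)] g(2) unfolding isometry_onto_def by simp
        then obtain a b where ab: "a \<in> pts W0" "p = act_space H g W0 a"
          "b \<in> pts W0" "q = act_space H g W0 b" using p q by auto
        then have "dC W p q = dC W0 a b" using act_space_dist[OF g(1) W0(1)] g(2) by simp
        also have "\<dots> \<le> D" by (rule mdiam_le_imp[OF eq_refl[OF D(1)]]) (use ab D in auto)
        finally show ?thesis .
      qed
      then show ?thesis by blast
    qed
  next
    fix \<O> c c' assume "?P \<O> c" "c \<le> (c'::real)"
    then show "?P \<O> c'" by (meson order_trans)
  qed
  then obtain D where D: "D \<ge> 0" "\<forall>\<O>\<in>?O. ?P \<O> D" by blast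
  have "W \<in> orbit G (act_dom H) W" "orbit G (act_dom H) W \<in> ?O" if "W \<in> dom_set H" for W
    using that act_dom_one by (auto simp: orbit_def orbits_def intro: exI[of _ \<one>])
  then show ?thesis using D by (intro exI[of _ D]) blast
qed

lemma finite_word_ball: "finite {g \<in> carrier G. word_length G S g \<le> n}"
proof -
  let ?L = "{ws. set ws \<subseteq> S \<union> m_inv G ` S \<and> length ws \<le> n}"
  have "finite ?L" using finite_gens by (intro finite_lists_length_le) auto
  moreover have "{g \<in> carrier G. word_length G S g \<le> n} \<subseteq> (\<lambda>ws. foldr (mult G) ws \<one>) ` ?L"
  proof
    fix g assume "g \<in> {g \<in> carrier G. word_length G S g \<le> n}"
    then have g: "g \<in> carrier G" "word_length G S g \<le> n" by auto
    obtain ws where "length ws = word_length G S g" "set ws \<subseteq> S \<union> m_inv G ` S" "foldr (mult G) ws \<one> = g"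
      by (rule word_length_witness[OF is_group gens g(1)])
    then show "g \<in> (\<lambda>ws. foldr (mult G) ws \<one>) ` ?L" using g(2) by (intro image_eqI[of _ _ ws]) auto
  qed
  ultimately show ?thesis by (rule finite_surj)
qed

text \<open>
  Partial realization provides a point \<open>x0\<close> that lies close to \<open>\<rho>\<^sup>U\<^sub>W\<close> for all \<open>W\<close> at the same time. The
  stabilizer of \<open>U\<close> permutes these conditions, so its orbit of \<open>x0\<close> satisfies them as well.
\<close>

lemma rho_orbit_bound:
  assumes U: "U \<in> dom_set H"
  shows "\<exists>x0\<in>carrier G. \<forall>g\<in>carrier G. act_dom H g U = U \<longrightarrow>
    (\<forall>W\<in>dom_set H. pnest H U W \<or> transverse H U W \<longrightarrow>
      (\<forall>x\<in>cproj H W (g \<otimes> x0). \<forall>r\<in>rho_set H U W. dC W x r \<le> 3 * E + 1))"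
proof -
  obtain p where p: "p \<in> cproj H U \<one>" using proj_nonempty[OF U one_closed] by auto
  have "\<exists>x\<in>mspace (word_metric G S). \<forall>U\<in>{U}. cdist H U (cproj H U x) {p} \<le> ennreal E \<and>
        (\<forall>V\<in>dom_set H. pnest H U V \<or> transverse H U V \<longrightarrow>
           cdist H V (cproj H V x) (rho_set H U V) \<le> ennreal E)"
    by (rule partial_realization[of "{U}" "\<lambda>_. p"]) (use U p proj_mem[OF U one_closed] in auto)
  then obtain x0 where x0: "x0 \<in> carrier G" "\<And>V. V \<in> dom_set H \<Longrightarrow> pnest H U V \<or> transverse H U V \<Longrightarrow>
           cdist H V (cproj H V x0) (rho_set H U V) \<le> ennreal E" by auto
  show ?thesis
  proof (intro bexI[of _ x0] ballI impI)
    fix g W x r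
    assume g: "g \<in> carrier G" "act_dom H g U = U" and W: "W \<in> dom_set H" "pnest H U W \<or> transverse H U W"
      and x: "x \<in> cproj H W (g \<otimes> x0)" and r: "r \<in> rho_set H U W"
    let ?W = "act_dom H (inv g) W"
    have Wd: "?W \<in> dom_set H" using g W act_dom_closed by simp
    have gW: "act_dom H g ?W = W" using act_dom_inv(2)[OF g(1) W(1)] .
    have gU: "act_dom H (inv g) U = U" using act_dom_inv_fixed[OF g(1) U g(2)] .
    have rel: "pnest H U ?W \<or> transverse H U ?W"
    proof -
      have "nest H U ?W \<longleftrightarrow> nest H U W" "transverse H U ?W \<longleftrightarrow> transverse H U W"
        using act_dom_relations[OF inv_closed[OF g(1)] U W(1)] gU by auto
      moreover have "U = ?W \<longrightarrow> U = W" using gW g(2) by auto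
      ultimately show ?thesis using W(2) unfolding pnest_def by auto
    qed
    have "cproj H W (g \<otimes> x0) = act_space H g ?W ` cproj H ?W x0"
      using proj_equivariant[OF g(1) x0(1) Wd] gW by simp
    then obtain x' where x': "x' \<in> cproj H ?W x0" "x = act_space H g ?W x'" using x by auto
    have tr: "transverse H ?W U \<or> pnest H U ?W"
      using rel orth_commute[OF U Wd] unfolding transverse_def by auto
    have "rho_set H U W = act_space H g ?W ` rho_set H U ?W"
      using rho_equivariant[OF g(1) Wd U tr] gW g(2) by simp
    then obtain r' where r': "r' \<in> rho_set H U ?W" "r = act_space H g ?W r'" using r by auto
    have sub: "rho_set H U ?W \<subseteq> pts ?W" "cdiam H ?W (rho_set H U ?W) \<le> ennreal E"
      using rel rho_set_diam[OF U Wd] rho_transverse[OF U Wd] by auto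
    have "dC ?W x' r' \<le> 3 * E + 1"
      by (rule rho_points_close[OF Wd x0(1) _ sub x0(2)[OF Wd rel] x'(1) r'(1)]) (use r' in auto)
    moreover have "dC W x r = dC ?W x' r'"
      using act_space_dist[OF g(1) Wd, of x' r'] gW x' r' sub proj_mem[OF Wd x0(1)] by auto
    ultimately show "dC W x r \<le> 3 * E + 1" by simp
  qed (rule x0(1))
qed

text \<open>
  By the uniqueness axiom it is enough to bound the distance in every domain \<open>W\<close>, uniformly in \<open>n\<close>. If \<open>W\<close> is nested
  in \<open>U\<close>, then \<open>h\<close> acts trivially on it. If \<open>W\<close> is orthogonal to \<open>U\<close>, then \<open>g\<close> acts trivially on it
  and on its translate by \<open>h\<close>. For all other unbounded \<open>W\<close> both \<open>g\<^sup>n\<close> and \<open>h g\<^sup>n\<close> preserve \<open>U\<close> and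
  therefore stay near \<open>\<rho>\<^sup>U\<^sub>W\<close>.
\<close>

lemma rigid_almost_commute:
  assumes g: "rigidly_fully_supported G S H g U" and h: "rigidly_fully_supported G S H h V" and UV: "orth H U V"
  shows "\<exists>D. \<forall>n::nat. dG (g [^] n \<otimes> h) (h \<otimes> g [^] n) \<le> D"
proof -
  have gfs: "fully_supported G S H g U" and hfs: "fully_supported G S H h V"
    using g h unfolding rigidly_fully_supported_def by auto
  have gc: "g \<in> carrier G" and hc: "h \<in> carrier G"
    and Uu: "U \<in> unbounded_domains H" and Vu: "V \<in> unbounded_domains H"
    and gU: "act_dom H g U = U" and hV: "act_dom H h V = V"
    and gfix: "\<And>W. W \<in> unbounded_domains H \<Longrightarrow> orth H W U \<Longrightarrow> act_dom H g W = W"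
    and hfix: "\<And>W. W \<in> unbounded_domains H \<Longrightarrow> orth H W V \<Longrightarrow> act_dom H h W = W"
    using gfs hfs unfolding fully_supported_def axial_def by auto
  have gtriv: "act_space H g W p = p" if "W \<in> unbounded_domains H" "orth H W U" "p \<in> pts W" for W p
    using g that unfolding rigidly_fully_supported_def by auto
  have htriv: "act_space H h W p = p" if "W \<in> unbounded_domains H" "orth H W V" "p \<in> pts W" for W p
    using h that unfolding rigidly_fully_supported_def by auto
  have Ud: "U \<in> dom_set H" and Vd: "V \<in> dom_set H" using Uu Vu unbounded_in_dom by auto
  have hU: "act_dom H h U = U" using hfix[OF Uu UV] .
  have gnU: "act_dom H (g [^] n) U = U" for n :: nat
    using act_dom_int_pow[OF gc Ud gU, of "int n"] by (simp add: int_pow_int)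
  obtain D where D: "D \<ge> 0" and bdd: "\<And>W p q. W \<in> dom_set H - unbounded_domains H \<Longrightarrow>
    p \<in> pts W \<Longrightarrow> q \<in> pts W \<Longrightarrow> dC W p q \<le> D"
    using bounded_domains_uniform by blast
  obtain x0 where x0: "x0 \<in> carrier G" and near: "\<And>k W x r. k \<in> carrier G \<Longrightarrow> act_dom H k U = U \<Longrightarrow>
      W \<in> dom_set H \<Longrightarrow> pnest H U W \<or> transverse H U W \<Longrightarrow>
      x \<in> cproj H W (k \<otimes> x0) \<Longrightarrow> r \<in> rho_set H U W \<Longrightarrow> dC W x r \<le> 3 * E + 1"
    using rho_orbit_bound[OF Ud] by blast
  define B where "B = E * dG \<one> h + E * dG x0 h + E * dG x0 \<one> + 12 * E + 4"
  \<comment> \<open>\<open>D\<close> takes care of the bounded domains, \<open>B\<close> of the three cases for unbounded ones\<close>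
  define \<kappa> where "\<kappa> = D + B + 1"
  have B: "B \<ge> E * dG \<one> h + 3 * E + 1" "B \<ge> E" "B \<ge> E * dG x0 h + E * dG x0 \<one> + 12 * E + 4"
    using E_pos by (auto simp: B_def)
  have key: "\<exists>x\<in>cproj H W (g [^] n \<otimes> h). \<exists>y\<in>cproj H W (h \<otimes> g [^] n). dC W x y \<le> D + B"
    if W: "W \<in> dom_set H" for W and n :: nat
  proof -
    let ?k = "g [^] n"
    have kc: "?k \<in> carrier G" using gc by simp
    obtain x y where x: "x \<in> cproj H W (?k \<otimes> h)" and y: "y \<in> cproj H W (h \<otimes> ?k)"
      using proj_nonempty[OF W m_closed[OF kc hc]] proj_nonempty[OF W m_closed[OF hc kc]] by blast
    have xm: "x \<in> pts W" and ym: "y \<in> pts W"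
      using proj_mem[OF W] x y kc hc by auto
    have "dC W x y \<le> D + B"
    proof (cases "W \<in> unbounded_domains H")
      case False
      then show ?thesis using bdd[OF _ xm ym] W B E_pos by simp
    next
      case Wu: True
      consider "nest H W U" | "orth H W U" | "pnest H U W \<or> transverse H U W"
        using nest_refl W orth_commute[OF Ud W] unfolding pnest_def transverse_def by auto
      then show ?thesis
      proof cases
        case 1
        have WV: "orth H W V" using orth_nest[OF W Ud Vd 1 UV] .
        have "cproj H W (h \<otimes> ?k) = act_space H h W ` cproj H W ?k"
          using proj_equivariant[OF hc kc W] hfix[OF Wu WV] by simp
        also have "\<dots> = cproj H W ?k"
          using htriv[OF Wu WV] proj_mem[OF W kc] by (simp cong: image_cong)
        finally have "dC W x y \<le> E * dG (?k \<otimes> h) ?k + 3 * E + 1"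
          using proj_lipschitz_points[OF W _ kc x] y kc hc by simp
        moreover have "dG (?k \<otimes> h) ?k = dG \<one> h"
          using dG_left_invariant[OF kc hc one_closed] kc by (simp add: mdist_commute)
        ultimately show ?thesis using B D by simp
      next
        case 2
        have fixk: "act_dom H ?k W = W" and trivk: "\<And>p. p \<in> pts W \<Longrightarrow> act_space H ?k W p = p"
          if "W \<in> unbounded_domains H" "orth H W U" for W
          using act_dom_int_pow[OF gc unbounded_in_dom[OF that(1)] gfix[OF that], of "int n"]
            act_space_int_pow_trivial[OF gc unbounded_in_dom[OF that(1)] gfix[OF that] gtriv[OF that], of _ "int n"]
          by (auto simp: int_pow_int)
        have "cproj H W (?k \<otimes> h) = act_space H ?k W ` cproj H W h"
          using proj_equivariant[OF kc hc W] fixk[OF Wu 2] by simp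
        also have "\<dots> = cproj H W h"
          using trivk[OF Wu 2] proj_mem[OF W hc] by (simp cong: image_cong)
        finally have 1: "cproj H W (?k \<otimes> h) = cproj H W h" .
        let ?W = "act_dom H (inv h) W"
        have Wu': "?W \<in> unbounded_domains H" using act_unbounded[OF inv_closed[OF hc] Wu] .
        then have Wd': "?W \<in> dom_set H" by (rule unbounded_in_dom)
        have WU': "orth H ?W U"
          using act_dom_relations(2)[OF inv_closed[OF hc] W Ud] act_dom_inv_fixed[OF hc Ud hU] 2 by simp
        have hW: "act_dom H h ?W = W" using act_dom_inv(2)[OF hc W] .
        have "cproj H ?W ?k = act_space H ?k ?W ` cproj H ?W \<one>"
          using proj_equivariant[OF kc one_closed Wd'] fixk[OF Wu' WU'] kc by simp
        also have "\<dots> = cproj H ?W \<one>"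
          using trivk[OF Wu' WU'] proj_mem[OF Wd' one_closed] by (simp cong: image_cong)
        finally have "cproj H ?W ?k = cproj H ?W \<one>" .
        then have "cproj H W (h \<otimes> ?k) = cproj H W (h \<otimes> \<one>)"
          using proj_equivariant[OF hc kc Wd'] proj_equivariant[OF hc one_closed Wd'] hW by simp
        then have "dC W x y \<le> E"
          using x y 1 proj_close[OF W hc] hc by simp
        then show ?thesis using B D by simp
      next
        case 3
        have hk: "h \<otimes> ?k \<in> carrier G" "act_dom H (h \<otimes> ?k) U = U"
          using kc hc act_dom_mult[OF hc kc Ud] gnU hU by auto
        have "rho_set H U W \<noteq> {}"
          using 3 rho_set_nonempty[OF W Ud] rho_transverse[OF Ud W] by auto
        then obtain r where r: "r \<in> rho_set H U W" by auto
        have rm: "r \<in> pts W"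
          using 3 r rho_set_diam[OF Ud W] rho_transverse[OF Ud W] by auto
        obtain a b where a: "a \<in> cproj H W (?k \<otimes> x0)" and b: "b \<in> cproj H W (h \<otimes> ?k \<otimes> x0)"
          using proj_nonempty[OF W m_closed[OF kc x0]] proj_nonempty[OF W m_closed[OF hk(1) x0]] by blast
        have am: "a \<in> pts W" and bm: "b \<in> pts W"
          using proj_mem[OF W] a b kc hk x0 by auto
        have ar: "dC W a r \<le> 3 * E + 1" by (rule near[OF kc gnU W 3 a r])
        have br: "dC W b r \<le> 3 * E + 1" by (rule near[OF hk W 3 b r])
        have "dC W x a \<le> E * dG (?k \<otimes> h) (?k \<otimes> x0) + 3 * E + 1"
          by (rule proj_lipschitz_points[OF W _ _ x a]) (use kc hc x0 in auto)
        then have xa: "dC W x a \<le> E * dG x0 h + 3 * E + 1"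
          using dG_left_invariant[OF kc hc x0] by (simp add: mdist_commute)
        have "dC W y b \<le> E * dG (h \<otimes> ?k) (h \<otimes> ?k \<otimes> x0) + 3 * E + 1"
          by (rule proj_lipschitz_points[OF W _ _ y b]) (use hk x0 in auto)
        then have yb: "dC W y b \<le> E * dG x0 \<one> + 3 * E + 1"
          using dG_left_invariant[OF hk(1) one_closed x0] hk(1) by (simp add: mdist_commute)
        have "dC W x y \<le> dC W x a + dC W a y" "dC W a y \<le> dC W a r + dC W r y" "dC W r y \<le> dC W r b + dC W b y"
          by (rule mdist_triangle; use xm ym am bm rm in blast)+
        then show ?thesis using ar br xa yb B(3) D
          by (simp add: mdist_commute[of "cspace H W" r b] mdist_commute[of "cspace H W" b y])
      qed
    qed
    then show ?thesis using x y by blast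
  qed
  have "\<kappa> \<ge> 0" using D B E_pos by (simp add: \<kappa>_def)
  from uniqueness[OF this] obtain \<theta> where \<theta>: "\<And>x y. x \<in> carrier G \<Longrightarrow> y \<in> carrier G \<Longrightarrow> dG x y \<ge> \<theta> \<Longrightarrow>
      \<exists>W\<in>dom_set H. cdist H W (cproj H W x) (cproj H W y) \<ge> ennreal \<kappa>" by auto
  have "dG (g [^] n \<otimes> h) (h \<otimes> g [^] n) \<le> \<theta>" for n :: nat
  proof (rule ccontr)
    assume "\<not> ?thesis"
    then obtain W where W: "W \<in> dom_set H"
      "cdist H W (cproj H W (g [^] n \<otimes> h)) (cproj H W (h \<otimes> g [^] n)) \<ge> ennreal \<kappa>"
      using \<theta>[of "g [^] n \<otimes> h" "h \<otimes> g [^] n"] gc hc by auto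
    obtain x y where "x \<in> cproj H W (g [^] n \<otimes> h)" "y \<in> cproj H W (h \<otimes> g [^] n)" "dC W x y \<le> D + B"
      using key[OF W(1), of n] by blast
    then have "ennreal \<kappa> \<le> ennreal (dC W x y)" and lt: "dC W x y < \<kappa>"
      using order_trans[OF W(2) set_dist_le_dist[of x _ y]] by (auto simp: \<kappa>_def)
    then show False by (simp add: ennreal_le_iff)
  qed
  then show ?thesis by blast
qed

text \<open>
  The elements \<open>(g\<^sup>n h)\<inverse> (h g\<^sup>n)\<close> lie in a finite ball, so two of them coincide, say for \<open>m < n\<close>. Then
  \<open>g\<^sup>n\<^sup>-\<^sup>m\<close> commutes with \<open>h\<close>.
\<close>

lemma rigid_imp_commuting_powers:
  assumes g: "rigidly_fully_supported G S H g U" and h: "rigidly_fully_supported G S H h V" and UV: "orth H U V"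
  shows "\<exists>N::nat. N > 0 \<and> g [^] N \<otimes> h [^] N = h [^] N \<otimes> g [^] N"
proof -
  have gc: "g \<in> carrier G" and hc: "h \<in> carrier G"
    using g h unfolding rigidly_fully_supported_def fully_supported_def axial_def by auto
  obtain D where D: "\<And>n::nat. dG (g [^] n \<otimes> h) (h \<otimes> g [^] n) \<le> D"
    using rigid_almost_commute[OF assms] by blast
  define c where "c n = inv (g [^] n \<otimes> h) \<otimes> (h \<otimes> g [^] n)" for n :: nat
  have "range c \<subseteq> {x \<in> carrier G. word_length G S x \<le> nat \<lceil>D\<rceil>}"
  proof clarify
    fix n
    have "real (word_length G S (c n)) \<le> D"
      using D[of n] gc hc by (simp add: c_def mdist_word_metric[OF is_group gens])
    then show "c n \<in> carrier G \<and> word_length G S (c n) \<le> nat \<lceil>D\<rceil>"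
      using gc hc by (auto simp: c_def) linarith
  qed
  then have "finite (range c)" using finite_word_ball finite_subset by blast
  then have "\<not> inj c" using finite_imageD infinite_UNIV_nat by blast
  then obtain m n where mn: "c m = c n" "m < n" by (metis injI linorder_neqE_nat)
  define N where "N = n - m"
  have N: "N > 0" "n = m + N" using mn by (auto simp: N_def)
  let ?a = "g [^] m" and ?b = "g [^] N"
  have cl: "?a \<in> carrier G" "?b \<in> carrier G" using gc by auto
  have gn: "g [^] n = ?b \<otimes> ?a" using gc N(2) by (simp add: nat_pow_mult add.commute)
  have e: "inv (?a \<otimes> h) \<otimes> (h \<otimes> ?a) = inv (g [^] n \<otimes> h) \<otimes> (h \<otimes> g [^] n)" using mn(1) by (simp add: c_def)
  have "h \<otimes> ?b = ?b \<otimes> h"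
  proof -
    have "inv (g [^] n \<otimes> h) \<otimes> (h \<otimes> g [^] n) = inv (?a \<otimes> h) \<otimes> (inv ?b \<otimes> (h \<otimes> ?b)) \<otimes> ?a"
      using cl hc by (simp add: gn inv_mult_group m_assoc)
    moreover have "inv (?a \<otimes> h) \<otimes> (h \<otimes> ?a) = inv (?a \<otimes> h) \<otimes> h \<otimes> ?a"
      using cl hc by (simp add: m_assoc)
    ultimately have "inv (?a \<otimes> h) \<otimes> h \<otimes> ?a = inv (?a \<otimes> h) \<otimes> (inv ?b \<otimes> (h \<otimes> ?b)) \<otimes> ?a"
      using e by simp
    then have "h = inv ?b \<otimes> (h \<otimes> ?b)" using cl hc by simp
    then have "?b \<otimes> h = ?b \<otimes> (inv ?b \<otimes> (h \<otimes> ?b))" by simp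
    also have "\<dots> = h \<otimes> ?b" using cl hc by (simp flip: m_assoc)
    finally show ?thesis by simp
  qed
  then have "h [^] N \<otimes> ?b = ?b \<otimes> h [^] N" using commute_nat_pow[OF hc cl(2)] by simp
  then show ?thesis using N(1) by metis
qed

end

section \<open>Coordinates along quasi-axes\<close>

context hhg_with_constant
begin

text \<open>
  Here \<open>p\<close> is the orbit of a point \<open>p 0\<close> in the projection of the identity under the \<open>k\<close>-th powers of \<open>g\<close>, and \<open>B\<close> is
  the constant of its nearest-point projection.
\<close>

definition axis_in :: "'u \<Rightarrow> 'g \<Rightarrow> nat \<Rightarrow> real \<Rightarrow> real \<Rightarrow> real \<Rightarrow> (int \<Rightarrow> 'c) \<Rightarrow> bool" where
  "axis_in U g k A B L p \<longleftrightarrow> U \<in> dom_set H \<and> g \<in> carrier G \<and> act_dom H g U = U \<and> A \<ge> 0 \<and> B \<ge> 0 \<and>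
     p 0 \<in> cproj H U \<one> \<and> (\<forall>n. p n = act_space H (g [^] (int k * n)) U (p 0)) \<and>
     quasi_axis (cspace H U) A L p \<and>
     (\<forall>x\<in>pts U. \<forall>n. near_index (cspace H U) p x n \<longrightarrow> (\<forall>j. gp U x (p j) (p n) \<le> B))"

text \<open>
  The choice depends on \<open>z\<close> through the set \<open>cproj H U z\<close> alone. So elements acting trivially on the space of \<open>U\<close> preserve
  the coordinate exactly, not just coarsely.
\<close>

definition coord :: "'u \<Rightarrow> (int \<Rightarrow> 'c) \<Rightarrow> 'g \<Rightarrow> int" where
  "coord U p z = (SOME n. \<exists>x\<in>cproj H U z. near_index (cspace H U) p x n)"

lemma four_point_cspace: "U \<in> dom_set H \<Longrightarrow> four_point (3 * (E + 1)) (cspace H U)"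
  by (rule hyperbolic_imp_four_point[OF hyperbolic geodesic]) (use E_pos in auto)

lemma axis_exists:
  assumes g: "fully_supported G S H g U"
  shows "\<exists>k>0. \<exists>A B L p. axis_in U g k A B L p"
proof -
  have gc: "g \<in> carrier G" and U: "U \<in> dom_set H" and gU: "act_dom H g U = U"
    and lox: "acts_loxodromically G H g U"
    using g unbounded_in_dom unfolding fully_supported_def axial_def by auto
  let ?m = "cspace H U"
  have fixU: "act_dom H (g [^] n) U = U" for n :: int using act_dom_int_pow[OF gc U gU] .
  obtain q where q: "q \<in> mspace ?m" "qi_embedding int_metric ?m (\<lambda>n. act_space H (g [^] n) U q)"
    using lox unfolding acts_loxodromically_def by blast
  then obtain K C where K: "K \<ge> 1" and qi: "qi_embedding_const K C int_metric ?m (\<lambda>n. act_space H (g [^] n) U q)"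
    unfolding qi_embedding_def by blast
  obtain b where b: "b \<in> cproj H U \<one>" using proj_nonempty[OF U one_closed] by auto
  have bm: "b \<in> mspace ?m" using proj_mem[OF U one_closed b] .
  define x where "x n = act_space H (g [^] n) U b" for n :: int
  have cl: "act_space H (g [^] n) U p \<in> mspace ?m" if "p \<in> mspace ?m" for n :: int and p
    using act_space_closed[OF int_pow_closed[OF gc] U that, of n] fixU by simp
  have xm: "x n \<in> mspace ?m" for n unfolding x_def by (rule cl[OF bm])
  have shift: "mdist ?m (x (i + k)) (x (j + k)) = mdist ?m (x i) (x j)" for i j k
  proof -
    have "x (i + k) = act_space H (g [^] k) U (x i)" for i
    proof -
      have "g [^] (i + k) = g [^] k \<otimes> g [^] i" using int_pow_mult[OF gc, of k i] by (simp add: add.commute)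
      then show ?thesis
        using space_action[OF int_pow_closed[OF gc] int_pow_closed[OF gc] U bm, of k i] fixU by (simp add: x_def)
    qed
    then show ?thesis
      using act_space_dist[OF int_pow_closed[OF gc] U xm xm, of k i j] fixU by simp
  qed
  have x0: "x 0 = b" unfolding x_def using act_space_one[OF U bm] by simp
  have low: "real n / K - (C + 2 * dC U b q) \<le> mdist ?m (x 0) (x (int n))" for n
  proof -
    let ?q = "act_space H (g [^] int n) U q"
    have "mdist int_metric 0 (int n) / K - C \<le> mdist ?m (act_space H (g [^] (0::int)) U q) ?q"
      using qi unfolding qi_embedding_const_def mspace_int_metric by blast
    then have "real n / K - C \<le> dC U q ?q" by (simp add: mdist_int_metric act_space_one[OF U q(1)])
    moreover have "dC U (x (int n)) ?q = dC U b q"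
      using act_space_dist[OF int_pow_closed[OF gc] U bm q(1), of "int n"] fixU by (simp add: x_def)
    moreover have "dC U q ?q \<le> dC U q b + dC U b ?q" "dC U b ?q \<le> dC U b (x (int n)) + dC U (x (int n)) ?q"
      by (rule mdist_triangle; use q bm xm cl in blast)+
    ultimately show ?thesis by (simp add: x0 mdist_commute[of ?m q b])
  qed
  have \<delta>: "3 * (E + 1) \<ge> 0" and Kp: "K > 0" using E_pos K by auto
  have rng: "range x \<subseteq> mspace ?m" using xm by blast
  from periodic_quasi_axis[OF four_point_cspace[OF U] \<delta> rng shift Kp low]
  obtain k A L where k: "k > 0" "A \<ge> 0" "L \<ge> 1" "quasi_axis ?m A L (\<lambda>n. x (int k * n))" by blast
  from quasi_axis_projection[OF four_point_cspace[OF U] \<delta> k(4,2,3)]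
  obtain B where "B \<ge> 0" "\<forall>y\<in>mspace ?m. \<forall>n. near_index ?m (\<lambda>n. x (int k * n)) y n \<longrightarrow>
      (\<forall>j. gp U y (x (int k * j)) (x (int k * n)) \<le> B)" by blast
  then have "axis_in U g k A B L (\<lambda>n. x (int k * n))"
    unfolding axis_in_def using U gc gU k b by (simp add: x0) (simp add: x_def)
  then show ?thesis using k(1) by blast
qed

context
  fixes U g k A B L p
  assumes ax: "axis_in U g k A B L p"
begin

lemma axis_facts:
  "U \<in> dom_set H" "g \<in> carrier G" "act_dom H g U = U" "A \<ge> 0" "B \<ge> 0" "p 0 \<in> cproj H U \<one>"
  "\<And>n. p n = act_space H (g [^] (int k * n)) U (p 0)" "quasi_axis (cspace H U) A L p"
  "\<And>x n j. x \<in> pts U \<Longrightarrow> near_index (cspace H U) p x n \<Longrightarrow> gp U x (p j) (p n) \<le> B"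
  using ax unfolding axis_in_def by blast+

lemma axis_mspace: "p n \<in> pts U"
  using axis_facts(8) unfolding quasi_axis_def by blast

lemma coord_near:
  assumes "z \<in> carrier G"
  shows "\<exists>x\<in>cproj H U z. near_index (cspace H U) p x (coord U p z)"
  unfolding coord_def
proof (rule someI_ex)
  obtain x where "x \<in> cproj H U z" using proj_nonempty[OF axis_facts(1) assms] by auto
  then show "\<exists>n. \<exists>x\<in>cproj H U z. near_index (cspace H U) p x n"
    using near_index_exists[of "cspace H U" p x] by blast
qed

lemma coord_of_point:
  assumes z: "z \<in> carrier G" and x: "x \<in> cproj H U z"
    and y: "y \<in> pts U" "near_index (cspace H U) p y n"
  shows "\<bar>of_int (coord U p z) - of_int n\<bar> \<le> dC U x y + E + 2 * B"
proof -
  obtain x' where x': "x' \<in> cproj H U z" "near_index (cspace H U) p x' (coord U p z)"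
    using coord_near[OF z] by blast
  have m: "x \<in> pts U" "x' \<in> pts U"
    using proj_mem[OF axis_facts(1) z] x x' by auto
  have "\<bar>of_int (coord U p z - n)\<bar> \<le> dC U x' y + 2 * B"
    by (rule near_index_close[OF axis_facts(8) axis_facts(9) m(2) y(1) x'(2) y(2)])
  moreover have "dC U x' y \<le> dC U x' x + dC U x y" by (rule mdist_triangle[OF m(2,1) y(1)])
  ultimately show ?thesis using proj_close[OF axis_facts(1) z x'(1) x] by simp
qed

lemma coord_close:
  assumes z: "z \<in> carrier G" "z' \<in> carrier G" and x: "x \<in> cproj H U z" "x' \<in> cproj H U z'"
  shows "\<bar>of_int (coord U p z) - of_int (coord U p z')\<bar> \<le> dC U x x' + 2 * E + 2 * B"
proof -
  obtain y where y: "y \<in> cproj H U z'" "near_index (cspace H U) p y (coord U p z')"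
    using coord_near[OF z(2)] by blast
  have m: "x \<in> pts U" "x' \<in> pts U" "y \<in> pts U"
    using proj_mem[OF axis_facts(1)] z x y by auto
  show ?thesis
    using coord_of_point[OF z(1) x(1) m(3) y(2)] mdist_triangle[OF m] proj_close[OF axis_facts(1) z(2) x(2) y(1)]
    by simp
qed

lemma near_index_base: "near_index (cspace H U) p (p 0) 0"
  using mdist_self[OF axis_mspace[of 0]] by (simp add: near_index_def)

lemma coord_bound:
  assumes z: "z \<in> carrier G" and x: "x \<in> cproj H U z"
  shows "\<bar>of_int (coord U p z)\<bar> \<le> dC U x (p 0) + E + 2 * B"
  using coord_of_point[OF z x axis_mspace near_index_base] by simp

lemma coord_base: "\<bar>of_int (coord U p \<one>)\<bar> \<le> E + 2 * B"
  using coord_bound[OF one_closed axis_facts(6)] mdist_self[OF axis_mspace[of 0]] by simp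

lemma coord_lipschitz:
  assumes z: "z \<in> carrier G" "z' \<in> carrier G"
  shows "\<bar>of_int (coord U p z) - of_int (coord U p z')\<bar> \<le> E * dG z z' + 5 * E + 1 + 2 * B"
proof -
  obtain x x' where x: "x \<in> cproj H U z" "x' \<in> cproj H U z'"
    using proj_nonempty[OF axis_facts(1)] z by blast
  show ?thesis using coord_close[OF z x] proj_lipschitz_points[OF axis_facts(1) z x] by simp
qed

lemma axis_fixed: "act_dom H (g [^] (n::int)) U = U"
  using act_dom_int_pow[OF axis_facts(2,1,3)] .

lemma axis_shift: "act_space H (g [^] (int k * m)) U (p n) = p (n + m)"
proof -
  have "act_space H (g [^] (int k * m) \<otimes> g [^] (int k * n)) U (p 0)
      = act_space H (g [^] (int k * m)) (act_dom H (g [^] (int k * n)) U) (act_space H (g [^] (int k * n)) U (p 0))"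
    by (rule space_action) (use axis_facts(1,2) axis_mspace in auto)
  moreover have "g [^] (int k * m) \<otimes> g [^] (int k * n) = g [^] (int k * (n + m))"
    using int_pow_mult[OF axis_facts(2), of "int k * m" "int k * n"] by (simp add: algebra_simps)
  ultimately show ?thesis using axis_fixed axis_facts(7)[of n] axis_facts(7)[of "n + m"] by simp
qed

lemma coord_translate:
  assumes z: "z \<in> carrier G"
  shows "\<bar>of_int (coord U p (g [^] (int k * m) \<otimes> z)) - of_int (coord U p z) - of_int m\<bar> \<le> 2 * E + 2 * B"
proof -
  let ?h = "g [^] (int k * m)"
  have h: "?h \<in> carrier G" using axis_facts(2) by simp
  obtain x where x: "x \<in> cproj H U (?h \<otimes> z)" "near_index (cspace H U) p x (coord U p (?h \<otimes> z))"
    using coord_near[of "?h \<otimes> z"] h z by auto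
  have "cproj H U (?h \<otimes> z) = act_space H ?h U ` cproj H U z"
    using proj_equivariant[OF h z axis_facts(1)] axis_fixed by simp
  then obtain y where y: "y \<in> cproj H U z" "x = act_space H ?h U y" using x(1) by auto
  have ym: "y \<in> pts U" using proj_mem[OF axis_facts(1) z y(1)] .
  have "dC U y (p j) = dC U x (p (j + m))" for j
    using act_space_dist[OF h axis_facts(1) ym axis_mspace[of j]] axis_fixed axis_shift[of m j] y(2) by simp
  then have "near_index (cspace H U) p y (coord U p (?h \<otimes> z) - m)"
    using x(2) unfolding near_index_def by simp
  from coord_of_point[OF z y(1) ym this] mdist_self[OF ym] E_pos show ?thesis by (simp add: abs_le_iff)
qed

text \<open>
  A bound on the displacement that is uniform over the space makes the error independent of \<open>z\<close>. The bounded
  orbits in the definition of full support provide one such bound for all powers of an element.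
\<close>

lemma coord_elliptic:
  assumes h: "h \<in> carrier G" "act_dom H h U = U" and z: "z \<in> carrier G"
    and Q: "\<And>x. x \<in> pts U \<Longrightarrow> dC U (act_space H h U x) x \<le> Q"
  shows "\<bar>of_int (coord U p (h \<otimes> z)) - of_int (coord U p z)\<bar> \<le> Q + 2 * E + 2 * B"
proof -
  obtain x where x: "x \<in> cproj H U z" using proj_nonempty[OF axis_facts(1) z] by auto
  then have "act_space H h U x \<in> cproj H U (h \<otimes> z)"
    using proj_equivariant[OF h(1) z axis_facts(1)] h(2) by auto
  from coord_close[OF m_closed[OF h(1) z] z this x] Q[OF proj_mem[OF axis_facts(1) z x]]
  show ?thesis by simp
qed

lemma coord_invariant:
  assumes h: "h \<in> carrier G" "act_dom H h U = U" and z: "z \<in> carrier G"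
    and triv: "\<And>x. x \<in> pts U \<Longrightarrow> act_space H h U x = x"
  shows "coord U p (h \<otimes> z) = coord U p z"
proof -
  have "cproj H U (h \<otimes> z) = act_space H h U ` cproj H U z"
    using proj_equivariant[OF h(1) z axis_facts(1)] h(2) by simp
  also have "\<dots> = cproj H U z" using triv proj_mem[OF axis_facts(1) z] by (simp cong: image_cong)
  finally show ?thesis by (simp add: coord_def)
qed

lemma axis_power_in_proj: "p n \<in> cproj H U (g [^] (int k * n))"
  using proj_equivariant[OF int_pow_closed[OF axis_facts(2)] one_closed axis_facts(1), of "int k * n"]
    axis_fixed axis_facts(2,6) axis_facts(7)[of n] by auto

end

text \<open>By consistency one of the projections of \<open>z\<close> is close to a fixed bounded set.\<close>

lemma exclusive_transverse:
  assumes axU: "axis_in U g k A B L p" and axV: "axis_in V h l A' B' L' q" and t: "transverse H U V"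
  shows "\<exists>R::real. \<forall>z\<in>carrier G. \<bar>of_int (coord U p z)\<bar> \<le> R \<or> \<bar>of_int (coord V q z)\<bar> \<le> R"
proof -
  note U = axis_facts[OF axU] and V = axis_facts[OF axV]
  have t': "transverse H V U" using t orth_commute[OF U(1) V(1)] unfolding transverse_def by auto
  obtain r r' where r: "r \<in> rho_set H V U" "r' \<in> rho_set H U V"
    using rho_transverse[OF U(1) V(1) t] rho_transverse[OF V(1) U(1) t'] by blast
  have rm: "r \<in> pts U" "r' \<in> pts V"
    using rho_transverse[OF U(1) V(1) t] rho_transverse[OF V(1) U(1) t'] r by auto
  let ?R = "max (3 * E + 1 + dC U r (p 0) + E + 2 * B) (3 * E + 1 + dC V r' (q 0) + E + 2 * B')"
  show ?thesis
  proof (intro exI[of _ ?R] ballI)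
    fix z assume z: "z \<in> carrier G"
    obtain x y where x: "x \<in> cproj H U z" and y: "y \<in> cproj H V z"
      using proj_nonempty[OF U(1) z] proj_nonempty[OF V(1) z] by auto
    have xm: "x \<in> pts U" and ym: "y \<in> pts V"
      using proj_mem[OF U(1) z x] proj_mem[OF V(1) z y] .
    have "dC U x (p 0) \<le> dC U x r + dC U r (p 0)" "dC V y (q 0) \<le> dC V y r' + dC V r' (q 0)"
      using mdist_triangle[OF xm rm(1) axis_mspace[OF axU]] mdist_triangle[OF ym rm(2) axis_mspace[OF axV]] .
    then show "\<bar>of_int (coord U p z)\<bar> \<le> ?R \<or> \<bar>of_int (coord V q z)\<bar> \<le> ?R"
      using transverse_consistency_points[OF U(1) V(1) t z] x y r
        coord_bound[OF axU z x] coord_bound[OF axV z y] by (auto simp: le_max_iff_disj) (smt (verit))+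
  qed
qed

text \<open>
  Suppose that the coordinate of \<open>z\<close> in \<open>U\<close> is large. Then the orbit point \<open>p\<^sub>t\<close> with \<open>t = \<plusminus>n\<^sub>0\<close> of the same sign
  lies roughly between \<open>p\<^sub>0\<close> and the projection of \<open>z\<close>, far away from \<open>\<rho>\<^sup>V\<^sub>U\<close>. So \<open>z\<close> and the corresponding
  power of \<open>g\<close> have close projections to \<open>V\<close>, and there are only two such powers.
\<close>

lemma exclusive_nested:
  assumes axU: "axis_in U g k A B L p" and axV: "axis_in V h l A' B' L' q" and n: "pnest H V U"
  shows "\<exists>R::real. \<forall>z\<in>carrier G. \<bar>of_int (coord U p z)\<bar> \<le> R \<or> \<bar>of_int (coord V q z)\<bar> \<le> R"
proof -
  note U = axis_facts[OF axU] and V = axis_facts[OF axV]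
  let ?m = "cspace H U" let ?\<delta> = "3 * (E + 1)"
  obtain r where r: "r \<in> rho_set H V U" using rho_set_nonempty[OF U(1) V(1) n] by auto
  have rm: "r \<in> mspace ?m" using rho_set_diam[OF V(1) U(1) n] r by auto
  note pm = axis_mspace[OF axU] and qm = axis_mspace[OF axV]
  define n0 where "n0 = nat \<lceil>A + B + ?\<delta> + dC U (p 0) r + 3 * E + 2\<rceil>"
  have n0: "real n0 > A + B + ?\<delta> + dC U (p 0) r + 3 * E + 1"
    unfolding n0_def using U(4,5) E_pos by linarith
  \<comment> \<open>\<open>c n\<close> bounds the distance in \<open>V\<close> from the identity to any \<open>z\<close> that looks like the \<open>n\<close>-th point of the axis\<close>
  define c where "c n = 3 * E + (E * dG (g [^] (int k * n)) \<one> + 3 * E + 1)" for n :: int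
  let ?R = "max (real n0) (max (c (int n0)) (c (- int n0)) + E + 2 * B')"
  have lo: "\<bar>of_int (i - j)\<bar> \<le> dC U (p i) (p j)" for i j
    using U(8) unfolding quasi_axis_def by blast
  have bet: "gp U (p i) (p j) (p l) \<le> A" if "i \<le> l \<and> l \<le> j \<or> j \<le> l \<and> l \<le> i" for i l j
    using U(8) that gromov_product_commute[of ?m "p i" "p j" "p l"] unfolding quasi_axis_def by metis
  show ?thesis
  proof (intro exI[of _ ?R] ballI)
    fix z assume z: "z \<in> carrier G"
    show "\<bar>of_int (coord U p z)\<bar> \<le> ?R \<or> \<bar>of_int (coord V q z)\<bar> \<le> ?R"
    proof (cases "\<bar>coord U p z\<bar> \<le> int n0")
      case True
      then have "\<bar>of_int (coord U p z) :: real\<bar> \<le> real n0" by linarith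
      then show ?thesis by (simp add: le_max_iff_disj)
    next
      case False
      define s where "s = coord U p z"
      define t where "t = (if s > 0 then int n0 else - int n0)"
      obtain x where x: "x \<in> cproj H U z" "near_index ?m p x s"
        using coord_near[OF axU z] unfolding s_def by blast
      have xm: "x \<in> mspace ?m" using proj_mem[OF U(1) z x(1)] .
      have "gp U x (p s) (p 0) = dC U (p 0) (p s) - gp U x (p 0) (p s)" by (rule gromov_product_swap)
      moreover have "gp U x (p 0) (p s) \<le> B" by (rule U(9)[OF xm x(2)])
      moreover have "dC U (p 0) (p s) \<ge> real n0" using lo[of 0 s] False by (simp add: s_def)
      ultimately have 1: "gp U x (p s) (p 0) \<ge> real n0 - B" by simp
      have "gp U (p s) (p t) (p 0) = dC U (p 0) (p t) - gp U (p s) (p 0) (p t)" by (rule gromov_product_swap)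
      moreover have "gp U (p s) (p 0) (p t) \<le> A"
        by (rule bet) (use False in \<open>auto simp: s_def t_def\<close>)
      moreover have "dC U (p 0) (p t) \<ge> real n0" using lo[of 0 t] by (auto simp: t_def)
      ultimately have 2: "gp U (p s) (p t) (p 0) \<ge> real n0 - A" by simp
      have "gp U x (p t) (p 0) \<ge> real n0 - A - B - ?\<delta>"
        using four_pointD[OF four_point_cspace[OF U(1)] xm pm[of s] pm[of t] pm[of 0]] 1 2 U(4,5) by auto
      moreover have "gp U x (p t) (p 0) \<le> gp U x (p t) r + dC U r (p 0)"
        by (rule gromov_product_base[OF xm pm pm rm])
      ultimately have far: "gp U x (p t) r > 3 * E + 1"
        using n0 by (simp add: mdist_commute[of ?m r "p 0"])
      let ?h = "g [^] (int k * t)"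
      have hc: "?h \<in> carrier G" using U(2) by simp
      obtain y y' where y: "y \<in> cproj H V z" and y': "y' \<in> cproj H V ?h"
        using proj_nonempty[OF V(1) z] proj_nonempty[OF V(1) hc] by blast
      have "dC V y y' \<le> 3 * E"
        by (rule nested_projection_close[OF U(1) V(1) n z hc x(1) axis_power_in_proj[OF axU] y y' r far])
      moreover have "dC V y' (q 0) \<le> E * dG ?h \<one> + 3 * E + 1"
        by (rule proj_lipschitz_points[OF V(1) hc one_closed y' V(6)])
      moreover have "dC V y (q 0) \<le> dC V y y' + dC V y' (q 0)"
        using mdist_triangle[OF proj_mem[OF V(1) z y] proj_mem[OF V(1) hc y'] qm] .
      ultimately have "dC V y (q 0) \<le> c t" by (simp add: c_def)
      also have "c t \<le> max (c (int n0)) (c (- int n0))" by (auto simp: t_def)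
      finally have "\<bar>of_int (coord V q z)\<bar> \<le> max (c (int n0)) (c (- int n0)) + E + 2 * B'"
        using coord_bound[OF axV z y] by linarith
      then show ?thesis by (simp only: le_max_iff_disj) simp
    qed
  qed
qed

lemma exclusive_coords:
  assumes axU: "axis_in U g k A B L p" and axV: "axis_in V h l A' B' L' q"
    and UV: "U \<noteq> V" "\<not> orth H U V"
  shows "\<exists>R::real. \<forall>z\<in>carrier G. \<bar>of_int (coord U p z)\<bar> \<le> R \<or> \<bar>of_int (coord V q z)\<bar> \<le> R"
proof -
  consider "transverse H U V" | "pnest H V U" | "pnest H U V"
    using UV unfolding transverse_def pnest_def by auto
  then show ?thesis
  proof cases
    case 1
    then show ?thesis by (rule exclusive_transverse[OF axU axV])
  next
    case 2
    then show ?thesis by (rule exclusive_nested[OF axU axV])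
  next
    case 3
    from exclusive_nested[OF axV axU this] show ?thesis by (meson disj_commute)
  qed
qed

end

section \<open>Right-angled Artin subgroups\<close>

context hhg_with_constant
begin

text \<open>
  The constants of the ping-pong depend on the chosen quasi-axes only. So the common exponent \<open>N\<close>, which is the shift of
  the coordinates, can be chosen after them. It is also a multiple of an exponent for which orthogonally supported
  elements commute.
\<close>

lemma raag_from_fully_supported:
  fixes \<Lambda> :: "'u graph" and g :: "'u \<Rightarrow> 'g"
  assumes fin: "finite (verts \<Lambda>)"
    and ind: "induced_subgraph \<Lambda> (orthogonality_graph H)"
    and g: "\<And>U. U \<in> verts \<Lambda> \<Longrightarrow> fully_supported G S H (g U) U"
    and comm: "\<And>U V. U \<in> verts \<Lambda> \<Longrightarrow> V \<in> verts \<Lambda> \<Longrightarrow> orth H U V \<Longrightarrow>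
      \<exists>N::nat. N > 0 \<and> g U [^] N \<otimes> g V [^] N = g V [^] N \<otimes> g U [^] N"
  shows "\<exists>K. subgroup K G \<and> G\<lparr>carrier := K\<rparr> \<cong> raag \<Lambda> \<and>
    ((\<forall>U\<in>verts \<Lambda>. rigidly_fully_supported G S H (g U) U) \<longrightarrow> undistorted_subgroup G S K)"
proof -
  let ?V = "verts \<Lambda>"
  have Vu: "?V \<subseteq> unbounded_domains H"
    using ind by (auto simp: induced_subgraph_def orthogonality_graph_def)
  have Vd: "U \<in> dom_set H" if "U \<in> ?V" for U using that Vu unbounded_in_dom by blast
  define adj where "adj U V \<longleftrightarrow> U \<in> ?V \<and> V \<in> ?V \<and> orth H U V" for U V
  have adj_sym: "adj U V \<Longrightarrow> adj V U" for U V
    unfolding adj_def using orth_commute Vd by blast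
  have adj_irrefl: "\<not> adj U U" for U
    unfolding adj_def using orth_irrefl Vd by (meson irreflp_onD)
  have adj_edges: "adj U V \<longleftrightarrow> {U, V} \<in> edges \<Lambda>" if "U \<in> ?V" "V \<in> ?V" for U V
  proof
    assume "adj U V"
    then have "U \<noteq> V" "orth H U V" using adj_irrefl unfolding adj_def by auto
    then have "{U, V} \<in> edges (orthogonality_graph H)"
      using that Vu unfolding orthogonality_graph_def by auto
    then show "{U, V} \<in> edges \<Lambda>"
      using ind that unfolding induced_subgraph_def by auto
  next
    assume "{U, V} \<in> edges \<Lambda>"
    then obtain U' V' where "{U, V} = {U', V'}" "orth H U' V'"
      using ind unfolding induced_subgraph_def orthogonality_graph_def by auto
    then have "orth H U V \<or> orth H V U" by (auto simp: doubleton_eq_iff)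
    then show "adj U V" using that orth_commute Vd unfolding adj_def by blast
  qed
  have gc: "g U \<in> carrier G" if "U \<in> ?V" for U
    using g[OF that] unfolding fully_supported_def axial_def by blast
  have "\<forall>U\<in>?V. \<exists>k A B L p. k > 0 \<and> axis_in U (g U) k A B L p" using axis_exists g by blast
  then obtain k A B L p where kA: "\<And>U. U \<in> ?V \<Longrightarrow> k U > 0 \<and> axis_in U (g U) (k U) (A U) (B U) (L U) (p U)"
    by metis
  then have ax: "\<And>U. U \<in> ?V \<Longrightarrow> axis_in U (g U) (k U) (A U) (B U) (L U) (p U)" by blast
  define s where "s U z = (of_int (coord U (p U) z) :: real)" for U z
  have fixV: "act_dom H (g U) V = V" if "adj U V" for U V
    using g[of U] that adj_sym[OF that] Vu unfolding fully_supported_def adj_def by blast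
  have ell: "\<exists>Q. \<forall>z\<in>carrier G. \<forall>m::int. \<bar>s V (g U [^] m \<otimes> z) - s V z\<bar> \<le> Q" if UV: "adj U V" for U V
  proof -
    have U: "U \<in> ?V" and V: "V \<in> ?V" using UV unfolding adj_def by auto
    have "V \<in> unbounded_domains H" "orth H V U" using UV adj_sym Vu unfolding adj_def by auto
    then obtain Q where Q: "Q \<ge> 0" "\<And>x. x \<in> pts V \<Longrightarrow>
        cdiam H V {act_space H (g U [^] n) V x | n :: int. True} \<le> ennreal Q"
      using g[OF U] unfolding fully_supported_def by blast
    have close: "mdist (cspace H V) (act_space H (g U [^] m) V x) x \<le> Q" if x: "x \<in> pts V" for x and m :: int
    proof (rule mdiam_le_imp[OF Q(2)[OF x] _ _ Q(1)])
      show "act_space H (g U [^] m) V x \<in> {act_space H (g U [^] n) V x | n :: int. True}" by blast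
      have "x = act_space H (g U [^] (0::int)) V x" using act_space_one[OF Vd[OF V] x] by simp
      then show "x \<in> {act_space H (g U [^] n) V x | n :: int. True}" by blast
    qed
    have "\<bar>s V (g U [^] m \<otimes> z) - s V z\<bar> \<le> Q + 2 * E + 2 * B V" if "z \<in> carrier G" for z and m :: int
      unfolding s_def
      by (rule coord_elliptic[OF ax[OF V] int_pow_closed[OF gc[OF U]] act_dom_int_pow[OF gc[OF U] Vd[OF V] fixV[OF UV]] that close])
    then show ?thesis by blast
  qed
  have "\<exists>C\<ge>0. \<forall>a\<in>?V \<times> ?V. adj (fst a) (snd a) \<longrightarrow>
      (\<forall>z\<in>carrier G. \<forall>m::int. \<bar>s (snd a) (g (fst a) [^] m \<otimes> z) - s (snd a) z\<bar> \<le> C)"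
    (is "\<exists>C\<ge>0. \<forall>a\<in>_. ?P a C")
  proof (rule uniform_bound)
    show "finite (?V \<times> ?V)" using fin by simp
    show "\<exists>c. ?P a c" for a using ell[of "fst a" "snd a"] by blast
    show "?P a c'" if "?P a c" "c \<le> c'" for a c c' using that by (meson order_trans)
  qed
  then obtain C1 where C1: "C1 \<ge> 0" "\<And>U V z m. U \<in> ?V \<Longrightarrow> V \<in> ?V \<Longrightarrow> adj U V \<Longrightarrow> z \<in> carrier G \<Longrightarrow>
      \<bar>s V (g U [^] (m::int) \<otimes> z) - s V z\<bar> \<le> C1" by fastforce
  have "\<exists>C\<ge>0. \<forall>U\<in>?V. B U \<le> C"
    using fin by (intro uniform_bound) (auto intro: order_trans)
  then obtain B0 where B0: "B0 \<ge> 0" "\<And>U. U \<in> ?V \<Longrightarrow> B U \<le> B0" by blast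
  have "\<exists>R\<ge>0. \<forall>a\<in>?V \<times> ?V. fst a \<noteq> snd a \<and> \<not> adj (fst a) (snd a) \<longrightarrow>
      (\<forall>z\<in>carrier G. \<bar>s (fst a) z\<bar> \<le> R \<or> \<bar>s (snd a) z\<bar> \<le> R)"
    (is "\<exists>R\<ge>0. \<forall>a\<in>_. ?P a R")
  proof (rule uniform_bound)
    show "finite (?V \<times> ?V)" using fin by simp
    show "\<exists>c. ?P a c" if a: "a \<in> ?V \<times> ?V" for a
    proof (cases "fst a \<noteq> snd a \<and> \<not> adj (fst a) (snd a)")
      case True
      then have "fst a \<noteq> snd a" "\<not> orth H (fst a) (snd a)" using a unfolding adj_def by auto
      then show ?thesis
        using exclusive_coords[OF ax[of "fst a"] ax[of "snd a"]] a unfolding s_def by auto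
    qed blast
    show "?P a c'" if "?P a c" "c \<le> c'" for a c c' using that by (meson order_trans)
  qed
  then obtain R1 where R1: "R1 \<ge> 0" "\<And>U V z. U \<in> ?V \<Longrightarrow> V \<in> ?V \<Longrightarrow> U \<noteq> V \<Longrightarrow> \<not> adj U V \<Longrightarrow> z \<in> carrier G \<Longrightarrow>
      \<bar>s U z\<bar> \<le> R1 \<or> \<bar>s V z\<bar> \<le> R1" by fastforce
  define commutes where "commutes a N \<longleftrightarrow> (adj (fst a) (snd a) \<longrightarrow>
      g (fst a) [^] N \<otimes> g (snd a) [^] N = g (snd a) [^] N \<otimes> g (fst a) [^] N)" for a and N :: nat
  have "\<exists>N>0. \<forall>a\<in>?V \<times> ?V. commutes a N"
  proof (rule common_multiple_of_positive)
    show "finite (?V \<times> ?V)" using fin by simp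
    show "\<exists>n>0. commutes a n" if "a \<in> ?V \<times> ?V" for a
      using comm[of "fst a" "snd a"] that unfolding commutes_def adj_def
      by (cases "orth H (fst a) (snd a)") auto
    fix a and n m :: nat assume a: "a \<in> ?V \<times> ?V" and *: "commutes a n" and "n dvd m"
    then obtain j where m: "m = n * j" by blast
    have c: "g (fst a) [^] n \<in> carrier G" "g (snd a) [^] n \<in> carrier G" using a gc by auto
    show "commutes a m"
      unfolding commutes_def
    proof
      assume "adj (fst a) (snd a)"
      then have "g (fst a) [^] n \<otimes> g (snd a) [^] n = g (snd a) [^] n \<otimes> g (fst a) [^] n"
        using * unfolding commutes_def by blast
      from commute_int_pow[OF c this, of "int j" "int j"]
      show "g (fst a) [^] m \<otimes> g (snd a) [^] m = g (snd a) [^] m \<otimes> g (fst a) [^] m"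
        using a gc by (auto simp: int_pow_int m nat_pow_pow)
    qed
  qed
  then obtain N0 :: nat where N0: "N0 > 0" and N0_comm: "\<forall>a\<in>?V \<times> ?V. commutes a N0" by blast
  define C where "C = max C1 (2 * E + 2 * B0)"
  define R where "R = max R1 (E + 2 * B0)"
  define K where "K = 6 * E + 1 + 2 * B0"
  define M where "M = nat \<lceil>2 * R + (real (card ?V) + 1) * C + K + 1\<rceil> + 1"
  define N where "N = N0 * M"
  define T where "T = real N"
  have C0: "C \<ge> 0" and R0: "R \<ge> 0" and K0: "K \<ge> 0" using C1 R1 B0 E_pos by (auto simp: C_def R_def K_def)
  have "real M > 2 * R + (real (card ?V) + 1) * C + K + 1" unfolding M_def by linarith
  moreover have "M \<le> N" using N0 by (simp add: N_def)
  then have "real M \<le> real N" by simp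
  ultimately have T: "T > 2 * R + (real (card ?V) + 1) * C + K + 1" unfolding T_def by linarith
  define f where "f U = g U [^] (int (k U * N))" for U
  have fpow: "f U [^] (e::int) = g U [^] (int (k U) * (int N * e))" if "U \<in> ?V" for U e
    using int_pow_pow[OF gc[OF that]] by (simp add: f_def algebra_simps)
  interpret coarse_ping_pong G ?V adj f s R C T
  proof unfold_locales
    show "adj u v \<Longrightarrow> adj v u" for u v by (rule adj_sym)
    show "\<not> adj v v" for v by (rule adj_irrefl)
    show "v \<in> ?V \<Longrightarrow> f v \<in> carrier G" for v using gc by (simp add: f_def)
    show "f u \<otimes> f v = f v \<otimes> f u" if "u \<in> ?V" "v \<in> ?V" "adj u v" for u v
    proof -
      have c: "g u [^] N0 \<in> carrier G" "g v [^] N0 \<in> carrier G" using gc that by auto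
      have comm0: "g u [^] N0 \<otimes> g v [^] N0 = g v [^] N0 \<otimes> g u [^] N0"
        using N0_comm[rule_format, of "(u, v)"] that by (simp add: commutes_def)
      have f: "f w = (g w [^] N0) [^] int (k w * M)" if "w \<in> ?V" for w
        using int_pow_pow[OF gc[OF that], of "int N0" "int (k w * M)"]
        by (simp add: f_def N_def int_pow_int mult.commute mult.left_commute)
      show ?thesis using commute_int_pow[OF c comm0] f that by simp
    qed
    show "finite ?V" by (rule fin)
    show "R \<ge> 0" "C \<ge> 0" by (rule R0 C0)+
    show "\<bar>s v \<one>\<bar> \<le> R" if "v \<in> ?V" for v
      using coord_base[OF ax[OF that]] B0(2)[OF that] by (auto simp: s_def R_def)
    show "\<bar>s v (f v [^] e \<otimes> z) - s v z - of_int e * T\<bar> \<le> C" if "v \<in> ?V" "z \<in> carrier G" for v z and e :: int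
      using coord_translate[OF ax[OF that(1)] that(2), of "int N * e"] B0(2)[OF that(1)] fpow[OF that(1), of e]
      by (simp add: s_def C_def T_def mult.commute le_max_iff_disj)
    show "\<bar>s v (f u [^] e \<otimes> z) - s v z\<bar> \<le> C" if "u \<in> ?V" "v \<in> ?V" "adj u v" "z \<in> carrier G" for u v z and e :: int
      using C1(2)[OF that] fpow[OF that(1), of e] by (simp add: C_def le_max_iff_disj)
    show "\<bar>s u z\<bar> \<le> R \<or> \<bar>s v z\<bar> \<le> R" if "u \<in> ?V" "v \<in> ?V" "u \<noteq> v" "\<not> adj u v" "z \<in> carrier G" for u v z
      using R1(2)[OF that] by (auto simp: R_def)
    show "T > 2 * R + (real (card ?V) + 1) * C" using T K0 by linarith
  qed
  let ?K = "generate G (f ` ?V)"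
  have sub: "subgroup ?K G" by (rule generate_is_subgroup) (use f_closed in auto)
  have iso: "G\<lparr>carrier := ?K\<rparr> \<cong> raag \<Lambda>" by (rule raag_embedding(1)) (use adj_edges in auto)
  have und: "undistorted_subgroup G S ?K" if rig: "\<forall>U\<in>?V. rigidly_fully_supported G S H (g U) U"
  proof -
    interpret rigid_ping_pong G ?V adj f s R C T
    proof unfold_locales
      fix u v z and e :: int assume uv: "u \<in> ?V" "v \<in> ?V" "adj u v" and z: "z \<in> carrier G"
      have v: "v \<in> unbounded_domains H" "orth H v u" using uv adj_sym Vu unfolding adj_def by auto
      have triv: "act_space H (g u) v x = x" if "x \<in> pts v" for x
        using rig uv(1) v that unfolding rigidly_fully_supported_def by blast
      have "coord v (p v) (g u [^] m \<otimes> z) = coord v (p v) z" for m :: int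
        by (rule coord_invariant[OF ax[OF uv(2)] int_pow_closed[OF gc[OF uv(1)]]
              act_dom_int_pow[OF gc[OF uv(1)] Vd[OF uv(2)] fixV[OF uv(3)]] z
              act_space_int_pow_trivial[OF gc[OF uv(1)] Vd[OF uv(2)] fixV[OF uv(3)] triv]])
      then show "s v (f u [^] e \<otimes> z) = s v z" by (simp add: s_def fpow[OF uv(1)])
    qed
    show ?thesis
    proof (rule raag_undistorted[OF HOL.refl adj_edges gens K0])
      fix v z \<sigma> assume v: "v \<in> ?V" and z: "z \<in> carrier G" and \<sigma>: "\<sigma> \<in> S \<union> m_inv G ` S"
      have c: "\<sigma> \<in> carrier G" using \<sigma> gens by (auto simp: generating_set_def)
      have "\<bar>s v (z \<otimes> \<sigma>) - s v z\<bar> \<le> E * dG (z \<otimes> \<sigma>) z + 5 * E + 1 + 2 * B v"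
        unfolding s_def by (rule coord_lipschitz[OF ax[OF v]]) (use z c in auto)
      moreover have "E * dG (z \<otimes> \<sigma>) z \<le> E * 1"
        using dG_le_one[OF z \<sigma>] E_pos by (intro mult_left_mono) (auto simp: mdist_commute)
      ultimately show "\<bar>s v (z \<otimes> \<sigma>) - s v z\<bar> \<le> K" using B0(2)[OF v] by (simp add: K_def)
    next
      have "C \<le> (real (card ?V) + 1) * C" using C0 by (simp add: algebra_simps)
      then show "T \<ge> 2 * R + C + K + 1" using T by linarith
    qed auto
  qed
  show ?thesis using sub iso und by blast
qed

end

theorem theorem5:
  fixes G :: "('g, 'b) monoid_scheme"
    and S :: "'g set"
    and H :: "('g, 'u, 'c, 'm) hhg_data_scheme"
    and \<Lambda> :: "'u graph"
  assumes "hhg G S H"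
    and "induced_subgraph \<Lambda> (orthogonality_graph H)"
    and "finite (verts \<Lambda>)"
  shows "(weak_commutativity G S H \<and> (\<forall>U\<in>unbounded_domains H. \<exists>g. fully_supported G S H g U) \<longrightarrow>
            (\<exists>K. subgroup K G \<and> G\<lparr>carrier := K\<rparr> \<cong> raag \<Lambda>)) \<and>
         ((\<forall>U\<in>unbounded_domains H. \<exists>g. rigidly_fully_supported G S H g U) \<longrightarrow>
            (\<exists>K. undistorted_subgroup G S K \<and> G\<lparr>carrier := K\<rparr> \<cong> raag \<Lambda>))"
proof -
  interpret hhg G S H by fact
  obtain E where "hhs_const (word_metric G S) H E" using is_hhs unfolding hhs_def by blast
  then interpret hhs_const "word_metric G S" H E .
  interpret hhg_with_constant G S H E by unfold_locales
  have Vu: "verts \<Lambda> \<subseteq> unbounded_domains H"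
    using assms(2) by (auto simp: induced_subgraph_def orthogonality_graph_def)
  let ?comm = "\<lambda>x y. \<exists>N::nat. N > 0 \<and>
    x [^]\<^bsub>G\<^esub> N \<otimes>\<^bsub>G\<^esub> y [^]\<^bsub>G\<^esub> N = y [^]\<^bsub>G\<^esub> N \<otimes>\<^bsub>G\<^esub> x [^]\<^bsub>G\<^esub> N"
  show ?thesis
  proof (intro conjI impI)
    assume *: "weak_commutativity G S H \<and> (\<forall>U\<in>unbounded_domains H. \<exists>g. fully_supported G S H g U)"
    then obtain g where g: "\<And>U. U \<in> unbounded_domains H \<Longrightarrow> fully_supported G S H (g U) U" by metis
    have comm: "?comm (g U) (g V)"
      if "U \<in> verts \<Lambda>" "V \<in> verts \<Lambda>" "orth H U V" for U V
    proof -
      have UV: "U \<in> unbounded_domains H" "V \<in> unbounded_domains H" using that Vu by auto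
      then show ?thesis using * that g unfolding weak_commutativity_def by blast
    qed
    show "\<exists>K. subgroup K G \<and> G\<lparr>carrier := K\<rparr> \<cong> raag \<Lambda>"
      using raag_from_fully_supported[OF assms(3,2), of g] g Vu comm by blast
  next
    assume "\<forall>U\<in>unbounded_domains H. \<exists>g. rigidly_fully_supported G S H g U"
    then obtain g where g: "\<And>U. U \<in> unbounded_domains H \<Longrightarrow> rigidly_fully_supported G S H (g U) U" by metis
    then have fs: "\<And>U. U \<in> unbounded_domains H \<Longrightarrow> fully_supported G S H (g U) U"
      unfolding rigidly_fully_supported_def by blast
    have comm: "?comm (g U) (g V)"
      if "U \<in> verts \<Lambda>" "V \<in> verts \<Lambda>" "orth H U V" for U V
      using rigid_imp_commuting_powers[OF g g that(3)] that Vu by blast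
    show "\<exists>K. undistorted_subgroup G S K \<and> G\<lparr>carrier := K\<rparr> \<cong> raag \<Lambda>"
      using raag_from_fully_supported[OF assms(3,2), of g] g fs Vu comm by blast
  qed
qed

end
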